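(* Assume $\mathbf\Theta[A,C;B,D]\ne\varnothing$. Let $(\Theta,v)\in\mathbb U$, let $\pi^{\Theta,v}$ be the unique invariant measure of the closed-loop system $$dX(t)=[(A+B\Theta)X(t)+Bv+b]dt+[(C+D\Theta)X(t)+Dv+\sigma]dW(t),\quad t\geqslant0,\qquad X(0)=x,$$ with solution $X(\cdot)=X(\cdot\,;x,\Theta,v)$, and for $\lambda>0$ let $$J^\lambda_\infty(x;\Theta,v)=\mathbb E\int_0^\infty e^{-\lambda t}g\big(X(t;x,\Theta,v),\Theta X(t;x,\Theta,v)+v\big)dt.$$ Then $$\liminf_{\lambda\to0^+}\lambda J^\lambda_\infty(x;\Theta,v)=\int_{\mathbb R^n}g(y,\Theta y+v)\,\pi^{\Theta,v}(dy),\qquad\forall x\in\mathbb R^n.$$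
   Context: $W$ is a standard one-dimensional Brownian motion on a complete filtered probability space with its augmented natural filtration. $A,C\in\mathbb R^{n\times n}$, $B,D\in\mathbb R^{n\times m}$, $b,\sigma\in\mathbb R^n$, $Q\in\mathbb S^n$, $R\in\mathbb S^m$, $S\in\mathbb R^{m\times n}$, $q\in\mathbb R^n$, $\rho\in\mathbb R^m$ are constant ($\mathbb S^k$: symmetric real $k\times k$ matrices), and $$g(x,u)=\langle Qx,x\rangle+2\langle Sx,u\rangle+\langle Ru,u\rangle+2\langle q,x\rangle+2\langle\rho,u\rangle.$$ $\mathbf\Theta[A,C;B,D]$ is the set of $\Theta\in\mathbb R^{m\times n}$ (stabilizers) such that for every $x\in\mathbb R^n$ the solution of $dX_0=(A+B\Theta)X_0\,dt+(C+D\Theta)X_0\,dW$, $X_0(0)=x$, satisfies $\mathbb E\int_0^\infty|X_0(t)|^2dt<\infty$. Put $\mathbb U=\mathbf\Theta[A,C;B,D]\times\mathbb R^m$. For $(\Theta,v)\in\mathbb U$ the closed-loop system has a unique invariant probability measure $\pi^{\Theta,v}$ on $\mathbb R^n$, with finite second moment, and $\sup_{t\geqslant0}\mathbb E|X(t;x,\Theta,v)|^2<\infty$, so $J^\lambda_\infty$ is well-defined. *)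

theory Defs
  imports "HOL-Probability.Probability"
begin

section \<open>Brownian motion and its augmented natural filtration\<close>

definition aug_filtration :: "'w measure \<Rightarrow> (real \<Rightarrow> 'w \<Rightarrow> real) \<Rightarrow> real \<Rightarrow> 'w measure" where
  "aug_filtration M W t =
     sigma (space M)
       ({W s -` B \<inter> space M | s B. 0 \<le> s \<and> s \<le> t \<and> B \<in> sets borel} \<union> null_sets M)"

definition standard_brownian :: "'w measure \<Rightarrow> (real \<Rightarrow> 'w \<Rightarrow> real) \<Rightarrow> bool" where
  "standard_brownian M W \<longleftrightarrow>
     prob_space M \<and> complete_measure M \<and>
     (\<forall>t\<ge>0. W t \<in> borel_measurable M) \<and>
     (AE \<omega> in M. W 0 \<omega> = 0) \<and>
     (\<forall>\<omega>\<in>space M. continuous_on {0..} (\<lambda>t. W t \<omega>)) \<and>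
     (\<forall>s t. 0 \<le> s \<and> s < t \<longrightarrow>
        distributed M lborel (\<lambda>\<omega>. W t \<omega> - W s \<omega>) (normal_density 0 (sqrt (t - s))) \<and>
        prob_space.indep_set M (sets (aug_filtration M W s))
          (sets (vimage_algebra (space M) (\<lambda>\<omega>. W t \<omega> - W s \<omega>) borel)))"

definition adapted :: "'w measure \<Rightarrow> (real \<Rightarrow> 'w \<Rightarrow> real) \<Rightarrow>
    (real \<Rightarrow> 'w \<Rightarrow> 'a::euclidean_space) \<Rightarrow> bool" where
  "adapted M W X \<longleftrightarrow> (\<forall>t\<ge>0. X t \<in> borel_measurable (aug_filtration M W t))"

definition continuous_paths :: "'w measure \<Rightarrow> (real \<Rightarrow> 'w \<Rightarrow> 'a::euclidean_space) \<Rightarrow> bool" where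
  "continuous_paths M X \<longleftrightarrow> (\<forall>\<omega>\<in>space M. continuous_on {0..} (\<lambda>t. X t \<omega>))"

definition progressive :: "'w measure \<Rightarrow> (real \<Rightarrow> 'w \<Rightarrow> real) \<Rightarrow>
    (real \<Rightarrow> 'w \<Rightarrow> 'a::euclidean_space) \<Rightarrow> bool" where
  "progressive M W H \<longleftrightarrow>
     (\<forall>t\<ge>0. (\<lambda>(s, \<omega>). H s \<omega>) \<in>
        borel_measurable (restrict_space borel {0..t} \<Otimes>\<^sub>M aug_filtration M W t))"

definition sq_norm_upto :: "'w measure \<Rightarrow> real \<Rightarrow> (real \<Rightarrow> 'w \<Rightarrow> 'a::euclidean_space) \<Rightarrow> ennreal" where
  "sq_norm_upto M T H = (\<integral>\<^sup>+\<omega>. (\<integral>\<^sup>+s\<in>{0..T}. ennreal ((norm (H s \<omega>))\<^sup>2) \<partial>lborel) \<partial>M)"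


section \<open>The Ito integral of square-integrable processes\<close>

text \<open>
  An elementary process is a finite sum of terms \<open>\<xi> i\<close> on \<open>(a i, b i]\<close> with \<open>\<xi> i\<close> bounded and
  known at time \<open>a i\<close>. The intervals may overlap: refining them to a common partition gives the
  same class of processes and the same integrals.
\<close>

definition elementary :: "'w measure \<Rightarrow> (real \<Rightarrow> 'w \<Rightarrow> real) \<Rightarrow> nat \<Rightarrow> (nat \<Rightarrow> real) \<Rightarrow>
    (nat \<Rightarrow> real) \<Rightarrow> (nat \<Rightarrow> 'w \<Rightarrow> 'a::euclidean_space) \<Rightarrow> bool" where
  "elementary M W N a b \<xi> \<longleftrightarrow>
     (\<forall>i<N. 0 \<le> a i \<and> a i \<le> b i \<and>
        \<xi> i \<in> borel_measurable (aug_filtration M W (a i)) \<and> bounded (\<xi> i ` space M))"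

definition elementary_process :: "nat \<Rightarrow> (nat \<Rightarrow> real) \<Rightarrow> (nat \<Rightarrow> real) \<Rightarrow>
    (nat \<Rightarrow> 'w \<Rightarrow> 'a::euclidean_space) \<Rightarrow> real \<Rightarrow> 'w \<Rightarrow> 'a" where
  "elementary_process N a b \<xi> s \<omega> = (\<Sum>i<N. indicator {a i<..b i} s *\<^sub>R \<xi> i \<omega>)"

definition elementary_integral :: "(real \<Rightarrow> 'w \<Rightarrow> real) \<Rightarrow> nat \<Rightarrow> (nat \<Rightarrow> real) \<Rightarrow>
    (nat \<Rightarrow> real) \<Rightarrow> (nat \<Rightarrow> 'w \<Rightarrow> 'a::euclidean_space) \<Rightarrow> real \<Rightarrow> 'w \<Rightarrow> 'a" where
  "elementary_integral W N a b \<xi> t \<omega> =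
     (\<Sum>i<N. (W (min (b i) t) \<omega> - W (min (a i) t) \<omega>) *\<^sub>R \<xi> i \<omega>)"

text \<open>
  \<open>is_ito_integral M W H I\<close>: the process \<open>I\<close> is (a continuous version of) the stochastic integral
  of \<open>H\<close> against \<open>W\<close> from \<open>0\<close>, i.e. the mean-square limit of elementary integrals.
\<close>

definition is_ito_integral :: "'w measure \<Rightarrow> (real \<Rightarrow> 'w \<Rightarrow> real) \<Rightarrow>
    (real \<Rightarrow> 'w \<Rightarrow> 'a::euclidean_space) \<Rightarrow> (real \<Rightarrow> 'w \<Rightarrow> 'a) \<Rightarrow> bool" where
  "is_ito_integral M W H I \<longleftrightarrow>
     progressive M W H \<and> (\<forall>T\<ge>0. sq_norm_upto M T H < \<infinity>) \<and>
     adapted M W I \<and> continuous_paths M I \<and>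
     (\<exists>N a b \<xi>.
        (\<forall>k. elementary M W (N k) (a k) (b k) (\<xi> k)) \<and>
        (\<forall>T\<ge>0. (\<lambda>k. sq_norm_upto M T
            (\<lambda>s \<omega>. elementary_process (N k) (a k) (b k) (\<xi> k) s \<omega> - H s \<omega>)) \<longlonglongrightarrow> 0) \<and>
        (\<forall>t\<ge>0. (\<lambda>k. \<integral>\<^sup>+\<omega>. ennreal ((norm
            (elementary_integral W (N k) (a k) (b k) (\<xi> k) t \<omega> - I t \<omega>))\<^sup>2) \<partial>M) \<longlonglongrightarrow> 0))"


section \<open>Linear stochastic differential equations\<close>

text \<open>
  \<open>solves_sde M W F f G h x X\<close>: \<open>X\<close> is a strong solution of
  \<open>dX = (F X + f) dt + (G X + h) dW\<close>, \<open>X(0) = x\<close>, in the usual class of continuous adapted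
  processes that are square integrable on bounded time intervals. The equation is Lipschitz with
  deterministic initial state, so this class contains the solution, unique up to
  indistinguishability.
\<close>

definition solves_sde :: "'w measure \<Rightarrow> (real \<Rightarrow> 'w \<Rightarrow> real) \<Rightarrow>
    real^'n^'n \<Rightarrow> real^'n \<Rightarrow> real^'n^'n \<Rightarrow> real^'n \<Rightarrow> real^'n \<Rightarrow> (real \<Rightarrow> 'w \<Rightarrow> real^'n) \<Rightarrow> bool" where
  "solves_sde M W F f G h x X \<longleftrightarrow>
     adapted M W X \<and> continuous_paths M X \<and> (\<forall>T\<ge>0. sq_norm_upto M T X < \<infinity>) \<and>
     (\<exists>I. is_ito_integral M W (\<lambda>s \<omega>. G *v X s \<omega> + h) I \<and>
        (AE \<omega> in M. \<forall>t\<ge>0. X t \<omega> = x + (LBINT s:{0..t}. F *v X s \<omega> + f) + I t \<omega>))"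

definition stabilizers :: "'w measure \<Rightarrow> (real \<Rightarrow> 'w \<Rightarrow> real) \<Rightarrow>
    real^'n^'n \<Rightarrow> real^'n^'n \<Rightarrow> real^'m^'n \<Rightarrow> real^'m^'n \<Rightarrow> (real^'n^'m) set" where
  "stabilizers M W A C B D =
     {\<Theta>. \<forall>x X0. solves_sde M W (A + B ** \<Theta>) 0 (C + D ** \<Theta>) 0 x X0 \<longrightarrow>
        (\<integral>\<^sup>+\<omega>. (\<integral>\<^sup>+t\<in>{0..}. ennreal ((norm (X0 t \<omega>))\<^sup>2) \<partial>lborel) \<partial>M) < \<infinity>}"

definition strategies :: "'w measure \<Rightarrow> (real \<Rightarrow> 'w \<Rightarrow> real) \<Rightarrow>
    real^'n^'n \<Rightarrow> real^'n^'n \<Rightarrow> real^'m^'n \<Rightarrow> real^'m^'n \<Rightarrow> ((real^'n^'m) \<times> (real^'m)) set" where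
  "strategies M W A C B D = stabilizers M W A C B D \<times> UNIV"

text \<open>
  \<open>X x\<close> is the solution started at \<open>x\<close>; \<open>distr M borel (X x t)\<close> is the transition
  probability \<open>P(t, x, _)\<close>.
\<close>

definition invariant_prob :: "'w measure \<Rightarrow> ('a::euclidean_space \<Rightarrow> real \<Rightarrow> 'w \<Rightarrow> 'a) \<Rightarrow> 'a measure \<Rightarrow> bool" where
  "invariant_prob M X \<pi> \<longleftrightarrow>
     prob_space \<pi> \<and> sets \<pi> = sets borel \<and>
     (\<forall>t\<ge>0. \<forall>E\<in>sets borel. (\<integral>\<^sup>+x. emeasure (distr M borel (X x t)) E \<partial>\<pi>) = emeasure \<pi> E)"


section \<open>Cost functionals\<close>

definition running_cost :: "real^'n^'n \<Rightarrow> real^'n^'m \<Rightarrow> real^'m^'m \<Rightarrow> real^'n \<Rightarrow> real^'m \<Rightarrow>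
    real^'n \<Rightarrow> real^'m \<Rightarrow> real" where
  "running_cost Q S R q \<rho> x u =
     (Q *v x) \<bullet> x + 2 * ((S *v x) \<bullet> u) + (R *v u) \<bullet> u + 2 * (q \<bullet> x) + 2 * (\<rho> \<bullet> u)"

definition discounted_cost :: "'w measure \<Rightarrow> (real^'n \<Rightarrow> real^'m \<Rightarrow> real) \<Rightarrow> real^'n^'m \<Rightarrow> real^'m \<Rightarrow>
    real \<Rightarrow> (real \<Rightarrow> 'w \<Rightarrow> real^'n) \<Rightarrow> real" where
  "discounted_cost M g \<Theta> v r X =
     (LINT \<omega>|M. (LBINT t:{0..}. exp (- r * t) * g (X t \<omega>) (\<Theta> *v X t \<omega> + v)))"

end

theory Submission
  imports Defs
begin

text \<open>
  The difference of two solutions of the closed-loop equation solves the homogeneous equation, so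
  \<open>X x - X z\<close> is square integrable on \<open>[0, \<infinity>)\<close>. For a symmetric matrix \<open>P\<close> the product rule for
  second moments (which needs only the Ito isometry and the orthogonality of increments) gives
  \<open>d/dt E \<langle>P Y, Y\<rangle> = E \<langle>\<L> P Y, Y\<rangle>\<close> for homogeneous solutions \<open>Y\<close>, where
  \<open>\<L> P = F\<^sup>T P + P F + G\<^sup>T P G\<close>. If \<open>\<L> P = 0\<close> then \<open>E \<langle>P Y, Y\<rangle>\<close> is constant, hence zero by square
  integrability; so \<open>\<L>\<close> is injective on symmetric matrices and \<open>\<L> P = - I\<close> has a solution. This \<open>P\<close>
  is positive definite and serves as a Lyapunov function: \<open>E |X x t - X z t|\<^sup>2\<close> tends to \<open>0\<close>, is
  bounded by a multiple of \<open>|x - z|\<^sup>2\<close>, and \<open>E |X z t|\<^sup>2\<close> is bounded in \<open>t\<close>.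

  Averaging over \<open>x\<close> with respect to the invariant measure and letting \<open>t\<close> tend to infinity shows first
  that \<open>\<pi>\<close> has a finite second moment and then that \<open>E g (X z t)\<close> converges to the \<open>\<pi>\<close>-integral of \<open>g\<close>.
  The discounted limit is the Abelian consequence of this convergence, so the limit inferior is
  a limit.
\<close>

section \<open>Square-integrable functions\<close>

text \<open>The Ito integral is known only through mean-square limits of elementary integrals.
  Identities that are bilinear in the processes survive such limits, so isometry and orthogonality
  are carried for every bounded bilinear form and not just for the norm; together with a pathwise
  chain rule for the drift they stand in for the Ito formula. Three obstacles shape the rest.
  \<open>stabilizers\<close> quantifies over homogeneous solutions without asserting that any
  exists; the differences \<open>X x - X z\<close> supply one for every starting point. Stability
  gives only a finite time integral, hence smallness of the second moment at some late times; the
  positivity of P is extracted from this, and only then does smallness propagate to all later times.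
  Finally, the solutions \<open>X x\<close> are given separately for each x, so the averages over
  \<open>\<pi>\<close> need a measurability in x that no hypothesis provides; it follows from the
  mean-square Lipschitz dependence on x that the Lyapunov bound yields. Since g is quadratic,
  convergence of laws would not be enough: costs are compared through mean-square distances and
  Cauchy-Schwarz.\<close>

definition sqint :: "'w measure \<Rightarrow> ('w \<Rightarrow> 'a::euclidean_space) \<Rightarrow> bool" where
  "sqint M f \<longleftrightarrow> f \<in> borel_measurable M \<and> integrable M (\<lambda>x. (norm (f x))\<^sup>2)"

definition L2norm :: "'w measure \<Rightarrow> ('w \<Rightarrow> 'a::euclidean_space) \<Rightarrow> real" where
  "L2norm M f = sqrt (LINT x|M. (norm (f x))\<^sup>2)"

lemma L2norm_nonneg: "0 \<le> L2norm M f"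
  by (simp add: L2norm_def)

lemma L2norm_power2: "(L2norm M f)\<^sup>2 = (LINT x|M. (norm (f x))\<^sup>2)"
  by (simp add: L2norm_def)

lemma sqint_measurable: "sqint M f \<Longrightarrow> f \<in> borel_measurable M"
  by (simp add: sqint_def)

lemma sqint_iff_nn_integral:
  "sqint M f \<longleftrightarrow> f \<in> borel_measurable M \<and> (\<integral>\<^sup>+x. ennreal ((norm (f x))\<^sup>2) \<partial>M) < \<infinity>"
  unfolding sqint_def
  by (auto simp: integrable_iff_bounded intro: borel_measurable_norm borel_measurable_power)

lemma sqint_nn_integral:
  assumes "sqint M f"
  shows "(\<integral>\<^sup>+x. ennreal ((norm (f x))\<^sup>2) \<partial>M) = ennreal ((L2norm M f)\<^sup>2)"
  using assms unfolding L2norm_power2 sqint_def by (intro nn_integral_eq_integral) auto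

lemma power2_norm_add_le:
  fixes a b :: "'a::real_normed_vector"
  shows "(norm (a + b))\<^sup>2 \<le> 2 * (norm a)\<^sup>2 + 2 * (norm b)\<^sup>2"
proof -
  have "(norm (a + b))\<^sup>2 \<le> (norm a + norm b)\<^sup>2"
    by (intro power_mono norm_triangle_ineq) auto
  also have "\<dots> \<le> 2 * (norm a)\<^sup>2 + 2 * (norm b)\<^sup>2"
    using zero_le_power2[of "norm a - norm b"] by (simp add: power2_eq_square algebra_simps)
  finally show ?thesis .
qed

lemma sqint_dominated:
  fixes f :: "'w \<Rightarrow> 'a::euclidean_space" and c :: real
  assumes "f \<in> borel_measurable M" "integrable M h" "\<And>x. x \<in> space M \<Longrightarrow> (norm (f x))\<^sup>2 \<le> h x"
  shows "sqint M f"
proof -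
  have "integrable M (\<lambda>x. (norm (f x))\<^sup>2)"
  proof (rule Bochner_Integration.integrable_bound[OF assms(2)])
    show "AE x in M. norm ((norm (f x))\<^sup>2) \<le> norm (h x)"
      using order_trans[OF assms(3) abs_ge_self] by auto
  qed (use assms(1) in measurable)
  then show ?thesis using assms(1) by (simp add: sqint_def)
qed

lemma sqint_add: 
  assumes "sqint M f" "sqint M g" shows "sqint M (\<lambda>x. f x + g x)"
  using assms power2_norm_add_le
  by (intro sqint_dominated[where h="\<lambda>x. 2 * (norm (f x))\<^sup>2 + 2 * (norm (g x))\<^sup>2"])
     (auto simp: sqint_def)

lemma sqint_linear:
  assumes "sqint M f" "bounded_linear T" shows "sqint M (\<lambda>x. T (f x))"
proof -
  obtain K where K: "\<And>x. norm (T x) \<le> norm x * K" "K \<ge> 0"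
    using bounded_linear.nonneg_bounded[OF assms(2)] by blast
  have "(norm (T (f x)))\<^sup>2 \<le> K\<^sup>2 * (norm (f x))\<^sup>2" for x
    using power_mono[OF K(1)[of "f x"], of 2] by (simp add: power_mult_distrib mult.commute)
  moreover have "T \<in> borel_measurable borel"
    by (intro borel_measurable_continuous_onI linear_continuous_on assms)
  ultimately show ?thesis using assms(1)
    by (intro sqint_dominated[where h="\<lambda>x. K\<^sup>2 * (norm (f x))\<^sup>2"]) (auto simp: sqint_def)
qed

lemma sqint_diff: 
  assumes "sqint M f" "sqint M g" shows "sqint M (\<lambda>x. f x - g x)"
  using sqint_add[OF assms(1) sqint_linear[OF assms(2) bounded_linear_minus[OF bounded_linear_ident]]] by simp

lemma sqint_sum:
  assumes "\<And>i. i \<in> I \<Longrightarrow> sqint M (f i)" shows "sqint M (\<lambda>x. \<Sum>i\<in>I. f i x)"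
  using assms by (induction I rule: infinite_finite_induct) (auto intro: sqint_add simp: sqint_def[of _ "\<lambda>x. 0"])

lemma (in finite_measure) sqint_const: "sqint M (\<lambda>x. c)"
  by (simp add: sqint_def)

lemma measurable_bilinear:
  fixes f :: "'w \<Rightarrow> 'a::euclidean_space" and g :: "'w \<Rightarrow> 'b::euclidean_space"
    and B :: "'a \<Rightarrow> 'b \<Rightarrow> real"
  assumes "f \<in> borel_measurable M" "g \<in> borel_measurable M" "bounded_bilinear B"
  shows "(\<lambda>x. B (f x) (g x)) \<in> borel_measurable M"
  by (rule borel_measurable_continuous_Pair[where H=B, OF assms(1,2)])
    (intro bounded_bilinear.continuous_on[OF assms(3)] continuous_on_fst continuous_on_snd continuous_on_id)

lemma integrable_bilinear:
  assumes "sqint M f" "sqint M g" "bounded_bilinear B"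
  shows "integrable M (\<lambda>x. B (f x) (g x) :: real)"
proof -
  obtain K where K: "\<And>x y. norm (B x y) \<le> norm x * norm y * K" "K > 0"
    using bounded_bilinear.pos_bounded[OF assms(3)] by blast
  have bd: "\<bar>B (f x) (g x)\<bar> \<le> K * (norm (f x))\<^sup>2 + K * (norm (g x))\<^sup>2" for x
  proof -
    have "2 * (norm (f x) * norm (g x)) \<le> (norm (f x))\<^sup>2 + (norm (g x))\<^sup>2"
      using zero_le_power2[of "norm (f x) - norm (g x)"] by (simp add: power2_eq_square algebra_simps)
    then have "norm (f x) * norm (g x) \<le> (norm (f x))\<^sup>2 + (norm (g x))\<^sup>2"
      using mult_nonneg_nonneg[OF norm_ge_zero[of "f x"] norm_ge_zero[of "g x"]] by linarith
    from mult_right_mono[OF this, of K] K(1)[of "f x" "g x"] K(2)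
    show ?thesis by (simp add: algebra_simps)
  qed
  have "(\<lambda>x. B (f x) (g x)) \<in> borel_measurable M"
    by (rule measurable_bilinear[OF sqint_measurable[OF assms(1)] sqint_measurable[OF assms(2)] assms(3)])
  moreover have "integrable M (\<lambda>x. K * (norm (f x))\<^sup>2 + K * (norm (g x))\<^sup>2)"
    using assms by (simp add: sqint_def)
  ultimately show ?thesis
    using order_trans[OF bd abs_ge_self]
    by (auto intro: Bochner_Integration.integrable_bound)
qed

lemma sqint_norm: "sqint M f \<Longrightarrow> sqint M (\<lambda>x. norm (f x))"
  unfolding sqint_def by auto

text \<open>Pointwise 2ab <= t a^2 + b^2 / t for every t > 0; integrating and taking t =
  \<open>?b / ?a\<close> gives the product of the norms. If a norm vanishes this choice degenerates,
  and t is made very large or very small instead.\<close>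

lemma Cauchy_Schwarz_L2:
  assumes "sqint M f" "sqint M g"
  shows "(LINT x|M. norm (f x) * norm (g x)) \<le> L2norm M f * L2norm M g"
proof -
  let ?I = "LINT x|M. norm (f x) * norm (g x)" and ?a = "L2norm M f" and ?b = "L2norm M g"
  have int: "integrable M (\<lambda>x. norm (f x) * norm (g x))"
    by (rule integrable_bilinear[OF sqint_norm sqint_norm bounded_bilinear_mult]) fact+
  have bd: "2 * ?I \<le> t * ?a\<^sup>2 + ?b\<^sup>2 / t" if "t > 0" for t
  proof -
    have "(LINT x|M. 2 * (norm (f x) * norm (g x))) \<le> (LINT x|M. t * (norm (f x))\<^sup>2 + (norm (g x))\<^sup>2 / t)"
    proof (rule integral_mono)
      fix x
      have "0 \<le> (t * norm (f x) - norm (g x))\<^sup>2 / t" using that by simp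
      also have "\<dots> = t * (norm (f x))\<^sup>2 + (norm (g x))\<^sup>2 / t - 2 * (norm (f x) * norm (g x))"
        using that by (simp add: power2_eq_square field_simps)
      finally show "2 * (norm (f x) * norm (g x)) \<le> t * (norm (f x))\<^sup>2 + (norm (g x))\<^sup>2 / t" by simp
    qed (use assms int in \<open>auto simp: sqint_def\<close>)
    then show ?thesis using assms int by (simp add: sqint_def L2norm_power2)
  qed
  consider "?a = 0" | "?b = 0" | "?a > 0" "?b > 0"
    using L2norm_nonneg[of M f] L2norm_nonneg[of M g] by linarith
  then show ?thesis
  proof cases
    case 1
    have "2 * ?I \<le> 0"
    proof (rule field_le_epsilon)
      fix e :: real assume "e > 0"
      \<comment> \<open>With \<open>?a = 0\<close> the bound is 2I <= \<open>?b\<close>^2 / t, and t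
        = (\<open>?b\<close>^2 + 1) / e pushes it below e. The summand 1 keeps t positive when
        \<open>?b = 0\<close>.\<close>
      have "?b\<^sup>2 / (?b\<^sup>2 + 1) \<le> 1" by (simp add: add_nonneg_pos)
      from mult_left_mono[OF this, of e] have "?b\<^sup>2 / ((?b\<^sup>2 + 1) / e) \<le> e"
        using \<open>e > 0\<close> by (simp add: mult.commute)
      then show "2 * ?I \<le> 0 + e" using bd[of "(?b\<^sup>2 + 1) / e"] \<open>e > 0\<close> 1
        by (simp add: add_nonneg_pos)
    qed
    then show ?thesis using 1 by simp
  next
    case 2
    have "2 * ?I \<le> 0"
    proof (rule field_le_epsilon)
      fix e :: real assume "e > 0"
      have "?a\<^sup>2 / (?a\<^sup>2 + 1) \<le> 1" by (simp add: add_nonneg_pos)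
      from mult_left_mono[OF this, of e] have "e / (?a\<^sup>2 + 1) * ?a\<^sup>2 \<le> e"
        using \<open>e > 0\<close> by simp
      then show "2 * ?I \<le> 0 + e" using bd[of "e / (?a\<^sup>2 + 1)"] \<open>e > 0\<close> 2
        by (simp add: add_nonneg_pos)
    qed
    then show ?thesis using 2 by simp
  next
    case 3
    have "2 * ?I \<le> 2 * (?a * ?b)"
      using bd[of "?b / ?a"] 3 by (simp add: power2_eq_square field_simps)
    then show ?thesis by simp
  qed
qed

lemma L2_bilinear_le:
  fixes B :: "'a::euclidean_space \<Rightarrow> 'b::euclidean_space \<Rightarrow> real"
  assumes "sqint M f" "sqint M g" "bounded_bilinear B"
    and K: "\<And>x y. \<bar>B x y\<bar> \<le> norm x * norm y * K" "K \<ge> 0"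
  shows "\<bar>LINT x|M. B (f x) (g x)\<bar> \<le> K * L2norm M f * L2norm M g"
proof -
  have int: "integrable M (\<lambda>x. norm (f x) * norm (g x))"
    by (rule integrable_bilinear[OF sqint_norm sqint_norm bounded_bilinear_mult]) fact+
  have "\<bar>LINT x|M. B (f x) (g x)\<bar> \<le> (LINT x|M. \<bar>B (f x) (g x)\<bar>)"
    using integral_abs_bound[of M "\<lambda>x. B (f x) (g x)"] .
  also have "\<dots> \<le> (LINT x|M. K * (norm (f x) * norm (g x)))"
    using int integrable_bilinear[OF assms(1-3)] K(1) by (intro integral_mono) (auto simp: mult_ac)
  also have "\<dots> \<le> K * L2norm M f * L2norm M g"
    using Cauchy_Schwarz_L2[OF assms(1,2)] K(2) by (simp add: mult_left_mono mult.assoc)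
  finally show ?thesis .
qed

text \<open>Some \<open>f k\<close> lies at finite distance from \<open>f0\<close>, and
  \<open>f0\<close> = \<open>f k\<close> - (\<open>f k\<close> - \<open>f0\<close>), so
  \<open>f0\<close> inherits square integrability. Only then can the extended-valued convergence be
  read as convergence of \<open>L2norm\<close>.\<close>

lemma sqint_L2_limit:
  assumes "\<And>k. sqint M (f k)" "f0 \<in> borel_measurable M"
    and lim: "(\<lambda>k. \<integral>\<^sup>+x. ennreal ((norm (f k x - f0 x))\<^sup>2) \<partial>M) \<longlonglongrightarrow> 0"
  shows "sqint M f0"
    and "(\<lambda>k::nat. L2norm M (\<lambda>x. f k x - f0 x)) \<longlonglongrightarrow> 0"
proof -
  have "\<forall>\<^sub>F k in sequentially. (\<integral>\<^sup>+x. ennreal ((norm (f k x - f0 x))\<^sup>2) \<partial>M) < 1"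
    using order_tendstoD(2)[OF lim] by simp
  then obtain k where "(\<integral>\<^sup>+x. ennreal ((norm (f k x - f0 x))\<^sup>2) \<partial>M) < 1"
    by (auto simp: eventually_sequentially)
  also have "(1::ennreal) < \<infinity>" by simp
  finally have fin: "(\<integral>\<^sup>+x. ennreal ((norm (f k x - f0 x))\<^sup>2) \<partial>M) < \<infinity>" .
  have "sqint M (\<lambda>x. f k x - f0 x)"
    unfolding sqint_iff_nn_integral using fin assms(1)[of k] assms(2) by (auto simp: sqint_def)
  from sqint_diff[OF assms(1)[of k] this] show f0: "sqint M f0" by simp
  have "(\<integral>\<^sup>+x. ennreal ((norm (f k x - f0 x))\<^sup>2) \<partial>M) = ennreal ((L2norm M (\<lambda>x. f k x - f0 x))\<^sup>2)" for k
    by (intro sqint_nn_integral sqint_diff assms f0)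
  then have "(\<lambda>k. ennreal ((L2norm M (\<lambda>x. f k x - f0 x))\<^sup>2)) \<longlonglongrightarrow> ennreal 0" using lim by simp
  then have "(\<lambda>k. (L2norm M (\<lambda>x. f k x - f0 x))\<^sup>2) \<longlonglongrightarrow> 0"
    by (subst (asm) tendsto_ennreal_iff) auto
  from tendsto_real_sqrt[OF this] show "(\<lambda>k. L2norm M (\<lambda>x. f k x - f0 x)) \<longlonglongrightarrow> 0"
    by (simp add: real_sqrt_abs L2norm_nonneg)
qed

text \<open>Expanding around the limits leaves three error terms, each with a factor whose
  \<open>L2norm\<close> tends to 0. This carries every quadratic identity from elementary integrals
  to the Ito integral, on \<open>M\<close> as well as on \<open>MT t\<close>.\<close>

lemma L2_limit_bilinear:
  fixes B :: "'a::euclidean_space \<Rightarrow> 'b::euclidean_space \<Rightarrow> real"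
  assumes "\<And>k. sqint M (f k)" "f0 \<in> borel_measurable M"
    and "(\<lambda>k. \<integral>\<^sup>+x. ennreal ((norm (f k x - f0 x))\<^sup>2) \<partial>M) \<longlonglongrightarrow> 0"
    and "\<And>k. sqint M (g k)" "g0 \<in> borel_measurable M"
    and "(\<lambda>k. \<integral>\<^sup>+x. ennreal ((norm (g k x - g0 x))\<^sup>2) \<partial>M) \<longlonglongrightarrow> 0"
    and "bounded_bilinear B"
  shows "(\<lambda>k::nat. LINT x|M. B (f k x) (g k x)) \<longlonglongrightarrow> (LINT x|M. B (f0 x) (g0 x))"
proof -
  note f0 = sqint_L2_limit[OF assms(1-3)] and g0 = sqint_L2_limit[OF assms(4-6)]
  obtain K where K: "\<And>x y. norm (B x y) \<le> norm x * norm y * K" "K > 0"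
    using bounded_bilinear.pos_bounded[OF assms(7)] by blast
  define df dg where "df = (\<lambda>k x. f k x - f0 x)" and "dg = (\<lambda>k x. g k x - g0 x)"
  have sd: "sqint M (df k)" "sqint M (dg k)" for k
    unfolding df_def dg_def by (intro sqint_diff assms f0 g0)+
  note intB = integrable_bilinear[OF _ _ assms(7)]
  have eq: "(LINT x|M. B (f k x) (g k x)) - (LINT x|M. B (f0 x) (g0 x)) =
     (LINT x|M. B (df k x) (dg k x)) + (LINT x|M. B (df k x) (g0 x)) + (LINT x|M. B (f0 x) (dg k x))" for k
  proof -
    have "(\<lambda>x. B (f k x) (g k x)) = (\<lambda>x. B (df k x) (dg k x) + B (df k x) (g0 x) + B (f0 x) (dg k x) + B (f0 x) (g0 x))"
      unfolding df_def dg_def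
      by (simp add: bounded_bilinear.diff_left[OF assms(7)] bounded_bilinear.diff_right[OF assms(7)])
    then show ?thesis using intB[OF sd(1)[of k] sd(2)[of k]] intB[OF sd(1)[of k] g0(1)] intB[OF f0(1) sd(2)[of k]] intB[OF f0(1) g0(1)]
      by simp
  qed
  have bd: "\<bar>(LINT x|M. B (f k x) (g k x)) - (LINT x|M. B (f0 x) (g0 x))\<bar> \<le>
     K * L2norm M (df k) * L2norm M (dg k) + K * L2norm M (df k) * L2norm M g0 + K * L2norm M f0 * L2norm M (dg k)" for k
    unfolding eq
    using L2_bilinear_le[OF sd(1)[of k] sd(2)[of k] assms(7), of K] L2_bilinear_le[OF sd(1)[of k] g0(1) assms(7), of K]
      L2_bilinear_le[OF f0(1) sd(2)[of k] assms(7), of K] K by fastforce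
  have "(\<lambda>k. K * L2norm M (df k) * L2norm M (dg k) + K * L2norm M (df k) * L2norm M g0 + K * L2norm M f0 * L2norm M (dg k)) \<longlonglongrightarrow> K * 0 * 0 + K * 0 * L2norm M g0 + K * L2norm M f0 * 0"
    by (intro tendsto_intros f0(2)[folded df_def] g0(2)[folded dg_def])
       (use f0(2) g0(2) in \<open>simp_all add: df_def dg_def\<close>)
  then have "(\<lambda>k. K * L2norm M (df k) * L2norm M (dg k) + K * L2norm M (df k) * L2norm M g0 + K * L2norm M f0 * L2norm M (dg k)) \<longlonglongrightarrow> 0" by simp
  then have "(\<lambda>k. (LINT x|M. B (f k x) (g k x)) - (LINT x|M. B (f0 x) (g0 x))) \<longlonglongrightarrow> 0"
    by (rule Lim_null_comparison[rotated]) (use bd in \<open>simp\<close>)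
  then show ?thesis by (simp add: LIM_zero_iff)
qed

section \<open>Brownian increments and elementary integrals\<close>

locale brownian =
  fixes M :: "'w measure" and W :: "real \<Rightarrow> 'w \<Rightarrow> real"
  assumes brownian: "standard_brownian M W"
begin

sublocale prob_space M
  using brownian by (simp add: standard_brownian_def)

abbreviation \<F> :: "real \<Rightarrow> 'w measure" where "\<F> \<equiv> aug_filtration M W"

lemma W_measurable_M: "t \<ge> 0 \<Longrightarrow> W t \<in> borel_measurable M"
  using brownian by (simp add: standard_brownian_def)

lemma generator_subset:
  "{W s -` B \<inter> space M | s B. 0 \<le> s \<and> s \<le> t \<and> B \<in> sets borel} \<union> null_sets M \<subseteq> sets M"
  by (auto intro: measurable_sets[OF W_measurable_M] dest: null_setsD2)

lemma space_\<F> [simp]: "space (\<F> t) = space M"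
  unfolding aug_filtration_def
  by (rule space_measure_of) (use generator_subset sets.space_closed in blast)

lemma sets_\<F>: "sets (\<F> t) = sigma_sets (space M)
       ({W s -` B \<inter> space M | s B. 0 \<le> s \<and> s \<le> t \<and> B \<in> sets borel} \<union> null_sets M)"
  unfolding aug_filtration_def
  by (rule sets_measure_of) (use generator_subset sets.space_closed in blast)

lemma sets_\<F>_subset: "sets (\<F> t) \<subseteq> sets M"
  unfolding sets_\<F> by (rule sets.sigma_sets_subset) (rule generator_subset)

lemma sets_\<F>_mono: "s \<le> t \<Longrightarrow> sets (\<F> s) \<subseteq> sets (\<F> t)"
  unfolding sets_\<F> 
proof (rule sigma_sets_mono', safe)
  fix r :: real and B :: "real set"
  assume "s \<le> t" "W r -` B \<inter> space M \<notin> null_sets M" "0 \<le> r" "r \<le> s" "B \<in> sets borel"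
  then show "\<exists>q A. W r -` B \<inter> space M = W q -` A \<inter> space M \<and> 0 \<le> q \<and> q \<le> t \<and> A \<in> sets borel"
    by (intro exI[of _ r] exI[of _ B]) auto
qed

lemma measurable_\<F>_M: "f \<in> borel_measurable (\<F> t) \<Longrightarrow> f \<in> borel_measurable M"
  using measurable_mono[OF order_refl refl, of "\<F> t" M borel] sets_\<F>_subset by auto

lemma measurable_\<F>_mono: "f \<in> borel_measurable (\<F> s) \<Longrightarrow> s \<le> t \<Longrightarrow> f \<in> borel_measurable (\<F> t)"
  using measurable_mono[OF order_refl refl, of "\<F> s" "\<F> t" borel] sets_\<F>_mono by auto

lemma W_measurable: "0 \<le> s \<Longrightarrow> s \<le> t \<Longrightarrow> W s \<in> borel_measurable (\<F> t)"
proof (rule measurableI)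
  fix B :: "real set" assume "0 \<le> s" "s \<le> t" "B \<in> sets borel"
  then show "W s -` B \<inter> space (\<F> t) \<in> sets (\<F> t)"
    unfolding sets_\<F> space_\<F> by (intro sigma_sets.Basic) blast
qed auto

section \<open>Moments and independence of Brownian increments\<close>

lemma increment_moments:
  assumes "0 \<le> s" "s \<le> t"
  shows "integrable M (\<lambda>\<omega>. W t \<omega> - W s \<omega>)" "expectation (\<lambda>\<omega>. W t \<omega> - W s \<omega>) = 0"
    "integrable M (\<lambda>\<omega>. (W t \<omega> - W s \<omega>)\<^sup>2)" "expectation (\<lambda>\<omega>. (W t \<omega> - W s \<omega>)\<^sup>2) = t - s"
proof -
  let ?D = "\<lambda>\<omega>. W t \<omega> - W s \<omega>"
  have "integrable M ?D \<and> expectation ?D = 0 \<and> integrable M (\<lambda>\<omega>. (?D \<omega>)\<^sup>2) \<and> expectation (\<lambda>\<omega>. (?D \<omega>)\<^sup>2) = t - s"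
  proof (cases "s = t")
    case False
    then have pos: "0 < sqrt (t - s)" using assms by simp
    have D: "distributed M lborel ?D (normal_density 0 (sqrt (t - s)))"
      using brownian assms False by (simp add: standard_brownian_def)
    have i1: "integrable M ?D"
      using distributed_integrable[OF D, of "\<lambda>x. x"] integrable_normal_moment_nz_1[OF pos, of 0] by simp
    have i2: "integrable M (\<lambda>\<omega>. (?D \<omega>)\<^sup>2)"
      using distributed_integrable[OF D, of "\<lambda>x. x^2"] integrable_normal_moment[OF pos, of 0 2] by simp
    have e: "expectation ?D = 0"
      by (rule normal_distributed_expectation[OF pos D])
    moreover have "expectation (\<lambda>\<omega>. (?D \<omega>)\<^sup>2) = t - s"
      using normal_distributed_variance[OF pos D] assms unfolding e by simp
    ultimately show ?thesis using i1 i2 by simp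
  qed simp
  then show "integrable M ?D" "expectation ?D = 0"
    "integrable M (\<lambda>\<omega>. (?D \<omega>)\<^sup>2)" "expectation (\<lambda>\<omega>. (?D \<omega>)\<^sup>2) = t - s" by auto
qed

text \<open>Independence passes to smaller sigma-algebras: the one generated by f lies in
  \<open>\<F> s\<close>, the other in the one generated by the increment.\<close>

lemma indep_increment:
  fixes f :: "'w \<Rightarrow> real" and \<phi> :: "real \<Rightarrow> real"
  assumes "0 \<le> s" "s < t" "f \<in> borel_measurable (\<F> s)" "\<phi> \<in> borel_measurable borel"
  shows "indep_var borel f borel (\<lambda>\<omega>. \<phi> (W t \<omega> - W s \<omega>))"
proof -
  let ?D = "\<lambda>\<omega>. W t \<omega> - W s \<omega>"
  have ind: "indep_set (sets (\<F> s)) (sets (vimage_algebra (space M) ?D borel))"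
    using brownian assms by (simp add: standard_brownian_def)
  have 1: "sigma_sets (space M) {f -` A \<inter> space M |A. A \<in> sets borel} \<subseteq> sets (\<F> s)"
    using measurable_sets[OF assms(3)]
    by (subst (1) space_\<F>[of s, symmetric], intro sets.sigma_sets_subset) auto
  have "{(\<lambda>\<omega>. \<phi> (?D \<omega>)) -` A \<inter> space M |A. A \<in> sets borel} \<subseteq> {?D -` A \<inter> space M |A. A \<in> sets borel}"
  proof safe
    fix A :: "real set" assume "A \<in> sets borel"
    then have "\<phi> -` A \<in> sets borel" using measurable_sets[OF assms(4)] by simp
    then show "\<exists>B. (\<lambda>\<omega>. \<phi> (?D \<omega>)) -` A \<inter> space M = ?D -` B \<inter> space M \<and> B \<in> sets borel"
      by (intro exI[of _ "\<phi> -` A"]) auto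
  qed
  then have 2: "sigma_sets (space M) {(\<lambda>\<omega>. \<phi> (?D \<omega>)) -` A \<inter> space M |A. A \<in> sets borel}
      \<subseteq> sets (vimage_algebra (space M) ?D borel)"
    unfolding sets_vimage_algebra by (rule sigma_sets_mono')
  have "?D \<in> borel_measurable M" using assms W_measurable_M by auto
  then have "(\<lambda>\<omega>. \<phi> (?D \<omega>)) \<in> borel_measurable M"
    by (rule measurable_compose[OF _ assms(4)])
  moreover have "indep_set (sigma_sets (space M) {f -` A \<inter> space M |A. A \<in> sets borel})
      (sigma_sets (space M) {(\<lambda>\<omega>. \<phi> (?D \<omega>)) -` A \<inter> space M |A. A \<in> sets borel})"
    using ind[unfolded indep_sets2_eq] unfolding indep_sets2_eq
    by (intro conjI ballI order_trans[OF 1] order_trans[OF 2]) (use 1 2 in blast)+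
  ultimately show ?thesis
    unfolding indep_var_eq using measurable_\<F>_M[OF assms(3)] by simp
qed

text \<open>Independence factors each expectation, and the increment has mean 0 and variance t - s.
  The case s = t is treated apart because the independence in \<open>standard_brownian\<close> is
  stated for s < t.\<close>

lemma increment_orthogonal:
  assumes "0 \<le> s" "s \<le> t" "\<eta> \<in> borel_measurable (\<F> s)" "integrable M \<eta>"
  shows "integrable M (\<lambda>\<omega>. \<eta> \<omega> * (W t \<omega> - W s \<omega>))"
    "expectation (\<lambda>\<omega>. \<eta> \<omega> * (W t \<omega> - W s \<omega>)) = 0"
    "integrable M (\<lambda>\<omega>. \<eta> \<omega> * (W t \<omega> - W s \<omega>)\<^sup>2)"
    "expectation (\<lambda>\<omega>. \<eta> \<omega> * (W t \<omega> - W s \<omega>)\<^sup>2) = (t - s) * expectation \<eta>"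
proof -
  note m = increment_moments[OF assms(1,2)]
  have "integrable M (\<lambda>\<omega>. \<eta> \<omega> * (W t \<omega> - W s \<omega>)) \<and>
    expectation (\<lambda>\<omega>. \<eta> \<omega> * (W t \<omega> - W s \<omega>)) = 0 \<and>
    integrable M (\<lambda>\<omega>. \<eta> \<omega> * (W t \<omega> - W s \<omega>)\<^sup>2) \<and>
    expectation (\<lambda>\<omega>. \<eta> \<omega> * (W t \<omega> - W s \<omega>)\<^sup>2) = (t - s) * expectation \<eta>"
  proof (cases "s = t")
    case False
    then have "s < t" using assms by simp
    have i1: "indep_var borel \<eta> borel (\<lambda>\<omega>. W t \<omega> - W s \<omega>)"
      using indep_increment[OF assms(1) \<open>s < t\<close> assms(3), of "\<lambda>x. x"] by simp
    have i2: "indep_var borel \<eta> borel (\<lambda>\<omega>. (W t \<omega> - W s \<omega>)\<^sup>2)"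
      using indep_increment[OF assms(1) \<open>s < t\<close> assms(3), of "\<lambda>x. x\<^sup>2"] by simp
    show ?thesis
      using indep_var_lebesgue_integral[OF i1 assms(4) m(1)] indep_var_integrable[OF i1 assms(4) m(1)]
        indep_var_lebesgue_integral[OF i2 assms(4) m(3)] indep_var_integrable[OF i2 assms(4) m(3)] m
      by simp
  qed simp
  then show "integrable M (\<lambda>\<omega>. \<eta> \<omega> * (W t \<omega> - W s \<omega>))"
    "expectation (\<lambda>\<omega>. \<eta> \<omega> * (W t \<omega> - W s \<omega>)) = 0"
    "integrable M (\<lambda>\<omega>. \<eta> \<omega> * (W t \<omega> - W s \<omega>)\<^sup>2)"
    "expectation (\<lambda>\<omega>. \<eta> \<omega> * (W t \<omega> - W s \<omega>)\<^sup>2) = (t - s) * expectation \<eta>" by auto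
qed

lemma integrable_bounded_mult:
  fixes \<zeta> :: "'w \<Rightarrow> real"
  assumes "\<zeta> \<in> borel_measurable M" "bounded (\<zeta> ` space M)" "integrable M f"
  shows "integrable M (\<lambda>\<omega>. \<zeta> \<omega> * f \<omega>)"
proof -
  obtain K where K: "\<And>\<omega>. \<omega> \<in> space M \<Longrightarrow> \<bar>\<zeta> \<omega>\<bar> \<le> K"
    using assms(2) by (auto simp: bounded_iff)
  show ?thesis
  proof (rule Bochner_Integration.integrable_bound)
    show "integrable M (\<lambda>\<omega>. K * f \<omega>)" using assms by simp
    show "AE \<omega> in M. norm (\<zeta> \<omega> * f \<omega>) \<le> norm (K * f \<omega>)"
    proof (rule AE_I2)
      fix \<omega> assume "\<omega> \<in> space M"
      then have "\<bar>\<zeta> \<omega>\<bar> \<le> \<bar>K\<bar>" using K[of \<omega>] by linarith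
      then show "norm (\<zeta> \<omega> * f \<omega>) \<le> norm (K * f \<omega>)" by (simp add: abs_mult mult_right_mono)
    qed
  qed (use assms in measurable)
qed

text \<open>Cutting both increments at the right points leaves one square, which contributes its
  length, and two products of an increment with something known at its left end, whose means
  vanish.\<close>

lemma increment_product_ordered:
  fixes \<zeta> :: "'w \<Rightarrow> real"
  assumes "0 \<le> a" "a \<le> b" "a \<le> c" "c \<le> d"
    and \<zeta>: "\<zeta> \<in> borel_measurable (\<F> c)" "bounded (\<zeta> ` space M)"
  shows "integrable M (\<lambda>\<omega>. \<zeta> \<omega> * ((W b \<omega> - W a \<omega>) * (W d \<omega> - W c \<omega>)))"
    "expectation (\<lambda>\<omega>. \<zeta> \<omega> * ((W b \<omega> - W a \<omega>) * (W d \<omega> - W c \<omega>))) = max 0 (min b d - c) * expectation \<zeta>"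
proof -
  \<comment> \<open>\<open>b1\<close> and \<open>b2\<close> cut the first interval at c; of
    \<open>b2\<close> and d, \<open>e\<close> is the smaller and \<open>f\<close> the larger. Beyond
    c the two increments share the stretch from c to \<open>e\<close>, and the longer one goes on to
    \<open>f\<close>.\<close>
  define b1 b2 e f where "b1 = min b c" and "b2 = max b c" and "e = min b2 d" and "f = max b2 d"
  have ord: "a \<le> b1" "b1 \<le> c" "c \<le> b2" "c \<le> e" "e \<le> f" "0 \<le> c" "0 \<le> b1" "0 \<le> e"
    using assms by (auto simp: b1_def b2_def e_def f_def)
  note \<zeta>M = measurable_\<F>_M[OF \<zeta>(1)]
  have int\<zeta>: "integrable M \<zeta>"
    using integrable_bounded_mult[OF \<zeta>M \<zeta>(2), of "\<lambda>_. 1"] by simp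
  let ?\<eta>1 = "\<lambda>\<omega>. \<zeta> \<omega> * (W b1 \<omega> - W a \<omega>)" and ?\<eta>2 = "\<lambda>\<omega>. \<zeta> \<omega> * (W e \<omega> - W c \<omega>)"
  have i1: "integrable M ?\<eta>1"
    by (intro integrable_bounded_mult[OF \<zeta>M \<zeta>(2)] increment_moments) (use ord assms in auto)
  have i2: "integrable M ?\<eta>2"
    by (intro integrable_bounded_mult[OF \<zeta>M \<zeta>(2)] increment_moments) (use ord assms in auto)
  have m1: "?\<eta>1 \<in> borel_measurable (\<F> c)"
    using \<zeta>(1) W_measurable[of b1 c] W_measurable[of a c] ord assms by auto
  have m2: "?\<eta>2 \<in> borel_measurable (\<F> e)"
    using measurable_\<F>_mono[OF \<zeta>(1), of e] W_measurable[of e e] W_measurable[of c e] ord assms by auto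
  note o1 = increment_orthogonal[OF \<open>0 \<le> c\<close> \<open>c \<le> d\<close> m1 i1]
  note o2 = increment_orthogonal[OF \<open>0 \<le> e\<close> \<open>e \<le> f\<close> m2 i2]
  note o3 = increment_orthogonal[OF \<open>0 \<le> c\<close> \<open>c \<le> e\<close> \<zeta>(1) int\<zeta>]
  have split1: "W b \<omega> - W a \<omega> = (W b1 \<omega> - W a \<omega>) + (W b2 \<omega> - W c \<omega>)" for \<omega>
    by (auto simp: b1_def b2_def min_def max_def)
  have split2: "(W b2 \<omega> - W c \<omega>) * (W d \<omega> - W c \<omega>) =
      (W e \<omega> - W c \<omega>)\<^sup>2 + (W e \<omega> - W c \<omega>) * (W f \<omega> - W e \<omega>)" for \<omega>
    by (auto simp: e_def f_def min_def max_def power2_eq_square algebra_simps)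
  have eq: "(\<lambda>\<omega>. \<zeta> \<omega> * ((W b \<omega> - W a \<omega>) * (W d \<omega> - W c \<omega>))) =
    (\<lambda>\<omega>. ?\<eta>1 \<omega> * (W d \<omega> - W c \<omega>) + (\<zeta> \<omega> * (W e \<omega> - W c \<omega>)\<^sup>2 + ?\<eta>2 \<omega> * (W f \<omega> - W e \<omega>)))"
  proof
    fix \<omega>
    have "\<zeta> \<omega> * ((W b \<omega> - W a \<omega>) * (W d \<omega> - W c \<omega>)) =
      ?\<eta>1 \<omega> * (W d \<omega> - W c \<omega>) + \<zeta> \<omega> * ((W b2 \<omega> - W c \<omega>) * (W d \<omega> - W c \<omega>))"
      unfolding split1 by (simp add: algebra_simps)
    then show "\<zeta> \<omega> * ((W b \<omega> - W a \<omega>) * (W d \<omega> - W c \<omega>)) =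
      ?\<eta>1 \<omega> * (W d \<omega> - W c \<omega>) + (\<zeta> \<omega> * (W e \<omega> - W c \<omega>)\<^sup>2 + ?\<eta>2 \<omega> * (W f \<omega> - W e \<omega>))"
      unfolding split2 by (simp add: algebra_simps)
  qed
  show "integrable M (\<lambda>\<omega>. \<zeta> \<omega> * ((W b \<omega> - W a \<omega>) * (W d \<omega> - W c \<omega>)))"
    unfolding eq by (intro Bochner_Integration.integrable_add o1 o2 o3)
  have "expectation (\<lambda>\<omega>. \<zeta> \<omega> * ((W b \<omega> - W a \<omega>) * (W d \<omega> - W c \<omega>))) = (e - c) * expectation \<zeta>"
    unfolding eq using o1 o2 o3 by simp
  also have "e - c = max 0 (min b d - c)"
    using assms by (auto simp: e_def b2_def min_def max_def)
  finally show "expectation (\<lambda>\<omega>. \<zeta> \<omega> * ((W b \<omega> - W a \<omega>) * (W d \<omega> - W c \<omega>))) = max 0 (min b d - c) * expectation \<zeta>" .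
qed

text \<open>The intervals of an elementary process may overlap in any manner, so both orders of the
  left ends occur; exchanging the increments reduces one to the other.\<close>

lemma increment_product:
  fixes \<zeta> :: "'w \<Rightarrow> real"
  assumes "0 \<le> a" "a \<le> b" "0 \<le> c" "c \<le> d"
    and \<zeta>: "\<zeta> \<in> borel_measurable (\<F> (max a c))" "bounded (\<zeta> ` space M)"
  shows "integrable M (\<lambda>\<omega>. \<zeta> \<omega> * ((W b \<omega> - W a \<omega>) * (W d \<omega> - W c \<omega>)))"
    "expectation (\<lambda>\<omega>. \<zeta> \<omega> * ((W b \<omega> - W a \<omega>) * (W d \<omega> - W c \<omega>))) =
       max 0 (min b d - max a c) * expectation \<zeta>"
proof -
  have "integrable M (\<lambda>\<omega>. \<zeta> \<omega> * ((W b \<omega> - W a \<omega>) * (W d \<omega> - W c \<omega>))) \<and>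
    expectation (\<lambda>\<omega>. \<zeta> \<omega> * ((W b \<omega> - W a \<omega>) * (W d \<omega> - W c \<omega>))) =
       max 0 (min b d - max a c) * expectation \<zeta>"
  proof (cases "a \<le> c")
    case True
    then show ?thesis using increment_product_ordered[of a b c d \<zeta>] assms by (simp add: max_def)
  next
    case False
    then show ?thesis using increment_product_ordered[of c d a b \<zeta>] assms
      by (simp add: max_def min.commute mult.commute[of "W b _ - _"])
  qed
  then show "integrable M (\<lambda>\<omega>. \<zeta> \<omega> * ((W b \<omega> - W a \<omega>) * (W d \<omega> - W c \<omega>)))"
    "expectation (\<lambda>\<omega>. \<zeta> \<omega> * ((W b \<omega> - W a \<omega>) * (W d \<omega> - W c \<omega>))) =
       max 0 (min b d - max a c) * expectation \<zeta>" by auto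
qed

end

lemma bilinear_sum_scaleR:
  assumes "bounded_bilinear B"
  shows "B (\<Sum>i\<in>I. c i *\<^sub>R x i) (\<Sum>j\<in>J. d j *\<^sub>R y j) = (\<Sum>i\<in>I. \<Sum>j\<in>J. (B (x i) (y j) :: real) * (c i * d j))"
proof -
  interpret bounded_bilinear B by fact
  have "B (\<Sum>i\<in>I. c i *\<^sub>R x i) (\<Sum>j\<in>J. d j *\<^sub>R y j) = (\<Sum>i\<in>I. B (c i *\<^sub>R x i) (\<Sum>j\<in>J. d j *\<^sub>R y j))"
    by (rule sum_left)
  also have "\<dots> = (\<Sum>i\<in>I. \<Sum>j\<in>J. B (c i *\<^sub>R x i) (d j *\<^sub>R y j))"
    by (simp only: sum_right)
  finally show ?thesis by (simp add: scaleR_left scaleR_right mult_ac)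
qed

lemma integral_double_sum:
  fixes f :: "nat \<Rightarrow> nat \<Rightarrow> 'w \<Rightarrow> real"
  assumes "\<And>i j. i < N \<Longrightarrow> j < N \<Longrightarrow> integrable M (f i j)"
  shows "(LINT x|M. (\<Sum>i<N. \<Sum>j<N. f i j x)) = (\<Sum>i<N. \<Sum>j<N. integral\<^sup>L M (f i j))"
proof -
  have "(LINT x|M. (\<Sum>i<N. \<Sum>j<N. f i j x)) = (\<Sum>i<N. (LINT x|M. (\<Sum>j<N. f i j x)))"
    by (rule Bochner_Integration.integral_sum) (auto intro!: Bochner_Integration.integrable_sum assms)
  also have "\<dots> = (\<Sum>i<N. \<Sum>j<N. integral\<^sup>L M (f i j))"
    by (intro sum.cong refl Bochner_Integration.integral_sum) (auto intro!: assms)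
  finally show ?thesis .
qed

section \<open>The product space of sample points and times up to t\<close>

abbreviation time_measure :: "real \<Rightarrow> real measure" where
  "time_measure t \<equiv> restrict_space lborel {0..t}"

lemma finite_measure_time: "finite_measure (time_measure t)"
  by (intro finite_measureI) (auto simp: emeasure_restrict_space space_restrict_space emeasure_lborel_Icc_eq)

text \<open>Tonelli. The sample point is the first coordinate of the product and time the second,
  the opposite of the order in \<open>progressive\<close>.\<close>

lemma sq_norm_upto_eq:
  assumes "(\<lambda>(\<omega>, s). H s \<omega>) \<in> borel_measurable (M \<Otimes>\<^sub>M time_measure t)"
  shows "sq_norm_upto M t H = (\<integral>\<^sup>+z. ennreal ((norm (H (snd z) (fst z)))\<^sup>2) \<partial>(M \<Otimes>\<^sub>M time_measure t))"
proof -
  interpret T: finite_measure "time_measure t" by (rule finite_measure_time)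
  have "(\<lambda>z. ennreal ((norm (H (snd z) (fst z)))\<^sup>2)) \<in> borel_measurable (M \<Otimes>\<^sub>M time_measure t)"
    using assms by (simp add: split_beta')
  from T.nn_integral_fst[OF this] show ?thesis
    unfolding sq_norm_upto_def by (simp add: nn_integral_restrict_space)
qed

context brownian begin

abbreviation MT :: "real \<Rightarrow> ('w \<times> real) measure" where
  "MT t \<equiv> M \<Otimes>\<^sub>M time_measure t"

lemma finite_measure_MT: "finite_measure (MT t)"
  by (intro finite_measure_pair_measure finite_measure_time) unfold_locales

lemma pair_sigma_finite_MT: "pair_sigma_finite M (time_measure t)"
proof -
  interpret T: finite_measure "time_measure t" by (rule finite_measure_time)
  show ?thesis by unfold_locales
qed

lemma progressive_measurable:
  assumes "progressive M W H" "t \<ge> 0"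
  shows "(\<lambda>(\<omega>, s). H s \<omega>) \<in> borel_measurable (MT t)"
proof -
  have "(\<lambda>(s, \<omega>). H s \<omega>) \<in> borel_measurable (restrict_space borel {0..t} \<Otimes>\<^sub>M \<F> t)"
    using assms by (simp add: progressive_def)
  moreover have "(\<lambda>z. (snd z, fst z)) \<in> MT t \<rightarrow>\<^sub>M (restrict_space borel {0..t} \<Otimes>\<^sub>M \<F> t)"
  proof (rule measurable_Pair)
    have "sets (time_measure t) = sets (restrict_space borel {0..t})"
      by (rule sets_restrict_space_cong) simp
    then show "snd \<in> MT t \<rightarrow>\<^sub>M restrict_space borel {0..t}"
      using measurable_snd[of M "time_measure t"] measurable_cong_sets by blast
    have "id \<in> M \<rightarrow>\<^sub>M \<F> t"
      using sets_\<F>_subset[of t] sets.sets_into_space[of _ "\<F> t"] 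
      by (intro measurableI) (auto simp: Int_absorb2)
    from measurable_compose[OF measurable_fst this]
    show "fst \<in> MT t \<rightarrow>\<^sub>M \<F> t" by simp
  qed
  ultimately have "(\<lambda>z. (\<lambda>(s, \<omega>). H s \<omega>) (snd z, fst z)) \<in> borel_measurable (MT t)"
    by (rule measurable_compose[rotated])
  then show ?thesis by (simp add: split_beta')
qed

lemma elementary_measurable:
  assumes "elementary M W N a b \<xi>" "i < N"
  shows "\<xi> i \<in> borel_measurable M"
  using assms measurable_\<F>_M by (auto simp: elementary_def)

lemma elementary_bounded:
  assumes "elementary M W N a b \<xi>" "i < N"
  obtains K where "\<And>\<omega>. \<omega> \<in> space M \<Longrightarrow> norm (\<xi> i \<omega>) \<le> K"
proof -
  have "bounded (\<xi> i ` space M)" using assms by (simp add: elementary_def)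
  then obtain K where "\<forall>x\<in>\<xi> i ` space M. norm x \<le> K" unfolding bounded_iff by blast
  then show thesis using that by blast
qed

lemma elementary_sqint:
  assumes "elementary M W N a b \<xi>" "i < N"
  shows "sqint M (\<xi> i)"
proof -
  obtain K where K: "\<And>\<omega>. \<omega> \<in> space M \<Longrightarrow> norm (\<xi> i \<omega>) \<le> K"
    using elementary_bounded[OF assms] by blast
  show ?thesis
    by (rule sqint_dominated[where h="\<lambda>_. K\<^sup>2"])
       (use K elementary_measurable[OF assms] in \<open>auto intro: power_mono\<close>)
qed

lemma elementary_integral_sqint:
  assumes "elementary M W N a b \<xi>" "t \<ge> 0"
  shows "sqint M (elementary_integral W N a b \<xi> t)"
proof -
  have "sqint M (\<lambda>\<omega>. (W (min (b i) t) \<omega> - W (min (a i) t) \<omega>) *\<^sub>R \<xi> i \<omega>)" if iN: "i < N" for i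
  proof -
    have ab: "0 \<le> a i" "a i \<le> b i" using assms that by (auto simp: elementary_def)
    obtain K where K: "\<And>\<omega>. \<omega> \<in> space M \<Longrightarrow> norm (\<xi> i \<omega>) \<le> K"
      using elementary_bounded[OF assms(1) iN] by blast
    have "0 \<le> min (a i) t" "min (a i) t \<le> min (b i) t" using ab assms(2) by auto
    note incr = increment_moments[OF this]
    show ?thesis
    proof (rule sqint_dominated[where h="\<lambda>\<omega>. (W (min (b i) t) \<omega> - W (min (a i) t) \<omega>)\<^sup>2 * K\<^sup>2"])
      show "(\<lambda>\<omega>. (W (min (b i) t) \<omega> - W (min (a i) t) \<omega>) *\<^sub>R \<xi> i \<omega>) \<in> borel_measurable M"
        using elementary_measurable[OF assms(1) that] W_measurable_M ab assms(2)
        by (intro borel_measurable_scaleR borel_measurable_diff) auto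
    next
      fix \<omega> assume "\<omega> \<in> space M"
      then show "(norm ((W (min (b i) t) \<omega> - W (min (a i) t) \<omega>) *\<^sub>R \<xi> i \<omega>))\<^sup>2
         \<le> (W (min (b i) t) \<omega> - W (min (a i) t) \<omega>)\<^sup>2 * K\<^sup>2"
        using K[of \<omega>] by (auto simp: power_mult_distrib intro!: mult_left_mono power_mono)
    qed (use incr in simp)
  qed
  then have "sqint M (\<lambda>\<omega>. \<Sum>i<N. (W (min (b i) t) \<omega> - W (min (a i) t) \<omega>) *\<^sub>R \<xi> i \<omega>)"
    by (intro sqint_sum) auto
  then show ?thesis by (simp add: elementary_integral_def[abs_def])
qed

text \<open>Once the intervals are clipped to [s, t], every summand of the difference is a Brownian
  increment times data known at its left end, so its mean vanishes.\<close>

lemma elementary_integral_orthogonal: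
  fixes B :: "'b::euclidean_space \<Rightarrow> 'a::euclidean_space \<Rightarrow> real" and \<xi> :: "nat \<Rightarrow> 'w \<Rightarrow> 'a"
  assumes el: "elementary M W N a b \<xi>" and st: "0 \<le> s" "s \<le> t"
    and \<eta>: "\<eta> \<in> borel_measurable (\<F> s)" "sqint M \<eta>" and B: "bounded_bilinear B"
  shows "expectation (\<lambda>\<omega>. B (\<eta> \<omega>) (elementary_integral W N a b \<xi> t \<omega>)) =
    expectation (\<lambda>\<omega>. B (\<eta> \<omega>) (elementary_integral W N a b \<xi> s \<omega>))"
proof -
  let ?S = "elementary_integral W N a b \<xi>"
  define D where "D = (\<lambda>i \<omega>. W (min (max (b i) s) t) \<omega> - W (min (max (a i) s) t) \<omega>)"
  have diff: "?S t \<omega> - ?S s \<omega> = (\<Sum>i<N. D i \<omega> *\<^sub>R \<xi> i \<omega>)" for \<omega>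
  proof -
    have "(W (min (b i) t) \<omega> - W (min (a i) t) \<omega>) *\<^sub>R \<xi> i \<omega> - (W (min (b i) s) \<omega> - W (min (a i) s) \<omega>) *\<^sub>R \<xi> i \<omega>
      = D i \<omega> *\<^sub>R \<xi> i \<omega>" if "i < N" for i
    proof -
      have "a i \<le> b i" using el that by (auto simp: elementary_def)
      then have "W (min (b i) t) \<omega> - W (min (a i) t) \<omega> - (W (min (b i) s) \<omega> - W (min (a i) s) \<omega>) = D i \<omega>"
        using st unfolding D_def by (auto simp: min_def max_def)
      then show ?thesis by (metis scaleR_left_diff_distrib)
    qed
    then show ?thesis unfolding elementary_integral_def sum_subtractf[symmetric] by (intro sum.cong) auto
  qed
  have trm: "integrable M (\<lambda>\<omega>. B (\<eta> \<omega>) (\<xi> i \<omega>) * D i \<omega>) \<and> expectation (\<lambda>\<omega>. B (\<eta> \<omega>) (\<xi> i \<omega>) * D i \<omega>) = 0"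
    if "i < N" for i
  \<comment> \<open>If a i >= t, the clipped left end is t and \<open>\<xi> i\<close> may be unknown
    there; but then the clipped increment is 0.\<close>
  proof (cases "a i < t")
    case True
    have ab: "0 \<le> a i" "a i \<le> b i" "\<xi> i \<in> borel_measurable (\<F> (a i))" using el that by (auto simp: elementary_def)
    define c d where "c = min (max (a i) s) t" and "d = min (max (b i) s) t"
    have cd: "0 \<le> c" "c \<le> d" "a i \<le> c" "s \<le> c" using True st ab by (auto simp: c_def d_def)
    have "(\<lambda>\<omega>. B (\<eta> \<omega>) (\<xi> i \<omega>)) \<in> borel_measurable (\<F> c)"
      using measurable_\<F>_mono[OF \<eta>(1) cd(4)] measurable_\<F>_mono[OF ab(3) cd(3)] B by (rule measurable_bilinear)
    from increment_orthogonal(1,2)[OF cd(1,2) this integrable_bilinear[OF \<eta>(2) elementary_sqint[OF el that] B]]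
    show ?thesis by (simp add: D_def c_def d_def)
  next
    case False
    moreover have "a i \<le> b i" using el that by (auto simp: elementary_def)
    ultimately have "min (max (b i) s) t = t" "min (max (a i) s) t = t" by auto
    then have "D i = (\<lambda>_. 0)" by (simp add: D_def)
    then show ?thesis by simp
  qed
  have "expectation (\<lambda>\<omega>. B (\<eta> \<omega>) (?S t \<omega> - ?S s \<omega>)) = expectation (\<lambda>\<omega>. \<Sum>i<N. B (\<eta> \<omega>) (\<xi> i \<omega>) * D i \<omega>)"
    unfolding diff by (simp add: bounded_bilinear.sum_right[OF B] bounded_bilinear.scaleR_right[OF B] mult.commute)
  also have "\<dots> = 0" using trm by (subst Bochner_Integration.integral_sum) auto
  finally have "expectation (\<lambda>\<omega>. B (\<eta> \<omega>) (?S t \<omega>) - B (\<eta> \<omega>) (?S s \<omega>)) = 0"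
    by (simp add: bounded_bilinear.diff_right[OF B])
  then show ?thesis
    using integrable_bilinear[OF \<eta>(2) elementary_integral_sqint[OF el, of t] B]
      integrable_bilinear[OF \<eta>(2) elementary_integral_sqint[OF el, of s] B] st by simp
qed

lemma elementary_process_component_sqint:
  fixes \<xi> :: "nat \<Rightarrow> 'w \<Rightarrow> 'a::euclidean_space"
  assumes "elementary M W N a b \<xi>" "i < N"
  shows "sqint (MT t) (\<lambda>z. indicat_real {a i<..b i} (snd z) *\<^sub>R \<xi> i (fst z))"
proof -
  interpret finite_measure "MT t" by (rule finite_measure_MT)
  obtain K where K: "\<And>\<omega>. \<omega> \<in> space M \<Longrightarrow> norm (\<xi> i \<omega>) \<le> K"
    using elementary_bounded[OF assms] by blast
  have [measurable]: "\<xi> i \<in> borel_measurable M" by (rule elementary_measurable) fact+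
  have [measurable]: "snd \<in> borel_measurable (MT t)"
    by (rule measurable_compose[OF measurable_snd]) (auto intro: measurable_restrict_space1)
  show ?thesis
  proof (rule sqint_dominated[where h="\<lambda>_. K\<^sup>2"])
    show "(\<lambda>z. indicat_real {a i<..b i} (snd z) *\<^sub>R \<xi> i (fst z)) \<in> borel_measurable (MT t)"
      by measurable
    fix z assume "z \<in> space (MT t)"
    then have "norm (\<xi> i (fst z)) \<le> K" using K by (auto simp: space_pair_measure)
    then show "(norm (indicat_real {a i<..b i} (snd z) *\<^sub>R \<xi> i (fst z)))\<^sup>2 \<le> K\<^sup>2"
      by (auto simp: indicator_def power_mono)
  qed simp
qed

lemma elementary_process_sqint:
  assumes "elementary M W N a b \<xi>"
  shows "sqint (MT t) (\<lambda>z. elementary_process N a b \<xi> (snd z) (fst z))"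
  unfolding elementary_process_def
  by (intro sqint_sum elementary_process_component_sqint[OF assms]) auto

text \<open>Both sides expand into the same double sum. The weight of a pair of summands is the
  overlap of their intervals up to t: on the left as the covariance of two increments, on the right
  as the integral of a product of indicators.\<close>

lemma elementary_isometry:
  fixes B :: "'a::euclidean_space \<Rightarrow> 'a \<Rightarrow> real" and \<xi> :: "nat \<Rightarrow> 'w \<Rightarrow> 'a"
  assumes el: "elementary M W N a b \<xi>" and t: "0 \<le> t" and B: "bounded_bilinear B"
  shows "expectation (\<lambda>\<omega>. B (elementary_integral W N a b \<xi> t \<omega>) (elementary_integral W N a b \<xi> t \<omega>)) =
    (LINT z|MT t. B (elementary_process N a b \<xi> (snd z) (fst z)) (elementary_process N a b \<xi> (snd z) (fst z)))"
proof -
  interpret T: finite_measure "time_measure t" by (rule finite_measure_time)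
  interpret P: pair_sigma_finite M "time_measure t" by (rule pair_sigma_finite_MT)
  define D where "D = (\<lambda>i \<omega>. W (min (b i) t) \<omega> - W (min (a i) t) \<omega>)"
  define h where "h = (\<lambda>i s. indicat_real {a i<..b i} s)"
  \<comment> \<open>Overlap length after clipping at t, in the shape that
    \<open>increment_product\<close> delivers.\<close>
  define L where "L = (\<lambda>i j. max 0 (min (min (b i) t) (min (b j) t) - max (min (a i) t) (min (a j) t)))"
  have trm1: "integrable M (\<lambda>\<omega>. B (\<xi> i \<omega>) (\<xi> j \<omega>) * (D i \<omega> * D j \<omega>)) \<and>
    expectation (\<lambda>\<omega>. B (\<xi> i \<omega>) (\<xi> j \<omega>) * (D i \<omega> * D j \<omega>)) = L i j * expectation (\<lambda>\<omega>. B (\<xi> i \<omega>) (\<xi> j \<omega>))"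
    if ij: "i < N" "j < N" for i j
  \<comment> \<open>As with orthogonality, a coefficient that becomes known only at or after t comes
    with a vanishing increment, and the overlap is then 0 too.\<close>
  proof (cases "a i < t \<and> a j < t")
    case True
    have ab: "0 \<le> a i" "a i \<le> b i" "\<xi> i \<in> borel_measurable (\<F> (a i))" "bounded (\<xi> i ` space M)"
      "0 \<le> a j" "a j \<le> b j" "\<xi> j \<in> borel_measurable (\<F> (a j))" "bounded (\<xi> j ` space M)"
      using el ij by (auto simp: elementary_def)
    have m: "(\<lambda>\<omega>. B (\<xi> i \<omega>) (\<xi> j \<omega>)) \<in> borel_measurable (\<F> (max (min (a i) t) (min (a j) t)))"
      using True by (intro measurable_bilinear[OF _ _ B] measurable_\<F>_mono[OF ab(3)] measurable_\<F>_mono[OF ab(7)]) auto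
    obtain K1 where K1: "\<And>\<omega>. \<omega> \<in> space M \<Longrightarrow> norm (\<xi> i \<omega>) \<le> K1"
      using elementary_bounded[OF el ij(1)] by blast
    obtain K2 where K2: "\<And>\<omega>. \<omega> \<in> space M \<Longrightarrow> norm (\<xi> j \<omega>) \<le> K2"
      using elementary_bounded[OF el ij(2)] by blast
    obtain K where KB: "\<And>x y. norm (B x y) \<le> norm x * norm y * K" "K > 0"
      using bounded_bilinear.pos_bounded[OF B] by blast
    have bd: "bounded ((\<lambda>\<omega>. B (\<xi> i \<omega>) (\<xi> j \<omega>)) ` space M)"
    proof (rule boundedI)
      fix x assume "x \<in> (\<lambda>\<omega>. B (\<xi> i \<omega>) (\<xi> j \<omega>)) ` space M"
      then obtain \<omega> where w: "\<omega> \<in> space M" "x = B (\<xi> i \<omega>) (\<xi> j \<omega>)" by auto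
      have "norm x \<le> norm (\<xi> i \<omega>) * norm (\<xi> j \<omega>) * K" using KB(1) w by simp
      also have "\<dots> \<le> \<bar>K1\<bar> * \<bar>K2\<bar> * K"
        using order_trans[OF K1[OF w(1)] abs_ge_self] order_trans[OF K2[OF w(1)] abs_ge_self] KB(2)
        by (intro mult_right_mono mult_mono) auto
      finally show "norm x \<le> \<bar>K1\<bar> * \<bar>K2\<bar> * K" .
    qed
    show ?thesis
      using increment_product[OF _ _ _ _ m bd, of "min (b i) t" "min (b j) t"] ab t
      unfolding D_def L_def by auto
  next
    case False
    then have "D i = (\<lambda>_. 0) \<or> D j = (\<lambda>_. 0)"
      using el ij t by (auto simp: elementary_def D_def min_def fun_eq_iff)
    moreover have "L i j = 0" using False unfolding L_def by linarith
    ultimately show ?thesis by auto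
  qed
  have trm2: "integrable (MT t) (\<lambda>z. B (\<xi> i (fst z)) (\<xi> j (fst z)) * (h i (snd z) * h j (snd z))) \<and>
    (LINT z|MT t. B (\<xi> i (fst z)) (\<xi> j (fst z)) * (h i (snd z) * h j (snd z))) = L i j * expectation (\<lambda>\<omega>. B (\<xi> i \<omega>) (\<xi> j \<omega>))"
    if ij: "i < N" "j < N" for i j
  proof -
    have "integrable (MT t) (\<lambda>z. B (h i (snd z) *\<^sub>R \<xi> i (fst z)) (h j (snd z) *\<^sub>R \<xi> j (fst z)))"
      unfolding h_def by (intro integrable_bilinear[OF _ _ B] elementary_process_component_sqint[OF el ij(1)]
        elementary_process_component_sqint[OF el ij(2)])
    then have int: "integrable (MT t) (\<lambda>z. B (\<xi> i (fst z)) (\<xi> j (fst z)) * (h i (snd z) * h j (snd z)))"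
      by (simp add: bounded_bilinear.scaleR_left[OF B] bounded_bilinear.scaleR_right[OF B] mult_ac)
    have "a i \<ge> 0" "a j \<ge> 0" using el ij by (auto simp: elementary_def)
    then have set: "{a i<..b i} \<inter> {a j<..b j} \<inter> {0..t} = {max (a i) (a j) <.. min (min (b i) (b j)) t}"
      by auto
    have "(LINT s|time_measure t. h i s * h j s) = (LINT s|lborel. indicat_real {0..t} s *\<^sub>R (h i s * h j s))"
      by (rule integral_restrict_space) simp
    also have "\<dots> = (LINT s|lborel. indicat_real {max (a i) (a j) <.. min (min (b i) (b j)) t} s)"
      unfolding set[symmetric] h_def by (intro Bochner_Integration.integral_cong) (auto simp: indicator_def)
    also have "\<dots> = max 0 (min (min (b i) (b j)) t - max (a i) (a j))"
    proof -
      have "(LINT s|lborel. indicat_real {p<..q} s) = max 0 (q - p)" for p q :: real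
        by (cases "p \<le> q") auto
      then show ?thesis .
    qed
    also have "\<dots> = L i j"
    proof -
      define p q where "p = max (a i) (a j)" and "q = min (min (b i) (b j)) t"
      have eqs: "min (min (b i) t) (min (b j) t) = q" "max (min (a i) t) (min (a j) t) = min p t"
        by (simp_all add: p_def q_def min.commute min.left_commute min_max_distrib1)
      \<comment> \<open>Clipping the left end at t changes something only if p > t; then neither
        difference is positive, because q <= t.\<close>
      have "q \<le> t" by (simp add: q_def)
      then have "max 0 (q - p) = max 0 (q - min p t)" by (cases "p \<le> t") (simp_all add: min_def max_def)
      then show ?thesis unfolding L_def eqs by (simp only: p_def q_def)
    qed
    finally have L: "(LINT s|time_measure t. h i s * h j s) = L i j" .
    have "(LINT z|MT t. B (\<xi> i (fst z)) (\<xi> j (fst z)) * (h i (snd z) * h j (snd z))) =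
       (LINT \<omega>|M. LINT s|time_measure t. B (\<xi> i \<omega>) (\<xi> j \<omega>) * (h i s * h j s))"
      using P.integral_fst'[OF int] by simp
    then show ?thesis using int by (simp add: L mult.commute)
  qed
  have "expectation (\<lambda>\<omega>. B (elementary_integral W N a b \<xi> t \<omega>) (elementary_integral W N a b \<xi> t \<omega>)) =
    expectation (\<lambda>\<omega>. \<Sum>i<N. \<Sum>j<N. B (\<xi> i \<omega>) (\<xi> j \<omega>) * (D i \<omega> * D j \<omega>))"
    unfolding elementary_integral_def D_def
    by (simp only: bilinear_sum_scaleR[OF B])
  also have "\<dots> = (\<Sum>i<N. \<Sum>j<N. L i j * expectation (\<lambda>\<omega>. B (\<xi> i \<omega>) (\<xi> j \<omega>)))"
    using trm1 by (subst integral_double_sum) auto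
  also have "\<dots> = (LINT z|MT t. (\<Sum>i<N. \<Sum>j<N. B (\<xi> i (fst z)) (\<xi> j (fst z)) * (h i (snd z) * h j (snd z))))"
    using trm2 by (subst integral_double_sum) auto
  also have "\<dots> = (LINT z|MT t. B (elementary_process N a b \<xi> (snd z) (fst z)) (elementary_process N a b \<xi> (snd z) (fst z)))"
    unfolding elementary_process_def h_def
    by (simp only: bilinear_sum_scaleR[OF B])
  finally show ?thesis .
qed

end

section \<open>The Ito integral\<close>

lemma L2_null_diff:
  fixes f g :: "nat \<Rightarrow> 'w \<Rightarrow> 'a::euclidean_space"
  assumes "\<And>k. f k \<in> borel_measurable M" "\<And>k. g k \<in> borel_measurable M"
    and "(\<lambda>k. \<integral>\<^sup>+x. ennreal ((norm (f k x))\<^sup>2) \<partial>M) \<longlonglongrightarrow> 0"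
    and "(\<lambda>k. \<integral>\<^sup>+x. ennreal ((norm (g k x))\<^sup>2) \<partial>M) \<longlonglongrightarrow> 0"
  shows "(\<lambda>k. \<integral>\<^sup>+x. ennreal ((norm (f k x - g k x))\<^sup>2) \<partial>M) \<longlonglongrightarrow> 0"
proof -
  let ?r = "\<lambda>k. 2 * (\<integral>\<^sup>+x. ennreal ((norm (f k x))\<^sup>2) \<partial>M) + 2 * (\<integral>\<^sup>+x. ennreal ((norm (g k x))\<^sup>2) \<partial>M)"
  have "?r \<longlonglongrightarrow> 2 * 0 + 2 * 0"
    by (intro tendsto_add ennreal_tendsto_cmult assms) auto
  then have r: "?r \<longlonglongrightarrow> 0" by simp
  have "(\<integral>\<^sup>+x. ennreal ((norm (f k x - g k x))\<^sup>2) \<partial>M) \<le> ?r k" for k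
  proof -
    have "ennreal ((norm (f k x - g k x))\<^sup>2) \<le> 2 * ennreal ((norm (f k x))\<^sup>2) + 2 * ennreal ((norm (g k x))\<^sup>2)" for x
    proof -
      have "ennreal ((norm (f k x - g k x))\<^sup>2) \<le> ennreal (2 * (norm (f k x))\<^sup>2 + 2 * (norm (g k x))\<^sup>2)"
        using power2_norm_add_le[of "f k x" "- g k x"] by (intro ennreal_leI) simp
      then show ?thesis by (simp add: ennreal_mult)
    qed
    then have "(\<integral>\<^sup>+x. ennreal ((norm (f k x - g k x))\<^sup>2) \<partial>M) \<le>
      (\<integral>\<^sup>+x. 2 * ennreal ((norm (f k x))\<^sup>2) + 2 * ennreal ((norm (g k x))\<^sup>2) \<partial>M)"
      by (intro nn_integral_mono)
    also have "\<dots> = ?r k"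
      using assms(1,2)[of k] by (subst nn_integral_add) (auto simp: nn_integral_cmult)
    finally show ?thesis .
  qed
  then show ?thesis
    by (intro tendsto_sandwich[OF _ _ tendsto_const r]) auto
qed

lemma sum_lessThan_add:
  "(\<Sum>i<m + n. f i) = (\<Sum>i<m. f i) + (\<Sum>i<n. f (m + i))" for f :: "nat \<Rightarrow> 'a::comm_monoid_add"
  by (induction n) (auto simp: add.assoc)

context brownian begin

lemma ito_integrand_sqint:
  assumes "is_ito_integral M W H I" "t \<ge> 0"
  shows "sqint (MT t) (\<lambda>z. H (snd z) (fst z))"
proof -
  have "progressive M W H" "sq_norm_upto M t H < \<infinity>" using assms by (auto simp: is_ito_integral_def)
  then show ?thesis
    using progressive_measurable[of H t] sq_norm_upto_eq[of H M t] assms(2)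
    by (simp add: sqint_iff_nn_integral split_beta')
qed

text \<open>The approximants are reduced to abstract integrands P and integrals S together with the
  identities they satisfy. What follows uses only that these identities are stable under mean-square
  limits.\<close>

lemma ito_approximation:
  fixes H :: "real \<Rightarrow> 'w \<Rightarrow> 'a::euclidean_space"
  assumes "is_ito_integral M W H I"
  obtains P S where
    "\<And>k t. t \<ge> 0 \<Longrightarrow> sqint (MT t) (\<lambda>z. P k (snd z) (fst z))"
    "\<And>t. t \<ge> 0 \<Longrightarrow> (\<lambda>k. \<integral>\<^sup>+z. ennreal ((norm (P k (snd z) (fst z) - H (snd z) (fst z)))\<^sup>2) \<partial>MT t) \<longlonglongrightarrow> 0"
    "\<And>k t. t \<ge> 0 \<Longrightarrow> sqint M (S k t)"
    "\<And>t. t \<ge> 0 \<Longrightarrow> (\<lambda>k. \<integral>\<^sup>+\<omega>. ennreal ((norm (S k t \<omega> - I t \<omega>))\<^sup>2) \<partial>M) \<longlonglongrightarrow> 0"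
    "\<And>k t B. t \<ge> 0 \<Longrightarrow> bounded_bilinear B \<Longrightarrow> expectation (\<lambda>\<omega>. B (S k t \<omega>) (S k t \<omega>) :: real) =
        (LINT z|MT t. B (P k (snd z) (fst z)) (P k (snd z) (fst z)))"
    "\<And>k s t \<eta> B. 0 \<le> s \<Longrightarrow> s \<le> t \<Longrightarrow> \<eta> \<in> borel_measurable (\<F> s) \<Longrightarrow> sqint M \<eta> \<Longrightarrow> bounded_bilinear B \<Longrightarrow>
        expectation (\<lambda>\<omega>. B (\<eta> \<omega> :: 'a) (S k t \<omega>) :: real) = expectation (\<lambda>\<omega>. B (\<eta> \<omega>) (S k s \<omega>))"
    "\<And>k. S k 0 = (\<lambda>_. 0)"
proof -
  obtain N a b \<xi> where el: "\<And>k. elementary M W (N k) (a k) (b k) (\<xi> k)"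
    and l1: "\<And>T. T \<ge> 0 \<Longrightarrow> (\<lambda>k. sq_norm_upto M T
            (\<lambda>s \<omega>. elementary_process (N k) (a k) (b k) (\<xi> k) s \<omega> - H s \<omega>)) \<longlonglongrightarrow> 0"
    and l2: "\<And>t. t \<ge> 0 \<Longrightarrow> (\<lambda>k. \<integral>\<^sup>+\<omega>. ennreal ((norm
            (elementary_integral W (N k) (a k) (b k) (\<xi> k) t \<omega> - I t \<omega>))\<^sup>2) \<partial>M) \<longlonglongrightarrow> 0"
    using assms unfolding is_ito_integral_def by blast
  define P where "P = (\<lambda>k. elementary_process (N k) (a k) (b k) (\<xi> k))"
  define S where "S = (\<lambda>k. elementary_integral W (N k) (a k) (b k) (\<xi> k))"
  have sP: "sqint (MT t) (\<lambda>z. P k (snd z) (fst z))" for k t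
    unfolding P_def by (rule elementary_process_sqint[OF el])
  have eq: "sq_norm_upto M t (\<lambda>s \<omega>. P k s \<omega> - H s \<omega>) =
     (\<integral>\<^sup>+z. ennreal ((norm (P k (snd z) (fst z) - H (snd z) (fst z)))\<^sup>2) \<partial>MT t)" if "t \<ge> 0" for k t
    using sqint_measurable[OF sP[of t k]] sqint_measurable[OF ito_integrand_sqint[OF assms that]]
    by (intro sq_norm_upto_eq) (simp add: split_beta')
  have S0: "S k 0 = (\<lambda>_. 0)" for k
  proof
    fix \<omega>
    have "min (b k i) 0 = 0" "min (a k i) 0 = 0" if "i < N k" for i
      using el[of k] that by (auto simp: elementary_def)
    then show "S k 0 \<omega> = 0" unfolding S_def elementary_integral_def by simp
  qed
  show thesis
  proof (rule that[of P S])
    show "(\<lambda>k. \<integral>\<^sup>+z. ennreal ((norm (P k (snd z) (fst z) - H (snd z) (fst z)))\<^sup>2) \<partial>MT t) \<longlonglongrightarrow> 0" if "t \<ge> 0" for t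
      using l1[OF that] eq[OF that] by (simp add: P_def)
    show "(\<lambda>k. \<integral>\<^sup>+\<omega>. ennreal ((norm (S k t \<omega> - I t \<omega>))\<^sup>2) \<partial>M) \<longlonglongrightarrow> 0" if "t \<ge> 0" for t
      using l2[OF that] by (simp add: S_def)
    show "sqint M (S k t)" if "t \<ge> 0" for k t
      unfolding S_def by (rule elementary_integral_sqint[OF el that])
    show "expectation (\<lambda>\<omega>. B (S k t \<omega>) (S k t \<omega>) :: real) =
        (LINT z|MT t. B (P k (snd z) (fst z)) (P k (snd z) (fst z)))" if "t \<ge> 0" "bounded_bilinear B" for k t B
      unfolding S_def P_def by (rule elementary_isometry[OF el that])
    show "expectation (\<lambda>\<omega>. B (\<eta> \<omega> :: 'a) (S k t \<omega>) :: real) = expectation (\<lambda>\<omega>. B (\<eta> \<omega>) (S k s \<omega>))"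
      if "0 \<le> s" "s \<le> t" "\<eta> \<in> borel_measurable (\<F> s)" "sqint M \<eta>" "bounded_bilinear B" for k s t \<eta> B
      unfolding S_def by (rule elementary_integral_orthogonal[OF el that])
  qed (rule sP S0)+
qed

lemma ito_measurable:
  assumes "is_ito_integral M W H I" "t \<ge> 0"
  shows "I t \<in> borel_measurable M"
  using assms measurable_\<F>_M by (auto simp: is_ito_integral_def adapted_def)

lemma ito_sqint:
  fixes H :: "real \<Rightarrow> 'w \<Rightarrow> 'a::euclidean_space"
  assumes "is_ito_integral M W H I" "t \<ge> 0"
  shows "sqint M (I t)"
proof (rule ito_approximation[OF assms(1)])
  fix P S assume "\<And>k t. t \<ge> 0 \<Longrightarrow> sqint M (S k t)"
    "\<And>t. t \<ge> 0 \<Longrightarrow> (\<lambda>k::nat. \<integral>\<^sup>+\<omega>. ennreal ((norm (S k t \<omega> - I t \<omega>))\<^sup>2) \<partial>M) \<longlonglongrightarrow> 0"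
  from sqint_L2_limit(1)[OF this(1) ito_measurable[OF assms] this(2)] show ?thesis using assms(2) by simp
qed

text \<open>The elementary isometry holds along the approximating sequence and both sides converge.
  The form B stays general so that matrices other than the identity can be inserted.\<close>

lemma ito_isometry:
  fixes H :: "real \<Rightarrow> 'w \<Rightarrow> 'a::euclidean_space" and B :: "'a \<Rightarrow> 'a \<Rightarrow> real"
  assumes "is_ito_integral M W H I" "t \<ge> 0" and B: "bounded_bilinear B"
  shows "expectation (\<lambda>\<omega>. B (I t \<omega>) (I t \<omega>)) = (LINT z|MT t. B (H (snd z) (fst z)) (H (snd z) (fst z)))"
proof (rule ito_approximation[OF assms(1)])
  fix P S
  assume P0: "\<And>k t. t \<ge> 0 \<Longrightarrow> sqint (MT t) (\<lambda>z. P k (snd z) (fst z))"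
    and P1: "\<And>t. t \<ge> 0 \<Longrightarrow> (\<lambda>k::nat. \<integral>\<^sup>+z. ennreal ((norm (P k (snd z) (fst z) - H (snd z) (fst z)))\<^sup>2) \<partial>MT t) \<longlonglongrightarrow> 0"
    and S0: "\<And>k t. t \<ge> 0 \<Longrightarrow> sqint M (S k t)"
    and S1: "\<And>t. t \<ge> 0 \<Longrightarrow> (\<lambda>k::nat. \<integral>\<^sup>+\<omega>. ennreal ((norm (S k t \<omega> - I t \<omega>))\<^sup>2) \<partial>M) \<longlonglongrightarrow> 0"
    and iso: "\<And>k t B. t \<ge> 0 \<Longrightarrow> bounded_bilinear B \<Longrightarrow> expectation (\<lambda>\<omega>. B (S k t \<omega>) (S k t \<omega>) :: real) =
        (LINT z|MT t. B (P k (snd z) (fst z)) (P k (snd z) (fst z)))"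
  note P = P0[OF assms(2)] P1[OF assms(2)] and S = S0[OF assms(2)] S1[OF assms(2)] and eq = iso[OF assms(2) B]
  note Hm = sqint_measurable[OF ito_integrand_sqint[OF assms(1,2)]]
  have "(\<lambda>k. expectation (\<lambda>\<omega>. B (S k t \<omega>) (S k t \<omega>))) \<longlonglongrightarrow> expectation (\<lambda>\<omega>. B (I t \<omega>) (I t \<omega>))"
    by (rule L2_limit_bilinear[OF S(1) ito_measurable[OF assms(1,2)] S(2) S(1) ito_measurable[OF assms(1,2)] S(2) B])
  moreover have "(\<lambda>k. LINT z|MT t. B (P k (snd z) (fst z)) (P k (snd z) (fst z)))
      \<longlonglongrightarrow> (LINT z|MT t. B (H (snd z) (fst z)) (H (snd z) (fst z)))"
    by (rule L2_limit_bilinear[OF P(1) Hm P(2) P(1) Hm P(2) B])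
  ultimately show ?thesis unfolding eq by (rule LIMSEQ_unique)
qed

text \<open>Limit of the elementary orthogonality. \<open>is_ito_integral\<close> does not state the
  value of I at 0; the second claim comes from the elementary integrals, which vanish there.\<close>

lemma ito_orthogonal:
  fixes H :: "real \<Rightarrow> 'w \<Rightarrow> 'a::euclidean_space" and B :: "'a \<Rightarrow> 'a \<Rightarrow> real"
  assumes ito: "is_ito_integral M W H I" and st: "0 \<le> s" "s \<le> t"
    and \<eta>: "\<eta> \<in> borel_measurable (\<F> s)" "sqint M \<eta>" and B: "bounded_bilinear B"
  shows "expectation (\<lambda>\<omega>. B (\<eta> \<omega>) (I t \<omega>)) = expectation (\<lambda>\<omega>. B (\<eta> \<omega>) (I s \<omega>))"
    and "expectation (\<lambda>\<omega>. B (\<eta> \<omega>) (I 0 \<omega>)) = 0"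
proof -
  \<comment> \<open>\<open>good\<close> keeps from the approximation only what concerns the fixed s,
    t, \<open>\<eta>\<close> and B.\<close>
  define good where "good S \<longleftrightarrow> (\<forall>k t. t \<ge> 0 \<longrightarrow> sqint M (S k t)) \<and>
    (\<forall>t\<ge>0. (\<lambda>k::nat. \<integral>\<^sup>+\<omega>. ennreal ((norm (S k t \<omega> - I t \<omega>))\<^sup>2) \<partial>M) \<longlonglongrightarrow> 0) \<and>
    (\<forall>k. expectation (\<lambda>\<omega>. B (\<eta> \<omega>) (S k t \<omega>)) = expectation (\<lambda>\<omega>. B (\<eta> \<omega>) (S k s \<omega>))) \<and>
    (\<forall>k. S k 0 = (\<lambda>_. 0))" for S :: "nat \<Rightarrow> real \<Rightarrow> 'w \<Rightarrow> 'a"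
  have "\<exists>S. good S"
  proof (rule ito_approximation[OF ito])
    fix P S
    assume S0: "\<And>k t. t \<ge> 0 \<Longrightarrow> sqint M (S k t)"
      and S1: "\<And>t. t \<ge> 0 \<Longrightarrow> (\<lambda>k::nat. \<integral>\<^sup>+\<omega>. ennreal ((norm (S k t \<omega> - I t \<omega>))\<^sup>2) \<partial>M) \<longlonglongrightarrow> 0"
      and orth: "\<And>k s t \<eta> B. 0 \<le> s \<Longrightarrow> s \<le> t \<Longrightarrow> \<eta> \<in> borel_measurable (\<F> s) \<Longrightarrow> sqint M \<eta> \<Longrightarrow> bounded_bilinear B \<Longrightarrow>
        expectation (\<lambda>\<omega>. B (\<eta> \<omega> :: 'a) (S k t \<omega>) :: real) = expectation (\<lambda>\<omega>. B (\<eta> \<omega>) (S k s \<omega>))"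
      and zero: "\<And>k. S k 0 = (\<lambda>_. 0)"
    have "good S"
      unfolding good_def
      by (intro conjI allI impI S0 S1 zero orth[OF st \<eta> B])
    then show ?thesis by blast
  qed
  then obtain S where "good S" ..
  then have S: "\<And>k t. t \<ge> 0 \<Longrightarrow> sqint M (S k t)"
    "\<And>t. t \<ge> 0 \<Longrightarrow> (\<lambda>k. \<integral>\<^sup>+\<omega>. ennreal ((norm (S k t \<omega> - I t \<omega>))\<^sup>2) \<partial>M) \<longlonglongrightarrow> 0"
    and eq: "\<And>k. expectation (\<lambda>\<omega>. B (\<eta> \<omega>) (S k t \<omega>)) = expectation (\<lambda>\<omega>. B (\<eta> \<omega>) (S k s \<omega>))"
    and S0: "\<And>k. S k 0 = (\<lambda>_. 0)" unfolding good_def by blast+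
  have null: "(\<lambda>k::nat. \<integral>\<^sup>+\<omega>. ennreal ((norm (\<eta> \<omega> - \<eta> \<omega>))\<^sup>2) \<partial>M) \<longlonglongrightarrow> 0" by simp
  have lim: "(\<lambda>k. expectation (\<lambda>\<omega>. B (\<eta> \<omega>) (S k r \<omega>))) \<longlonglongrightarrow> expectation (\<lambda>\<omega>. B (\<eta> \<omega>) (I r \<omega>))" if "r \<ge> 0" for r
    by (rule L2_limit_bilinear[OF \<eta>(2) sqint_measurable[OF \<eta>(2)] null S(1)[OF that]
      ito_measurable[OF ito that] S(2)[OF that] B])
  show "expectation (\<lambda>\<omega>. B (\<eta> \<omega>) (I t \<omega>)) = expectation (\<lambda>\<omega>. B (\<eta> \<omega>) (I s \<omega>))"
    using lim[of t] lim[of s] st unfolding eq by (auto intro: LIMSEQ_unique)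
  show "expectation (\<lambda>\<omega>. B (\<eta> \<omega>) (I 0 \<omega>)) = 0"
    using lim[of 0] unfolding S0 by (simp add: bounded_bilinear.zero_right[OF B] LIMSEQ_const_iff)
qed

section \<open>Differences of Ito integrals\<close>

text \<open>Because \<open>elementary\<close> allows overlapping intervals, the two lists are simply
  concatenated, the second with negated coefficients, in place of passing to a common
  refinement.\<close>

lemma elementary_diff:
  fixes \<xi>1 \<xi>2 :: "nat \<Rightarrow> 'w \<Rightarrow> 'a::euclidean_space"
  assumes "elementary M W N1 a1 b1 \<xi>1" "elementary M W N2 a2 b2 \<xi>2"
  defines "a \<equiv> \<lambda>i. if i < N1 then a1 i else a2 (i - N1)"
    and "b \<equiv> \<lambda>i. if i < N1 then b1 i else b2 (i - N1)"
    and "\<xi> \<equiv> \<lambda>i. if i < N1 then \<xi>1 i else (\<lambda>\<omega>. - \<xi>2 (i - N1) \<omega>)"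
  shows "elementary M W (N1 + N2) a b \<xi>"
    "elementary_process (N1 + N2) a b \<xi> s \<omega> = elementary_process N1 a1 b1 \<xi>1 s \<omega> - elementary_process N2 a2 b2 \<xi>2 s \<omega>"
    "elementary_integral W (N1 + N2) a b \<xi> t \<omega> = elementary_integral W N1 a1 b1 \<xi>1 t \<omega> - elementary_integral W N2 a2 b2 \<xi>2 t \<omega>"
proof -
  have "bounded ((\<lambda>\<omega>. - \<xi>2 i \<omega>) ` space M)" if "bounded (\<xi>2 i ` space M)" for i
    using that unfolding bounded_iff by simp
  then show "elementary M W (N1 + N2) a b \<xi>"
    using assms(1,2) by (auto simp: elementary_def a_def b_def \<xi>_def)
  show "elementary_process (N1 + N2) a b \<xi> s \<omega> = elementary_process N1 a1 b1 \<xi>1 s \<omega> - elementary_process N2 a2 b2 \<xi>2 s \<omega>"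
    unfolding elementary_process_def sum_lessThan_add
    by (simp add: a_def b_def \<xi>_def sum_negf)
  show "elementary_integral W (N1 + N2) a b \<xi> t \<omega> = elementary_integral W N1 a1 b1 \<xi>1 t \<omega> - elementary_integral W N2 a2 b2 \<xi>2 t \<omega>"
    unfolding elementary_integral_def sum_lessThan_add
    by (simp add: a_def b_def \<xi>_def sum_negf)
qed

lemma progressive_diff:
  assumes "progressive M W H1" "progressive M W H2"
  shows "progressive M W (\<lambda>s \<omega>. H1 s \<omega> - H2 s \<omega>)"
  using assms unfolding progressive_def by (auto simp: split_beta' intro!: borel_measurable_diff)

lemma adapted_diff: "adapted M W X \<Longrightarrow> adapted M W Y \<Longrightarrow> adapted M W (\<lambda>t \<omega>. X t \<omega> - Y t \<omega>)"
  unfolding adapted_def by (auto intro: borel_measurable_diff)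

lemma continuous_paths_diff:
  "continuous_paths M X \<Longrightarrow> continuous_paths M Y \<Longrightarrow> continuous_paths M (\<lambda>t \<omega>. X t \<omega> - Y t \<omega>)"
  unfolding continuous_paths_def by (auto intro: continuous_on_diff)

text \<open>The approximating sequences are subtracted term by term and the errors added by
  \<open>L2_null_diff\<close>. This is what turns the difference of two solutions into a
  solution.\<close>

lemma ito_diff:
  fixes H1 H2 :: "real \<Rightarrow> 'w \<Rightarrow> 'a::euclidean_space"
  assumes ito1: "is_ito_integral M W H1 I1" and ito2: "is_ito_integral M W H2 I2"
  shows "is_ito_integral M W (\<lambda>s \<omega>. H1 s \<omega> - H2 s \<omega>) (\<lambda>t \<omega>. I1 t \<omega> - I2 t \<omega>)"
proof -
  have pr: "progressive M W (\<lambda>s \<omega>. H1 s \<omega> - H2 s \<omega>)"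
    using ito1 ito2 by (intro progressive_diff) (auto simp: is_ito_integral_def)
  have fin: "sq_norm_upto M T (\<lambda>s \<omega>. H1 s \<omega> - H2 s \<omega>) < \<infinity>" if "T \<ge> 0" for T
  proof -
    have "sqint (MT T) (\<lambda>z. H1 (snd z) (fst z) - H2 (snd z) (fst z))"
      by (intro sqint_diff ito_integrand_sqint[OF ito1] ito_integrand_sqint[OF ito2] that)
    then show ?thesis
      by (subst sq_norm_upto_eq) (auto simp: sqint_iff_nn_integral split_beta')
  qed
  obtain N1 a1 b1 \<xi>1 where el1: "\<And>k. elementary M W (N1 k) (a1 k) (b1 k) (\<xi>1 k)"
    and l1: "\<And>T. T \<ge> 0 \<Longrightarrow> (\<lambda>k. sq_norm_upto M T
            (\<lambda>s \<omega>. elementary_process (N1 k) (a1 k) (b1 k) (\<xi>1 k) s \<omega> - H1 s \<omega>)) \<longlonglongrightarrow> 0"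
    and m1: "\<And>t. t \<ge> 0 \<Longrightarrow> (\<lambda>k. \<integral>\<^sup>+\<omega>. ennreal ((norm
            (elementary_integral W (N1 k) (a1 k) (b1 k) (\<xi>1 k) t \<omega> - I1 t \<omega>))\<^sup>2) \<partial>M) \<longlonglongrightarrow> 0"
    using ito1 unfolding is_ito_integral_def by blast
  obtain N2 a2 b2 \<xi>2 where el2: "\<And>k. elementary M W (N2 k) (a2 k) (b2 k) (\<xi>2 k)"
    and l2: "\<And>T. T \<ge> 0 \<Longrightarrow> (\<lambda>k. sq_norm_upto M T
            (\<lambda>s \<omega>. elementary_process (N2 k) (a2 k) (b2 k) (\<xi>2 k) s \<omega> - H2 s \<omega>)) \<longlonglongrightarrow> 0"
    and m2: "\<And>t. t \<ge> 0 \<Longrightarrow> (\<lambda>k. \<integral>\<^sup>+\<omega>. ennreal ((norm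
            (elementary_integral W (N2 k) (a2 k) (b2 k) (\<xi>2 k) t \<omega> - I2 t \<omega>))\<^sup>2) \<partial>M) \<longlonglongrightarrow> 0"
    using ito2 unfolding is_ito_integral_def by blast
  define N where "N = (\<lambda>k. N1 k + N2 k)"
  define a where "a = (\<lambda>k i. if i < N1 k then a1 k i else a2 k (i - N1 k))"
  define b where "b = (\<lambda>k i. if i < N1 k then b1 k i else b2 k (i - N1 k))"
  define \<xi> where "\<xi> = (\<lambda>k i. if i < N1 k then \<xi>1 k i else (\<lambda>\<omega>. - \<xi>2 k (i - N1 k) \<omega>))"
  have e0: "elementary M W (N k) (a k) (b k) (\<xi> k)" for k
    using elementary_diff(1)[OF el1[of k] el2[of k]] unfolding N_def a_def b_def \<xi>_def .
  have e1: "elementary_process (N k) (a k) (b k) (\<xi> k) s \<omega> =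
     elementary_process (N1 k) (a1 k) (b1 k) (\<xi>1 k) s \<omega> - elementary_process (N2 k) (a2 k) (b2 k) (\<xi>2 k) s \<omega>" for k s \<omega>
    using elementary_diff(2)[OF el1[of k] el2[of k]] unfolding N_def a_def b_def \<xi>_def .
  have e2: "elementary_integral W (N k) (a k) (b k) (\<xi> k) t \<omega> =
     elementary_integral W (N1 k) (a1 k) (b1 k) (\<xi>1 k) t \<omega> - elementary_integral W (N2 k) (a2 k) (b2 k) (\<xi>2 k) t \<omega>" for k t \<omega>
    using elementary_diff(3)[OF el1[of k] el2[of k]] unfolding N_def a_def b_def \<xi>_def .
  have "(\<lambda>k. sq_norm_upto M T (\<lambda>s \<omega>. elementary_process (N k) (a k) (b k) (\<xi> k) s \<omega> - (H1 s \<omega> - H2 s \<omega>))) \<longlonglongrightarrow> 0"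
    if T: "T \<ge> 0" for T
  proof -
    define f where "f = (\<lambda>k z. elementary_process (N1 k) (a1 k) (b1 k) (\<xi>1 k) (snd z) (fst z) - H1 (snd z) (fst z))"
    define g where "g = (\<lambda>k z. elementary_process (N2 k) (a2 k) (b2 k) (\<xi>2 k) (snd z) (fst z) - H2 (snd z) (fst z))"
    have mf: "f k \<in> borel_measurable (MT T)" for k
      unfolding f_def
      by (intro borel_measurable_diff sqint_measurable elementary_process_sqint[OF el1] ito_integrand_sqint[OF ito1] T)
    have mg: "g k \<in> borel_measurable (MT T)" for k
      unfolding g_def
      by (intro borel_measurable_diff sqint_measurable elementary_process_sqint[OF el2] ito_integrand_sqint[OF ito2] T)
    have nf: "(\<lambda>k. \<integral>\<^sup>+z. ennreal ((norm (f k z))\<^sup>2) \<partial>MT T) \<longlonglongrightarrow> 0"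
      using l1[OF T] mf by (subst (asm) sq_norm_upto_eq) (auto simp: f_def split_beta')
    have ng: "(\<lambda>k. \<integral>\<^sup>+z. ennreal ((norm (g k z))\<^sup>2) \<partial>MT T) \<longlonglongrightarrow> 0"
      using l2[OF T] mg by (subst (asm) sq_norm_upto_eq) (auto simp: g_def split_beta')
    have eq: "f k z - g k z = elementary_process (N k) (a k) (b k) (\<xi> k) (snd z) (fst z) - (H1 (snd z) (fst z) - H2 (snd z) (fst z))" for k z
      unfolding f_def g_def e1 by simp
    have "(\<lambda>z. f k z - g k z) \<in> borel_measurable (MT T)" for k using mf mg by simp
    then show ?thesis
      using L2_null_diff[OF mf mg nf ng] unfolding eq by (subst sq_norm_upto_eq) (auto simp: split_beta')
  qed
  moreover have "(\<lambda>k. \<integral>\<^sup>+\<omega>. ennreal ((norm (elementary_integral W (N k) (a k) (b k) (\<xi> k) t \<omega> - (I1 t \<omega> - I2 t \<omega>)))\<^sup>2) \<partial>M) \<longlonglongrightarrow> 0"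
    if t: "t \<ge> 0" for t
  proof -
    have "(\<lambda>k. \<integral>\<^sup>+\<omega>. ennreal ((norm ((elementary_integral W (N1 k) (a1 k) (b1 k) (\<xi>1 k) t \<omega> - I1 t \<omega>) -
        (elementary_integral W (N2 k) (a2 k) (b2 k) (\<xi>2 k) t \<omega> - I2 t \<omega>)))\<^sup>2) \<partial>M) \<longlonglongrightarrow> 0"
      by (intro L2_null_diff m1 m2 t borel_measurable_diff ito_measurable[OF ito1] ito_measurable[OF ito2]
        sqint_measurable elementary_integral_sqint[OF el1] elementary_integral_sqint[OF el2])
    then show ?thesis unfolding e2 by (simp add: algebra_simps)
  qed
  moreover have "adapted M W (\<lambda>t \<omega>. I1 t \<omega> - I2 t \<omega>)" "continuous_paths M (\<lambda>t \<omega>. I1 t \<omega> - I2 t \<omega>)"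
    using ito1 ito2 by (auto simp: is_ito_integral_def intro: adapted_diff continuous_paths_diff)
  ultimately show ?thesis
    using pr fin e0 unfolding is_ito_integral_def by blast
qed

end

section \<open>Second moments of solutions of linear equations\<close>

text \<open>Rounding time down to the grid of mesh 1 / (n+1) gives functions that depend on time
  through countably many values only, hence jointly measurable; path continuity makes them converge.
  The measure N is left open to cover both bounded intervals and the half-line.\<close>

lemma continuous_paths_measurable:
  fixes X :: "real \<Rightarrow> 'w \<Rightarrow> 'a::euclidean_space"
  assumes meas: "\<And>t. t \<ge> 0 \<Longrightarrow> X t \<in> borel_measurable M" and cont: "continuous_paths M X"
    and N: "sets N = sets (restrict_space borel A)" "A \<subseteq> {0..}"
  shows "(\<lambda>z. X (snd z) (fst z)) \<in> borel_measurable (M \<Otimes>\<^sub>M N)"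
proof (rule borel_measurable_LIMSEQ_metric)
  define r where "r = (\<lambda>(n::nat) (s::real). real_of_int \<lfloor>real (Suc n) * s\<rfloor> / real (Suc n))"
  have spN: "space N = A" using sets_eq_imp_space_eq[OF N(1)] by (simp add: space_restrict_space)
  have [measurable]: "(\<lambda>s. s) \<in> N \<rightarrow>\<^sub>M borel"
    unfolding measurable_cong_sets[OF N(1) refl] by (rule measurable_restrict_space1) simp
  have [measurable]: "snd \<in> M \<Otimes>\<^sub>M N \<rightarrow>\<^sub>M borel"
    by (rule measurable_compose[OF measurable_snd]) fact
  \<comment> \<open>For times in A the \<open>max 0\<close> changes nothing, but it keeps every grid
    point in the range where X is known to be measurable.\<close>
  show "(\<lambda>z. X (max 0 (r n (snd z))) (fst z)) \<in> borel_measurable (M \<Otimes>\<^sub>M N)" for n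
  proof -
    have "(\<lambda>z. \<lfloor>real (Suc n) * snd z\<rfloor>) \<in> M \<Otimes>\<^sub>M N \<rightarrow>\<^sub>M count_space UNIV" by measurable
    moreover have "(\<lambda>z. X (max 0 (real_of_int i / real (Suc n))) (fst z)) \<in> borel_measurable (M \<Otimes>\<^sub>M N)" for i
      by (rule measurable_compose[OF measurable_fst meas]) simp
    ultimately have "(\<lambda>z. X (max 0 (real_of_int \<lfloor>real (Suc n) * snd z\<rfloor> / real (Suc n))) (fst z)) \<in> borel_measurable (M \<Otimes>\<^sub>M N)"
      by (rule measurable_compose_countable[rotated])
    then show ?thesis by (simp add: r_def)
  qed
  fix z assume "z \<in> space (M \<Otimes>\<^sub>M N)"
  then have z: "fst z \<in> space M" "snd z \<ge> 0" using N spN by (auto simp: space_pair_measure)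
  have bound: "\<bar>r n s - s\<bar> \<le> 1 / real (Suc n)" for n s
  proof -
    have "\<bar>real_of_int \<lfloor>real (Suc n) * s\<rfloor> - real (Suc n) * s\<bar> \<le> 1" by linarith
    moreover have "r n s - s = (real_of_int \<lfloor>real (Suc n) * s\<rfloor> - real (Suc n) * s) / real (Suc n)"
      by (simp add: r_def field_simps del: of_nat_Suc)
    ultimately show ?thesis by (simp add: divide_right_mono del: of_nat_Suc)
  qed
  have "(\<lambda>n. r n (snd z) - snd z) \<longlonglongrightarrow> 0"
    by (rule Lim_null_comparison[OF _ LIMSEQ_inverse_real_of_nat])
       (use bound in \<open>auto simp: inverse_eq_divide\<close>)
  then have "(\<lambda>n. r n (snd z)) \<longlonglongrightarrow> snd z" by (simp add: LIM_zero_iff)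
  then have "(\<lambda>n. max 0 (r n (snd z))) \<longlonglongrightarrow> max 0 (snd z)" by (intro tendsto_max tendsto_const)
  then have lim: "(\<lambda>n. max 0 (r n (snd z))) \<longlonglongrightarrow> snd z" using z by simp
  have "continuous_on {0..} (\<lambda>t. X t (fst z))" using cont z by (simp add: continuous_paths_def)
  from continuous_on_tendsto_compose[OF this lim] z
  show "(\<lambda>n. X (max 0 (r n (snd z))) (fst z)) \<longlonglongrightarrow> X (snd z) (fst z)" by simp
qed

lemma sets_time_measure: "sets (time_measure t) = sets (restrict_space borel {0..t})"
  by (rule sets_restrict_space_cong) simp

lemma integral_time_measure:
  fixes f :: "real \<Rightarrow> 'a::euclidean_space"
  shows "(LINT s|time_measure t. f s) = (LBINT s:{0..t}. f s)"
  unfolding set_lebesgue_integral_def by (rule integral_restrict_space) simp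

lemma integrable_time_measure:
  fixes f :: "real \<Rightarrow> 'a::euclidean_space"
  assumes "continuous_on {0..t} f" shows "integrable (time_measure t) f"
  using borel_integrable_atLeastAtMost'[OF assms]
  by (simp add: integrable_restrict_space set_integrable_def)

lemma sqint_time_measure:
  fixes f :: "real \<Rightarrow> 'a::euclidean_space"
  assumes "continuous_on {0..t} f" shows "sqint (time_measure t) f"
proof -
  have "continuous_on {0..t} (\<lambda>s. (norm (f s))\<^sup>2)" using assms by (intro continuous_intros)
  from integrable_time_measure[OF this] integrable_time_measure[OF assms] show ?thesis
    by (auto simp: sqint_def)
qed

text \<open>For continuous f the Lebesgue integral equals the gauge integral, whose derivative rule
  then applies.\<close>

lemma integral_has_vector_derivative_lborel:
  fixes f :: "real \<Rightarrow> 'a::euclidean_space"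
  assumes f: "continuous_on {0..t} f" and s: "s \<in> {0..t}"
  shows "((\<lambda>u. LINT s|time_measure u. f s) has_vector_derivative f s) (at s within {0..t})"
proof (rule has_vector_derivative_transform[OF s _ integral_has_vector_derivative[OF assms]])
  fix u assume "u \<in> {0..t}"
  then have "continuous_on {0..u} f" using f by (auto intro: continuous_on_subset)
  from set_borel_integral_eq_integral(2)[OF borel_integrable_atLeastAtMost'[OF this]]
  show "(LINT s|time_measure u. f s) = integral {0..u} f" by (simp add: integral_time_measure)
qed

lemma sqint_cong_AE:
  assumes "sqint M f" "g \<in> borel_measurable M" "AE x in M. f x = g x"
  shows "sqint M g"
proof -
  have "(\<integral>\<^sup>+x. ennreal ((norm (g x))\<^sup>2) \<partial>M) = (\<integral>\<^sup>+x. ennreal ((norm (f x))\<^sup>2) \<partial>M)"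
    using assms(3) by (intro nn_integral_cong_AE) auto
  then show ?thesis using assms by (simp add: sqint_iff_nn_integral)
qed

context brownian begin

lemma integrable_MT_fst:
  fixes f :: "'w \<Rightarrow> real"
  assumes "integrable M f" shows "integrable (MT t) (\<lambda>z. f (fst z))"
proof -
  interpret T: finite_measure "time_measure t" by (rule finite_measure_time)
  have f: "f \<in> borel_measurable M" using assms by auto
  have "(\<integral>\<^sup>+z. ennreal (norm (f (fst z))) \<partial>MT t) = (\<integral>\<^sup>+\<omega>. \<integral>\<^sup>+s. ennreal (norm (f \<omega>)) \<partial>time_measure t \<partial>M)"
    using f by (subst T.nn_integral_fst[symmetric]) auto
  also have "\<dots> = (\<integral>\<^sup>+\<omega>. ennreal (norm (f \<omega>)) \<partial>M) * emeasure (time_measure t) (space (time_measure t))"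
    using f by (simp add: nn_integral_multc)
  also have "\<dots> < \<infinity>"
  proof -
    have "(\<integral>\<^sup>+\<omega>. ennreal (norm (f \<omega>)) \<partial>M) < \<infinity>" using assms by (simp add: integrable_iff_bounded)
    moreover have "emeasure (time_measure t) (space (time_measure t)) < \<infinity>"
      using T.emeasure_finite by (simp add: less_top[symmetric])
    ultimately show ?thesis by (simp only: ennreal_mult_less_top infinity_ennreal_def) simp
  qed
  finally show ?thesis using f by (simp add: integrable_iff_bounded)
qed

lemma sqint_MT_fst: "sqint M f \<Longrightarrow> sqint (MT t) (\<lambda>z. f (fst z))"
  unfolding sqint_def using integrable_MT_fst[of "\<lambda>x. (norm (f x))\<^sup>2" t] by auto

end

section \<open>Drift and martingale part of a solution\<close>

locale sde_solution = brownian M W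
  for M :: "'w measure" and W :: "real \<Rightarrow> 'w \<Rightarrow> real" +
  fixes F G :: "real^'n^'n" and f h x :: "real^'n" and X :: "real \<Rightarrow> 'w \<Rightarrow> real^'n"
  assumes solves: "solves_sde M W F f G h x X"
begin

text \<open>
  \<open>mart\<close> is defined as a remainder, so that the decomposition of \<open>X\<close> holds for every sample point;
  it agrees with the Ito integral almost surely.
\<close>

definition "\<alpha> s \<omega> = F *v X s \<omega> + f"
definition "\<beta> s \<omega> = G *v X s \<omega> + h"
definition "drift t \<omega> = (LINT s|time_measure t. \<alpha> s \<omega>)"
definition "mart t \<omega> = X t \<omega> - x - drift t \<omega>"

lemma X_adapted: "t \<ge> 0 \<Longrightarrow> X t \<in> borel_measurable (\<F> t)"
  using solves by (simp add: solves_sde_def adapted_def)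

lemma X_measurable: "t \<ge> 0 \<Longrightarrow> X t \<in> borel_measurable M"
  by (rule measurable_\<F>_M[OF X_adapted])

lemma X_continuous_paths: "continuous_paths M X"
  using solves by (simp add: solves_sde_def)

lemma X_continuous: "\<omega> \<in> space M \<Longrightarrow> continuous_on {0..t} (\<lambda>s. X s \<omega>)"
  using X_continuous_paths unfolding continuous_paths_def by (auto intro: continuous_on_subset)

lemma X_joint: "(\<lambda>z. X (snd z) (fst z)) \<in> borel_measurable (MT t)"
  by (rule continuous_paths_measurable[OF X_measurable X_continuous_paths sets_time_measure]) auto

lemma X_sqint_MT: assumes "t \<ge> 0" shows "sqint (MT t) (\<lambda>z. X (snd z) (fst z))"
proof -
  have "sq_norm_upto M t X < \<infinity>" using solves assms by (simp add: solves_sde_def)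
  then show ?thesis
    using X_joint[of t] sq_norm_upto_eq[of X M t]
    by (simp add: sqint_iff_nn_integral split_beta')
qed

lemma sqint_affine:
  fixes A :: "real^'k^'l"
  assumes "finite_measure N" "sqint N Y" shows "sqint N (\<lambda>z. A *v Y z + c)"
  by (rule sqint_add[OF sqint_linear[OF assms(2) matrix_vector_mul_bounded_linear] finite_measure.sqint_const[OF assms(1)]])

lemma \<alpha>_sqint_MT: "t \<ge> 0 \<Longrightarrow> sqint (MT t) (\<lambda>z. \<alpha> (snd z) (fst z))"
  unfolding \<alpha>_def by (intro sqint_affine finite_measure_MT X_sqint_MT)

lemma \<beta>_sqint_MT: "t \<ge> 0 \<Longrightarrow> sqint (MT t) (\<lambda>z. \<beta> (snd z) (fst z))"
  unfolding \<beta>_def by (intro sqint_affine finite_measure_MT X_sqint_MT)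

lemma \<alpha>_continuous: "\<omega> \<in> space M \<Longrightarrow> continuous_on {0..t} (\<lambda>s. \<alpha> s \<omega>)"
  unfolding \<alpha>_def
  by (intro continuous_on_add continuous_on_const bounded_linear.continuous_on[OF matrix_vector_mul_bounded_linear] X_continuous)

lemma \<alpha>_adapted: "t \<ge> 0 \<Longrightarrow> \<alpha> t \<in> borel_measurable (\<F> t)"
  unfolding \<alpha>_def
  by (intro borel_measurable_add borel_measurable_const measurable_compose[OF X_adapted]
    borel_measurable_continuous_onI linear_continuous_on matrix_vector_mul_bounded_linear)

lemma drift_measurable: "drift t \<in> borel_measurable M"
proof (cases "t \<ge> 0")
  case True
  interpret T: finite_measure "time_measure t" by (rule finite_measure_time)
  have "(\<lambda>(\<omega>, s). \<alpha> s \<omega>) \<in> borel_measurable (MT t)"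
    using sqint_measurable[OF \<alpha>_sqint_MT[OF True]] by (simp add: split_beta')
  then show ?thesis unfolding drift_def[abs_def] by (rule T.borel_measurable_lebesgue_integral)
next
  case False
  then have "drift t = (\<lambda>_. 0)"
    unfolding drift_def[abs_def] integral_time_measure set_lebesgue_integral_def by simp
  then show ?thesis by simp
qed

lemma drift_derivative:
  assumes "\<omega> \<in> space M" "s \<in> {0..t}"
  shows "((\<lambda>u. drift u \<omega>) has_vector_derivative \<alpha> s \<omega>) (at s within {0..t})"
  unfolding drift_def by (rule integral_has_vector_derivative_lborel[OF \<alpha>_continuous[OF assms(1)] assms(2)])

lemma drift_continuous: "\<omega> \<in> space M \<Longrightarrow> continuous_on {0..t} (\<lambda>s. drift s \<omega>)"
  using drift_derivative has_vector_derivative_continuous by (fastforce simp: continuous_on_eq_continuous_within)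

lemma drift_continuous_paths: "continuous_paths M drift"
  unfolding continuous_paths_def
proof
  fix \<omega> assume w: "\<omega> \<in> space M"
  show "continuous_on {0..} (\<lambda>t. drift t \<omega>)"
    unfolding continuous_on_eq_continuous_within
  proof
    fix s :: real assume "s \<in> {0..}"
    then have "continuous (at s within {0..s+1}) (\<lambda>t. drift t \<omega>)"
      using drift_continuous[OF w, of "s+1"] by (auto simp: continuous_on_eq_continuous_within)
    moreover have "at s within {0..s+1} = at s within {0..}"
      by (rule at_within_nhd[where S="{..<s+1}"]) auto
    ultimately show "continuous (at s within {0..}) (\<lambda>t. drift t \<omega>)" by simp
  qed
qed

lemma drift_joint: "(\<lambda>z. drift (snd z) (fst z)) \<in> borel_measurable (MT t)"
  by (rule continuous_paths_measurable[OF drift_measurable drift_continuous_paths sets_time_measure]) auto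

text \<open>Cauchy-Schwarz in time against the constant 1. The right side is the same for all times
  up to t, so it dominates the drift on \<open>MT t\<close> and not only at a single time.\<close>

lemma drift_bound:
  assumes w: "\<omega> \<in> space M" and st: "0 \<le> s" "s \<le> t"
  shows "(norm (drift s \<omega>))\<^sup>2 \<le> t * (LINT s|time_measure t. (norm (\<alpha> s \<omega>))\<^sup>2)"
proof -
  interpret T: finite_measure "time_measure t" by (rule finite_measure_time)
  have c: "continuous_on {0..t} (\<lambda>s. norm (\<alpha> s \<omega>))" "continuous_on {0..s} (\<lambda>s. norm (\<alpha> s \<omega>))"
    by (intro continuous_on_norm \<alpha>_continuous w)+
  have "norm (drift s \<omega>) \<le> (LINT r|time_measure s. norm (\<alpha> r \<omega>))"
    unfolding drift_def by (rule integral_norm_bound)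
  also have "\<dots> \<le> (LINT r|time_measure t. norm (\<alpha> r \<omega>))"
    unfolding integral_time_measure set_lebesgue_integral_def
    using borel_integrable_atLeastAtMost'[OF c(1)] borel_integrable_atLeastAtMost'[OF c(2)] st
    by (intro integral_mono) (auto simp: set_integrable_def indicator_def)
  also have "\<dots> = (LINT r|time_measure t. norm (1::real) * norm (\<alpha> r \<omega>))" by simp
  also have "\<dots> \<le> L2norm (time_measure t) (\<lambda>_. 1::real) * L2norm (time_measure t) (\<lambda>s. \<alpha> s \<omega>)"
    by (intro Cauchy_Schwarz_L2 T.sqint_const sqint_time_measure \<alpha>_continuous w)
  finally have "(norm (drift s \<omega>))\<^sup>2 \<le> (L2norm (time_measure t) (\<lambda>_. 1::real) * L2norm (time_measure t) (\<lambda>s. \<alpha> s \<omega>))\<^sup>2"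
    by (rule power_mono) simp
  also have "\<dots> = t * (LINT s|time_measure t. (norm (\<alpha> s \<omega>))\<^sup>2)"
    using st by (simp add: power_mult_distrib L2norm_power2 measure_restrict_space space_restrict_space)
  finally show ?thesis .
qed

lemma drift_bound_integrable:
  assumes "t \<ge> 0" shows "integrable M (\<lambda>\<omega>. t * (LINT s|time_measure t. (norm (\<alpha> s \<omega>))\<^sup>2))"
proof -
  interpret P: pair_sigma_finite M "time_measure t" by (rule pair_sigma_finite_MT)
  have "integrable (MT t) (\<lambda>z. (norm (\<alpha> (snd z) (fst z)))\<^sup>2)"
    using \<alpha>_sqint_MT[OF assms] by (simp add: sqint_def)
  from P.integrable_fst'[OF this] show ?thesis by simp
qed

lemma drift_sqint: "t \<ge> 0 \<Longrightarrow> sqint M (drift t)"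
  by (rule sqint_dominated[OF drift_measurable drift_bound_integrable drift_bound]) auto

lemma drift_sqint_MT: "t \<ge> 0 \<Longrightarrow> sqint (MT t) (\<lambda>z. drift (snd z) (fst z))"
  by (rule sqint_dominated[OF drift_joint integrable_MT_fst[OF drift_bound_integrable]])
     (auto simp: space_pair_measure space_restrict_space intro!: drift_bound)

lemma mart_sqint_MT: "t \<ge> 0 \<Longrightarrow> sqint (MT t) (\<lambda>z. mart (snd z) (fst z))"
  unfolding mart_def
  by (intro sqint_diff X_sqint_MT drift_sqint_MT finite_measure.sqint_const[OF finite_measure_MT])

lemma mart_ito: obtains I where "is_ito_integral M W \<beta> I" "AE \<omega> in M. \<forall>t\<ge>0. mart t \<omega> = I t \<omega>"
proof -
  obtain I where I: "is_ito_integral M W (\<lambda>s \<omega>. G *v X s \<omega> + h) I"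
    "AE \<omega> in M. \<forall>t\<ge>0. X t \<omega> = x + (LBINT s:{0..t}. F *v X s \<omega> + f) + I t \<omega>"
    using solves by (auto simp: solves_sde_def)
  have "AE \<omega> in M. \<forall>t\<ge>0. mart t \<omega> = I t \<omega>"
    using I(2) by eventually_elim (simp add: mart_def drift_def \<alpha>_def integral_time_measure)
  with I(1) show thesis using that[of I] by (simp add: \<beta>_def[abs_def])
qed

lemma mart_measurable: "t \<ge> 0 \<Longrightarrow> mart t \<in> borel_measurable M"
  unfolding mart_def[abs_def] using X_measurable drift_measurable by auto

lemma mart_sqint: assumes "t \<ge> 0" shows "sqint M (mart t)"
proof -
  obtain I where I: "is_ito_integral M W \<beta> I" "AE \<omega> in M. \<forall>t\<ge>0. mart t \<omega> = I t \<omega>" by (rule mart_ito)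
  have "AE \<omega> in M. I t \<omega> = mart t \<omega>" using I(2) by eventually_elim (use assms in simp)
  from sqint_cong_AE[OF ito_sqint[OF I(1) assms] mart_measurable[OF assms] this] show ?thesis .
qed

lemma X_sqint: assumes "t \<ge> 0" shows "sqint M (X t)"
proof -
  have "sqint M (\<lambda>\<omega>. mart t \<omega> + (x + drift t \<omega>))"
    by (intro sqint_add mart_sqint drift_sqint sqint_const assms)
  then show ?thesis by (simp add: mart_def)
qed

lemma mart_isometry:
  fixes B :: "real^'n \<Rightarrow> real^'n \<Rightarrow> real"
  assumes "t \<ge> 0" and B: "bounded_bilinear B"
  shows "expectation (\<lambda>\<omega>. B (mart t \<omega>) (mart t \<omega>)) = (LINT z|MT t. B (\<beta> (snd z) (fst z)) (\<beta> (snd z) (fst z)))"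
proof -
  obtain I where I: "is_ito_integral M W \<beta> I" "AE \<omega> in M. \<forall>t\<ge>0. mart t \<omega> = I t \<omega>" by (rule mart_ito)
  have "expectation (\<lambda>\<omega>. B (mart t \<omega>) (mart t \<omega>)) = expectation (\<lambda>\<omega>. B (I t \<omega>) (I t \<omega>))"
    using I(2) assms(1)
    by (intro integral_cong_AE measurable_bilinear[OF _ _ B] mart_measurable ito_measurable[OF I(1)]) auto
  then show ?thesis using ito_isometry[OF I(1) assms(1) B] by simp
qed

lemma mart_orthogonal:
  fixes B :: "real^'n \<Rightarrow> real^'n \<Rightarrow> real"
  assumes st: "0 \<le> s" "s \<le> t"
    and \<eta>: "\<eta> \<in> borel_measurable (\<F> s)" "sqint M \<eta>" and B: "bounded_bilinear B"
  shows "expectation (\<lambda>\<omega>. B (\<eta> \<omega>) (mart t \<omega>)) = expectation (\<lambda>\<omega>. B (\<eta> \<omega>) (mart s \<omega>))"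
    and "expectation (\<lambda>\<omega>. B (\<eta> \<omega>) (mart 0 \<omega>)) = 0"
proof -
  obtain I where I: "is_ito_integral M W \<beta> I" "AE \<omega> in M. \<forall>t\<ge>0. mart t \<omega> = I t \<omega>" by (rule mart_ito)
  have eq: "expectation (\<lambda>\<omega>. B (\<eta> \<omega>) (mart r \<omega>)) = expectation (\<lambda>\<omega>. B (\<eta> \<omega>) (I r \<omega>))" if "r \<ge> 0" for r
    using I(2) that
    by (intro integral_cong_AE measurable_bilinear[OF _ _ B] mart_measurable ito_measurable[OF I(1)] sqint_measurable[OF \<eta>(2)]) auto
  show "expectation (\<lambda>\<omega>. B (\<eta> \<omega>) (mart t \<omega>)) = expectation (\<lambda>\<omega>. B (\<eta> \<omega>) (mart s \<omega>))"
    using ito_orthogonal(1)[OF I(1) st \<eta> B] eq[of t] eq[of s] st by simp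
  show "expectation (\<lambda>\<omega>. B (\<eta> \<omega>) (mart 0 \<omega>)) = 0"
    using ito_orthogonal(2)[OF I(1) st \<eta> B] eq[of 0] by simp
qed

lemma \<alpha>_sqint: "t \<ge> 0 \<Longrightarrow> sqint M (\<alpha> t)"
  unfolding \<alpha>_def[abs_def] by (intro sqint_affine X_sqint) unfold_locales

text \<open>Orthogonality of the increments replaces \<open>mart t\<close> by \<open>mart s\<close> under the time integral.\<close>

lemma mart_drift:
  fixes B :: "real^'n \<Rightarrow> real^'n \<Rightarrow> real"
  assumes t: "t \<ge> 0" and B: "bounded_bilinear B"
  shows "expectation (\<lambda>\<omega>. B (drift t \<omega>) (mart t \<omega>)) = (LINT z|MT t. B (\<alpha> (snd z) (fst z)) (mart (snd z) (fst z)))"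
proof -
  interpret P: pair_sigma_finite M "time_measure t" by (rule pair_sigma_finite_MT)
  have i1: "integrable (MT t) (\<lambda>z. B (\<alpha> (snd z) (fst z)) (mart t (fst z)))"
    by (rule integrable_bilinear[OF \<alpha>_sqint_MT[OF t] sqint_MT_fst[OF mart_sqint[OF t]] B])
  have i2: "integrable (MT t) (\<lambda>z. B (\<alpha> (snd z) (fst z)) (mart (snd z) (fst z)))"
    by (rule integrable_bilinear[OF \<alpha>_sqint_MT[OF t] mart_sqint_MT[OF t] B])
  have "expectation (\<lambda>\<omega>. B (drift t \<omega>) (mart t \<omega>)) =
     (LINT \<omega>|M. LINT s|time_measure t. B (\<alpha> s \<omega>) (mart t \<omega>))"
  proof (rule Bochner_Integration.integral_cong[OF refl])
    fix \<omega> assume "\<omega> \<in> space M"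
    from integrable_time_measure[OF \<alpha>_continuous[OF this, of t]]
    show "B (drift t \<omega>) (mart t \<omega>) = (LINT s|time_measure t. B (\<alpha> s \<omega>) (mart t \<omega>))"
      unfolding drift_def by (rule integral_bounded_linear[OF bounded_bilinear.bounded_linear_left[OF B], symmetric])
  qed
  also have "\<dots> = (LINT s|time_measure t. LINT \<omega>|M. B (\<alpha> s \<omega>) (mart t \<omega>))"
    using i1 by (intro P.Fubini_integral[symmetric]) (simp add: split_beta')
  also have "\<dots> = (LINT s|time_measure t. LINT \<omega>|M. B (\<alpha> s \<omega>) (mart s \<omega>))"
    by (intro Bochner_Integration.integral_cong refl mart_orthogonal(1)[OF _ _ \<alpha>_adapted \<alpha>_sqint B])
       (auto simp: space_restrict_space)
  also have "\<dots> = (LINT z|MT t. B (\<alpha> (snd z) (fst z)) (mart (snd z) (fst z)))"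
    using P.integral_snd[of "\<lambda>\<omega> s. B (\<alpha> s \<omega>) (mart s \<omega>)"] i2 by (simp add: split_beta')
  finally show ?thesis .
qed

text \<open>Along each path the drift is differentiable, so the fundamental theorem of calculus
  applies to the square; symmetry of B merges the two terms of the product rule, and Fubini moves
  the expectation inside.\<close>

lemma drift_square:
  fixes B :: "real^'n \<Rightarrow> real^'n \<Rightarrow> real"
  assumes t: "t \<ge> 0" and B: "bounded_bilinear B" and sym: "\<And>u v. B u v = B v u"
  shows "expectation (\<lambda>\<omega>. B (x + drift t \<omega>) (x + drift t \<omega>)) =
    B x x + (LINT z|MT t. 2 * B (x + drift (snd z) (fst z)) (\<alpha> (snd z) (fst z)))"
proof -
  interpret P: pair_sigma_finite M "time_measure t" by (rule pair_sigma_finite_MT)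
  have int: "integrable (MT t) (\<lambda>z. 2 * B (x + drift (snd z) (fst z)) (\<alpha> (snd z) (fst z)))"
    by (intro Bochner_Integration.integrable_mult_right impI integrable_bilinear[OF _ _ B] sqint_add \<alpha>_sqint_MT drift_sqint_MT t
      finite_measure.sqint_const[OF finite_measure_MT])
  have "B (x + drift t \<omega>) (x + drift t \<omega>) = B x x + (LINT s|time_measure t. 2 * B (x + drift s \<omega>) (\<alpha> s \<omega>))"
    if w: "\<omega> \<in> space M" for \<omega>
  proof -
    have "(LINT s|lborel. indicator {0..t} s *\<^sub>R (2 * B (x + drift s \<omega>) (\<alpha> s \<omega>))) =
       B (x + drift t \<omega>) (x + drift t \<omega>) - B (x + drift 0 \<omega>) (x + drift 0 \<omega>)"
    proof (rule integral_FTC_atLeastAtMost[OF t])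
      fix s assume "0 \<le> s" "s \<le> t"
      then have "((\<lambda>u. x + drift u \<omega>) has_vector_derivative \<alpha> s \<omega>) (at s within {0..t})"
        using drift_derivative[OF w, of s t] by (auto intro!: derivative_eq_intros)
      from bounded_bilinear.has_vector_derivative[OF B this this]
      show "((\<lambda>u. B (x + drift u \<omega>) (x + drift u \<omega>)) has_vector_derivative 2 * B (x + drift s \<omega>) (\<alpha> s \<omega>)) (at s within {0..t})"
        by (simp add: sym[of "\<alpha> s \<omega>"])
    next
      show "continuous_on {0..t} (\<lambda>s. 2 * B (x + drift s \<omega>) (\<alpha> s \<omega>))"
        by (intro continuous_on_mult continuous_on_const bounded_bilinear.continuous_on[OF B] continuous_on_add
          drift_continuous \<alpha>_continuous w)
    qed
    moreover have "drift 0 \<omega> = 0"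
    proof -
      have "AE s in lborel. indicat_real {0..0} s *\<^sub>R \<alpha> s \<omega> = 0"
        using AE_lborel_singleton[of 0] by eventually_elim (auto simp: indicator_def)
      then show ?thesis
        unfolding drift_def integral_time_measure set_lebesgue_integral_def by (rule integral_eq_zero_AE)
    qed
    ultimately show ?thesis
      unfolding integral_time_measure set_lebesgue_integral_def by simp
  qed
  then have "expectation (\<lambda>\<omega>. B (x + drift t \<omega>) (x + drift t \<omega>)) =
      (LINT \<omega>|M. B x x + (LINT s|time_measure t. 2 * B (x + drift s \<omega>) (\<alpha> s \<omega>)))"
    by (intro Bochner_Integration.integral_cong) auto
  also have "\<dots> = B x x + (LINT \<omega>|M. (LINT s|time_measure t. 2 * B (x + drift s \<omega>) (\<alpha> s \<omega>)))"
    using P.integrable_fst'[OF int] by (subst Bochner_Integration.integral_add) (auto simp: prob_space)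
  also have "\<dots> = B x x + (LINT z|MT t. 2 * B (x + drift (snd z) (fst z)) (\<alpha> (snd z) (fst z)))"
    using P.integral_fst'[OF int] by simp
  finally show ?thesis .
qed

text \<open>This takes the place of the Ito formula for quadratic functions. Splitting X into x +
  \<open>drift\<close> and \<open>mart\<close>, the three parts of the square are handled by
  \<open>drift_square\<close>, \<open>mart_drift\<close> and \<open>mart_isometry\<close>; here
  \<open>\<gamma>\<close> is the expected generator.\<close>

theorem second_moment:
  fixes B :: "real^'n \<Rightarrow> real^'n \<Rightarrow> real"
  assumes t: "t \<ge> 0" and B: "bounded_bilinear B" and sym: "\<And>u v. B u v = B v u"
  defines "\<gamma> \<equiv> \<lambda>s. expectation (\<lambda>\<omega>. 2 * B (X s \<omega>) (F *v X s \<omega> + f) + B (G *v X s \<omega> + h) (G *v X s \<omega> + h))"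
  shows "expectation (\<lambda>\<omega>. B (X t \<omega>) (X t \<omega>)) = B x x + (LINT s|time_measure t. \<gamma> s)"
    and "integrable (time_measure t) \<gamma>"
proof -
  interpret P: pair_sigma_finite M "time_measure t" by (rule pair_sigma_finite_MT)
  let ?X = "\<lambda>z. X (snd z) (fst z)" and ?\<alpha> = "\<lambda>z. \<alpha> (snd z) (fst z)" and ?\<beta> = "\<lambda>z. \<beta> (snd z) (fst z)"
    and ?d = "\<lambda>z. drift (snd z) (fst z)" and ?m = "\<lambda>z. mart (snd z) (fst z)"
  interpret B: bounded_bilinear B by fact
  have Xd: "X s \<omega> = (x + drift s \<omega>) + mart s \<omega>" for s \<omega> by (simp add: mart_def)
  have gen: "B ((x + d) + m) ((x + d) + m) = B (x + d) (x + d) + 2 * (B x m + B d m) + B m m" for d m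
    using sym[of m x] sym[of m d] by (simp add: B.add_left B.add_right)
  have square: "B (X t \<omega>) (X t \<omega>) = B (x + drift t \<omega>) (x + drift t \<omega>) +
      2 * (B x (mart t \<omega>) + B (drift t \<omega>) (mart t \<omega>)) + B (mart t \<omega>) (mart t \<omega>)" for \<omega>
    using gen[of "drift t \<omega>" "mart t \<omega>"] by (simp only: Xd[symmetric])
  \<comment> \<open>The derivative of the drift square and the mixed drift-martingale term recombine
    into the pairing of the full state with \<open>\<alpha>\<close>.\<close>
  have gen': "2 * B (x + d) a + 2 * B a m = 2 * B ((x + d) + m) a" for d a m
    using sym[of a m] by (simp add: B.add_left)
  have cross: "2 * B (x + drift s \<omega>) a + 2 * B a (mart s \<omega>) = 2 * B (X s \<omega>) a" for s \<omega> a
    using gen'[of "drift s \<omega>" a "mart s \<omega>"] by (simp only: Xd[symmetric])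
  have sd: "sqint M (\<lambda>\<omega>. x + drift t \<omega>)" by (intro sqint_add drift_sqint sqint_const t)
  have mx: "expectation (\<lambda>\<omega>. B x (mart t \<omega>)) = 0"
    using mart_orthogonal[of 0 t "\<lambda>_. x", OF order_refl t _ sqint_const B] by simp
  have "expectation (\<lambda>\<omega>. B (X t \<omega>) (X t \<omega>)) = expectation (\<lambda>\<omega>. B (x + drift t \<omega>) (x + drift t \<omega>) +
      2 * (B x (mart t \<omega>) + B (drift t \<omega>) (mart t \<omega>)) + B (mart t \<omega>) (mart t \<omega>))"
    by (simp only: square)
  also have "\<dots> = expectation (\<lambda>\<omega>. B (x + drift t \<omega>) (x + drift t \<omega>)) +
      2 * (expectation (\<lambda>\<omega>. B x (mart t \<omega>)) + expectation (\<lambda>\<omega>. B (drift t \<omega>) (mart t \<omega>))) +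
      expectation (\<lambda>\<omega>. B (mart t \<omega>) (mart t \<omega>))"
    using integrable_bilinear[OF sd sd B] integrable_bilinear[OF sqint_const mart_sqint[OF t] B, of x]
      integrable_bilinear[OF drift_sqint[OF t] mart_sqint[OF t] B] integrable_bilinear[OF mart_sqint[OF t] mart_sqint[OF t] B]
    by simp
  also have "\<dots> = B x x + (LINT z|MT t. 2 * B (x + ?d z) (?\<alpha> z)) + 2 * (LINT z|MT t. B (?\<alpha> z) (?m z)) + (LINT z|MT t. B (?\<beta> z) (?\<beta> z))"
    using mx drift_square[OF t B sym] mart_drift[OF t B] mart_isometry[OF t B] by simp
  also have "\<dots> = B x x + (LINT z|MT t. 2 * B (x + ?d z) (?\<alpha> z) + 2 * B (?\<alpha> z) (?m z) + B (?\<beta> z) (?\<beta> z))"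
    using integrable_bilinear[OF sqint_add[OF finite_measure.sqint_const[OF finite_measure_MT] drift_sqint_MT[OF t]] \<alpha>_sqint_MT[OF t] B, of x]
      integrable_bilinear[OF \<alpha>_sqint_MT[OF t] mart_sqint_MT[OF t] B]
      integrable_bilinear[OF \<beta>_sqint_MT[OF t] \<beta>_sqint_MT[OF t] B]
    by simp
  also have "(\<lambda>z. 2 * B (x + ?d z) (?\<alpha> z) + 2 * B (?\<alpha> z) (?m z) + B (?\<beta> z) (?\<beta> z)) =
     (\<lambda>z. 2 * B (?X z) (?\<alpha> z) + B (?\<beta> z) (?\<beta> z))"
    by (simp only: cross)
  finally have eq: "expectation (\<lambda>\<omega>. B (X t \<omega>) (X t \<omega>)) = B x x + (LINT z|MT t. 2 * B (?X z) (?\<alpha> z) + B (?\<beta> z) (?\<beta> z))" .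
  have int: "integrable (MT t) (\<lambda>z. 2 * B (?X z) (?\<alpha> z) + B (?\<beta> z) (?\<beta> z))"
    using integrable_bilinear[OF X_sqint_MT[OF t] \<alpha>_sqint_MT[OF t] B]
      integrable_bilinear[OF \<beta>_sqint_MT[OF t] \<beta>_sqint_MT[OF t] B] by simp
  have int': "integrable (MT t) (case_prod (\<lambda>\<omega> s. 2 * B (X s \<omega>) (\<alpha> s \<omega>) + B (\<beta> s \<omega>) (\<beta> s \<omega>)))"
    using int by (simp add: split_beta')
  show "expectation (\<lambda>\<omega>. B (X t \<omega>) (X t \<omega>)) = B x x + (LINT s|time_measure t. \<gamma> s)"
    unfolding eq \<gamma>_def using P.integral_snd[OF int'] by (simp add: \<alpha>_def \<beta>_def split_beta')
  show "integrable (time_measure t) \<gamma>"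
    unfolding \<gamma>_def using P.integrable_snd[OF int'] by (simp add: \<alpha>_def \<beta>_def)
qed

lemma mean_square_integrable:
  assumes t: "t \<ge> 0"
  shows "integrable (time_measure t) (\<lambda>s. expectation (\<lambda>\<omega>. (norm (X s \<omega>))\<^sup>2))"
    and "(LINT s|time_measure t. expectation (\<lambda>\<omega>. (norm (X s \<omega>))\<^sup>2)) = (LINT z|MT t. (norm (X (snd z) (fst z)))\<^sup>2)"
proof -
  interpret P: pair_sigma_finite M "time_measure t" by (rule pair_sigma_finite_MT)
  have int: "integrable (MT t) (case_prod (\<lambda>\<omega> s. (norm (X s \<omega>))\<^sup>2))"
    using X_sqint_MT[OF t] by (simp add: sqint_def split_beta')
  show "integrable (time_measure t) (\<lambda>s. expectation (\<lambda>\<omega>. (norm (X s \<omega>))\<^sup>2))"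
    using P.integrable_snd[OF int] .
  show "(LINT s|time_measure t. expectation (\<lambda>\<omega>. (norm (X s \<omega>))\<^sup>2)) = (LINT z|MT t. (norm (X (snd z) (fst z)))\<^sup>2)"
    using P.integral_snd[OF int] by (simp add: split_beta')
qed

end

section \<open>The Lyapunov equation\<close>

definition lyapunov :: "real^'n^'n \<Rightarrow> real^'n^'n \<Rightarrow> real^'n^'n \<Rightarrow> real^'n^'n" where
  "lyapunov F G P = transpose F ** P + P ** F + transpose G ** P ** G"

definition form :: "real^'n^'n \<Rightarrow> real^'n \<Rightarrow> real^'n \<Rightarrow> real" where
  "form P u v = (P *v u) \<bullet> v"

lemma bounded_bilinear_form: "bounded_bilinear (form P)"
  unfolding form_def
  by (rule bounded_bilinear.comp1[OF bounded_bilinear_inner matrix_vector_mul_bounded_linear])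

lemma matrix_transpose_inner: "(transpose A *v u) \<bullet> v = u \<bullet> (A *v v)" for A :: "real^'k^'l"
  by (metis dot_lmul_matrix vector_transpose_matrix transpose_transpose)

lemma form_sym: "transpose P = P \<Longrightarrow> form P u v = form P v u"
  unfolding form_def by (metis matrix_transpose_inner inner_commute)

text \<open>Moving F and G to the other side of the inner product identifies the integrand of
  \<open>second_moment\<close> for f = h = 0 as a quadratic form again.\<close>

lemma form_lyapunov:
  assumes "transpose P = P"
  shows "2 * form P u (F *v u) + form P (G *v u) (G *v u) = form (lyapunov F G P) u u"
proof -
  have "form (lyapunov F G P) u u = (transpose F *v (P *v u)) \<bullet> u + (P *v (F *v u)) \<bullet> u + (transpose G *v (P *v (G *v u))) \<bullet> u"
    by (simp add: form_def lyapunov_def matrix_vector_mult_add_rdistrib inner_add_left matrix_vector_mul_assoc[symmetric])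
  also have "\<dots> = form P u (F *v u) + form P (F *v u) u + form P (G *v u) (G *v u)"
    by (simp add: form_def dot_lmul_matrix)
  finally show ?thesis using form_sym[OF assms, of u "F *v u"] by simp
qed

text \<open>Polarization: for symmetric P the diagonal values determine the bilinear form.\<close>

lemma form_eq_0_imp:
  assumes "transpose P = P" "\<And>u. form P u u = 0" shows "P = 0"
proof -
  interpret bounded_bilinear "form P" by (rule bounded_bilinear_form)
  have "form P u v = 0" for u v
    using assms(2)[of "u + v"] assms(2)[of u] assms(2)[of v] form_sym[OF assms(1), of u v]
    by (simp add: add_left add_right)
  then have "P *v u = 0" for u unfolding form_def by (metis inner_eq_zero_iff)
  then show ?thesis by (simp add: matrix_eq)
qed

lemma transpose_add: "transpose (A + B) = transpose A + transpose B"
  by (simp add: transpose_def vec_eq_iff)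

lemma transpose_diff: "transpose (A - B) = transpose A - transpose B"
  by (simp add: transpose_def vec_eq_iff)

lemma transpose_uminus: "transpose (- A) = - transpose A"
  by (simp add: transpose_def vec_eq_iff)

lemma transpose_scaleR: "transpose (c *\<^sub>R A) = c *\<^sub>R transpose A"
  by (simp add: transpose_def vec_eq_iff)

lemma matrix_add_mult: "(A + B) ** C = A ** C + B ** C" for A :: "real^'k^'l"
  by (simp add: matrix_eq matrix_vector_mul_assoc[symmetric] matrix_vector_mult_add_rdistrib)

lemma lyapunov_add: "lyapunov F G (P + Q) = lyapunov F G P + lyapunov F G Q"
  by (simp add: lyapunov_def matrix_add_ldistrib matrix_add_mult)

lemma lyapunov_scaleR: "lyapunov F G (c *\<^sub>R P) = c *\<^sub>R lyapunov F G P"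
  by (simp add: lyapunov_def scaleR_add_right matrix_scalar_ac scalar_matrix_assoc[symmetric])

lemma transpose_lyapunov: "transpose P = P \<Longrightarrow> transpose (lyapunov F G P) = lyapunov F G P"
  by (simp add: lyapunov_def transpose_add matrix_transpose_mul matrix_mul_assoc)

text \<open>Solvability by dimension: an injective endomorphism T of the space of all matrices is
  onto, and a preimage Q of \<open>- mat 1\<close> yields the symmetric solution
  \<open>Q + transpose Q\<close>.\<close>

lemma lyapunov_solvable:
  fixes F G :: "real^'n^'n"
  assumes inj: "\<And>P. transpose P = P \<Longrightarrow> lyapunov F G P = 0 \<Longrightarrow> P = 0"
  obtains P where "transpose P = P" "lyapunov F G P = - mat 1"
proof -
  \<comment> \<open>\<open>T\<close> extends \<open>lyapunov F G\<close> from symmetric matrices to all matrices without losing injectivity: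
    the antisymmetric part is kept.\<close>
  define T where "T = (\<lambda>Q. lyapunov F G (Q + transpose Q) + (Q - transpose Q))"
  have lin: "linear T"
    by (rule linearI) (simp_all add: T_def transpose_add transpose_scaleR lyapunov_add lyapunov_scaleR
      scaleR_add_right scaleR_diff_right algebra_simps)
  \<comment> \<open>Transposing T Q = R keeps the symmetric part and reverses the antisymmetric one,
    so comparing the two equations separates the parts.\<close>
  have parts: "lyapunov F G (Q + transpose Q) = R \<and> Q = transpose Q"
    if "T Q = R" "transpose R = R" for Q R
  proof -
    let ?L = "lyapunov F G (Q + transpose Q)"
    have L: "transpose ?L = ?L"
      by (rule transpose_lyapunov) (simp add: transpose_add add.commute)
    have 1: "?L + (Q - transpose Q) = R" using that by (simp add: T_def)
    from arg_cong[OF this, of transpose] have 2: "?L + (transpose Q - Q) = R"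
      by (simp add: transpose_add transpose_diff L that)
    have "?L $ i $ j = R $ i $ j" for i j
      using arg_cong[OF 1, of "\<lambda>A. A $ i $ j"] arg_cong[OF 2, of "\<lambda>A. A $ i $ j"] by simp
    then have "?L = R" by (simp add: vec_eq_iff)
    with 1 show ?thesis by simp
  qed
  have "Q = 0" if "T Q = 0" for Q
  proof -
    have p: "lyapunov F G (Q + transpose Q) = 0" "Q = transpose Q" using parts[OF that] by (auto simp: transpose_def vec_eq_iff)
    have "Q + transpose Q = 0" by (rule inj[OF _ p(1)]) (simp add: transpose_add add.commute)
    with p(2) have "(2::real) *\<^sub>R Q = 0" by (simp add: scaleR_2)
    then show ?thesis by simp
  qed
  then have "inj T" using linear_injective_0[OF lin] by blast
  then have "surj T" using linear_inj_imp_surj[OF lin] by simp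
  then obtain Q where Q: "T Q = - mat 1" by (metis surjD)
  have "lyapunov F G (Q + transpose Q) = - mat 1"
    by (rule parts[OF Q, THEN conjunct1]) (simp add: transpose_uminus)
  then show thesis by (intro that[of "Q + transpose Q"]) (simp_all add: transpose_add add.commute)
qed

section \<open>Integral inequalities in time\<close>

text \<open>The time integral is split at s. Applied to \<open>- msq\<close> it also serves as a
  lower bound, and with a = 0 as monotonicity of the integral in its upper limit.\<close>

lemma time_integral_increment:
  fixes \<gamma> :: "real \<Rightarrow> real"
  assumes "integrable (time_measure t) \<gamma>" "0 \<le> s" "s \<le> t" "\<And>r. s < r \<Longrightarrow> r \<le> t \<Longrightarrow> \<gamma> r \<le> a"
  shows "(LINT r|time_measure t. \<gamma> r) \<le> (LINT r|time_measure s. \<gamma> r) + a * (t - s)"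
proof -
  have int: "set_integrable lborel {0..t} \<gamma>"
    using assms(1) by (simp add: integrable_restrict_space set_integrable_def)
  have i1: "set_integrable lborel {0..s} \<gamma>" and i2: "set_integrable lborel {s<..t} \<gamma>"
    using assms by (auto intro: set_integrable_subset[OF int])
  have "{0..t} = {0..s} \<union> {s<..t}" "{0..s} \<inter> {s<..t} = {}" using assms by auto
  then have "(LBINT r:{0..t}. \<gamma> r) = (LBINT r:{0..s}. \<gamma> r) + (LBINT r:{s<..t}. \<gamma> r)"
    using set_integral_Un[OF _ i1 i2] by auto
  also have "(LBINT r:{s<..t}. \<gamma> r) \<le> (LBINT r:{s<..t}. a)"
    using assms by (intro set_integral_mono i2) (auto simp: set_integrable_def)
  also have "(LBINT r:{s<..t}. a) = a * (t - s)"
    using assms by (simp add: set_lebesgue_integral_def)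
  finally show ?thesis by (simp add: integral_time_measure)
qed

text \<open>
  Over each unit interval either \<open>\<phi>\<close> stays above \<open>c / \<delta>\<close> and does not increase, or it falls below
  \<open>c / \<delta>\<close> at some time and exceeds that level by at most \<open>c\<close> at the end.
\<close>

lemma dissipative_bound:
  fixes \<phi> \<gamma> :: "real \<Rightarrow> real"
  assumes int: "\<And>t. t \<ge> 0 \<Longrightarrow> integrable (time_measure t) \<gamma>"
    and \<phi>: "\<And>t. t \<ge> 0 \<Longrightarrow> \<phi> t = \<phi>0 + (LINT s|time_measure t. \<gamma> s)"
    and \<gamma>: "\<And>t. t \<ge> 0 \<Longrightarrow> \<gamma> t \<le> c - \<delta> * \<phi> t"
    and pos: "\<delta> > 0" "c \<ge> 0" "\<And>t. t \<ge> 0 \<Longrightarrow> \<phi> t \<ge> 0" "\<phi>0 \<ge> 0"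
    and t: "t \<ge> 0"
  shows "\<phi> t \<le> \<phi>0 + c / \<delta> + c"
proof -
  let ?C = "\<phi>0 + c / \<delta> + c"
  \<comment> \<open>Since \<open>\<gamma>\<close> is merely integrable, the differential inequality
    is used in this integrated form.\<close>
  have incr: "\<phi> t \<le> \<phi> s + a * (t - s)" if "0 \<le> s" "s \<le> t" "\<And>r. s < r \<Longrightarrow> r \<le> t \<Longrightarrow> \<gamma> r \<le> a" for s t a
    using time_integral_increment[OF int that] \<phi>[of s] \<phi>[of t] that by simp
  have \<gamma>c: "\<gamma> r \<le> c" if "r \<ge> 0" for r
    using \<gamma>[OF that] mult_nonneg_nonneg[of \<delta> "\<phi> r"] pos(1) pos(3)[OF that] by linarith
  have cd: "0 \<le> c / \<delta>" using pos by simp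
  \<comment> \<open>An excursion above the level c / \<open>\<delta>\<close> is followed for at most
    one time unit before the induction hypothesis takes over; this is the origin of the last summand
    c in \<open>?C\<close>.\<close>
  have "\<forall>t. 0 \<le> t \<and> t \<le> real n + 1 \<longrightarrow> \<phi> t \<le> ?C" for n
  proof (induction n)
    case 0
    show ?case
    proof safe
      fix t :: real assume t: "0 \<le> t" "t \<le> real 0 + 1"
      have "(LINT s|time_measure 0. \<gamma> s) = 0"
      proof -
        have "AE s in lborel. indicat_real {0..0} s *\<^sub>R \<gamma> s = 0"
          using AE_lborel_singleton[of 0] by eventually_elim (auto simp: indicator_def)
        then show ?thesis unfolding integral_time_measure set_lebesgue_integral_def by (rule integral_eq_zero_AE)
      qed
      then have "\<phi> 0 = \<phi>0" using \<phi>[of 0] by simp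
      moreover have "c * t \<le> c" using t pos mult_left_mono[of t 1 c] by simp
      ultimately show "\<phi> t \<le> ?C" using incr[of 0 t c] \<gamma>c t cd by auto
    qed
  next
    case (Suc n)
    show ?case
    proof safe
      fix t :: real assume t: "0 \<le> t" "t \<le> real (Suc n) + 1"
      show "\<phi> t \<le> ?C"
      proof (cases "t \<le> real n + 1")
        case True then show ?thesis using Suc t by auto
      next
        case False
        then have t1: "0 \<le> t - 1" "t - 1 \<le> real n + 1" using t by auto
        show ?thesis
        proof (cases "\<exists>r. t - 1 < r \<and> r \<le> t \<and> \<phi> r < c / \<delta>")
          case True
          then obtain r where r: "t - 1 < r" "r \<le> t" "\<phi> r < c / \<delta>" by auto
          have "\<phi> t \<le> \<phi> r + c * (t - r)" using r t1 by (intro incr \<gamma>c) auto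
          moreover have "c * (t - r) \<le> c" using mult_left_mono[of "t - r" 1 c] r pos by simp
          ultimately show ?thesis using r pos by linarith
        next
          case False
          have "\<gamma> r \<le> 0" if "t - 1 < r" "r \<le> t" for r
          proof -
            have "c / \<delta> \<le> \<phi> r" using False that by force
            then have "c \<le> \<delta> * \<phi> r" using pos by (simp add: field_simps)
            then show ?thesis using \<gamma>[of r] that t1 by linarith
          qed
          then have "\<phi> t \<le> \<phi> (t - 1) + 0 * (t - (t - 1))" using t1 by (intro incr) auto
          moreover have "\<phi> (t - 1) \<le> ?C" using Suc t1 by blast
          ultimately show ?thesis by simp
        qed
      qed
    qed
  qed
  moreover have "t \<le> real (nat \<lceil>t\<rceil>) + 1" by linarith
  ultimately show ?thesis using t by blast
qed

section \<open>Mean-square stability\<close>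

text \<open>The inhomogeneities f and h cancel. Path continuity makes both drift integrands
  integrable, so their integrals may be subtracted path by path.\<close>

lemma (in brownian) solves_sde_diff:
  assumes "solves_sde M W F f G h x X" "solves_sde M W F f G h z Z"
  shows "solves_sde M W F 0 G 0 (x - z) (\<lambda>t \<omega>. X t \<omega> - Z t \<omega>)"
proof -
  interpret X: sde_solution M W F G f h x X by unfold_locales fact
  interpret Z: sde_solution M W F G f h z Z by unfold_locales fact
  let ?Y = "\<lambda>t \<omega>. X t \<omega> - Z t \<omega>"
  obtain I where I: "is_ito_integral M W (\<lambda>s \<omega>. G *v X s \<omega> + h) I"
    "AE \<omega> in M. \<forall>t\<ge>0. X t \<omega> = x + (LBINT s:{0..t}. F *v X s \<omega> + f) + I t \<omega>"
    using assms(1) by (auto simp: solves_sde_def)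
  obtain J where J: "is_ito_integral M W (\<lambda>s \<omega>. G *v Z s \<omega> + h) J"
    "AE \<omega> in M. \<forall>t\<ge>0. Z t \<omega> = z + (LBINT s:{0..t}. F *v Z s \<omega> + f) + J t \<omega>"
    using assms(2) by (auto simp: solves_sde_def)
  have eq: "(\<lambda>s \<omega>. (G *v X s \<omega> + h) - (G *v Z s \<omega> + h)) = (\<lambda>s \<omega>. G *v ?Y s \<omega> + 0)"
    by (simp add: fun_eq_iff matrix_vector_mult_diff_distrib)
  have ito: "is_ito_integral M W (\<lambda>s \<omega>. G *v ?Y s \<omega> + 0) (\<lambda>t \<omega>. I t \<omega> - J t \<omega>)"
    using ito_diff[OF I(1) J(1)] unfolding eq .
  have "AE \<omega> in M. \<forall>t\<ge>0. ?Y t \<omega> = (x - z) + (LBINT s:{0..t}. F *v ?Y s \<omega> + 0) + (I t \<omega> - J t \<omega>)"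
    using I(2) J(2) AE_space
  proof eventually_elim
    case (elim \<omega>)
    have "(LBINT s:{0..t}. F *v ?Y s \<omega> + 0) = (LBINT s:{0..t}. F *v X s \<omega> + f) - (LBINT s:{0..t}. F *v Z s \<omega> + f)" for t
    proof -
      have "(\<lambda>s. F *v ?Y s \<omega> + 0) = (\<lambda>s. (F *v X s \<omega> + f) - (F *v Z s \<omega> + f))"
        by (simp add: fun_eq_iff matrix_vector_mult_diff_distrib)
      then show ?thesis
        using set_integral_diff(2)[OF borel_integrable_atLeastAtMost'[OF X.\<alpha>_continuous[OF elim(3)]]
          borel_integrable_atLeastAtMost'[OF Z.\<alpha>_continuous[OF elim(3)]], of t]
        by (simp add: X.\<alpha>_def Z.\<alpha>_def)
    qed
    then show ?case using elim by simp
  qed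
  moreover have "sq_norm_upto M T ?Y < \<infinity>" if "T \<ge> 0" for T
    using sqint_diff[OF X.X_sqint_MT[OF that] Z.X_sqint_MT[OF that]]
    by (subst sq_norm_upto_eq) (auto simp: sqint_iff_nn_integral split_beta')
  moreover have "adapted M W ?Y" "continuous_paths M ?Y"
    using assms by (auto simp: solves_sde_def intro: adapted_diff continuous_paths_diff)
  ultimately show ?thesis unfolding solves_sde_def using ito by blast
qed

locale stable_solution = sde_solution M W F G 0 0 x Y
  for M :: "'w measure" and W :: "real \<Rightarrow> 'w \<Rightarrow> real" and F G :: "real^'n^'n" and x :: "real^'n"
    and Y :: "real \<Rightarrow> 'w \<Rightarrow> real^'n" +
  assumes stable: "(\<integral>\<^sup>+\<omega>. (\<integral>\<^sup>+t\<in>{0..}. ennreal ((norm (Y t \<omega>))\<^sup>2) \<partial>lborel) \<partial>M) < \<infinity>"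
begin

definition "msq t = expectation (\<lambda>\<omega>. (norm (Y t \<omega>))\<^sup>2)"

lemma msq_nonneg: "0 \<le> msq t"
  by (simp add: msq_def)

lemma msq_integral_bound: "\<exists>K. \<forall>t\<ge>0. (LINT s|time_measure t. msq s) \<le> K"
proof -
  let ?N = "\<integral>\<^sup>+\<omega>. (\<integral>\<^sup>+t\<in>{0..}. ennreal ((norm (Y t \<omega>))\<^sup>2) \<partial>lborel) \<partial>M"
  have "(LINT s|time_measure t. msq s) \<le> enn2real ?N" if t: "t \<ge> 0" for t
  proof -
    have "ennreal (LINT s|time_measure t. msq s) = ennreal (LINT z|MT t. (norm (Y (snd z) (fst z)))\<^sup>2)"
      using mean_square_integrable(2)[OF t] by (simp add: msq_def)
    also have "\<dots> = (\<integral>\<^sup>+z. ennreal ((norm (Y (snd z) (fst z)))\<^sup>2) \<partial>MT t)"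
      using X_sqint_MT[OF t] by (intro nn_integral_eq_integral[symmetric]) (auto simp: sqint_def)
    also have "\<dots> = sq_norm_upto M t Y"
      using X_joint[of t] by (intro sq_norm_upto_eq[symmetric]) (simp add: split_beta')
    also have "\<dots> \<le> ?N"
      unfolding sq_norm_upto_def
      by (intro nn_integral_mono mult_left_mono) (auto simp: indicator_def)
    finally have "ennreal (LINT s|time_measure t. msq s) \<le> ?N" .
    moreover have "?N < top" using stable by simp
    ultimately have "enn2real (ennreal (LINT s|time_measure t. msq s)) \<le> enn2real ?N"
      by (rule enn2real_mono)
    moreover have "0 \<le> (LINT s|time_measure t. msq s)" by (simp add: msq_nonneg)
    ultimately show ?thesis by simp
  qed
  then show ?thesis by blast
qed

text \<open>A function with bounded time integral cannot stay above c forever. This gives smallness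
  at some late times only; \<open>msq_tendsto_0\<close> later propagates it.\<close>

lemma msq_small: assumes "c > 0" "t0 \<ge> 0" shows "\<exists>t\<ge>t0. msq t < c"
proof (rule ccontr)
  assume "\<not> ?thesis"
  then have ge: "c \<le> msq t" if "t \<ge> t0" for t using that by force
  obtain K where K: "\<And>t. t \<ge> 0 \<Longrightarrow> (LINT s|time_measure t. msq s) \<le> K" using msq_integral_bound by blast
  \<comment> \<open>Chosen so that c (t - t0) = |K| + 1, which exceeds the bound K on the
    integral.\<close>
  define t where "t = t0 + (\<bar>K\<bar> + 1) / c"
  have t: "t0 \<le> t" "0 \<le> t" using assms by (auto simp: t_def)
  have "integrable (time_measure t) (\<lambda>s. - msq s)"
    using mean_square_integrable(1)[OF t(2)] by (simp add: msq_def)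
  from time_integral_increment[OF this assms(2) t(1), of "- c"] ge
  have "(LINT s|time_measure t0. msq s) + c * (t - t0) \<le> (LINT s|time_measure t. msq s)" by auto
  moreover have "0 \<le> (LINT s|time_measure t0. msq s)" by (simp add: msq_nonneg)
  moreover have "c * (t - t0) = \<bar>K\<bar> + 1" using assms by (simp add: t_def)
  ultimately show False using K[OF t(2)] by linarith
qed

lemma form_moment:
  assumes "transpose P = P" "t \<ge> 0"
  shows "expectation (\<lambda>\<omega>. form P (Y t \<omega>) (Y t \<omega>)) =
      form P x x + (LINT s|time_measure t. expectation (\<lambda>\<omega>. form (lyapunov F G P) (Y s \<omega>) (Y s \<omega>)))"
    "integrable (time_measure t) (\<lambda>s. expectation (\<lambda>\<omega>. form (lyapunov F G P) (Y s \<omega>) (Y s \<omega>)))"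
  using second_moment[OF assms(2) bounded_bilinear_form form_sym[OF assms(1)]]
  by (simp_all add: form_lyapunov[OF assms(1)])

lemma form_expectation_bound:
  assumes "\<And>u. \<bar>form P u u\<bar> \<le> K * (norm u)\<^sup>2" "t \<ge> 0"
  shows "\<bar>expectation (\<lambda>\<omega>. form P (Y t \<omega>) (Y t \<omega>))\<bar> \<le> K * msq t"
proof -
  have int: "integrable M (\<lambda>\<omega>. form P (Y t \<omega>) (Y t \<omega>))"
    by (rule integrable_bilinear[OF X_sqint[OF assms(2)] X_sqint[OF assms(2)] bounded_bilinear_form])
  have "\<bar>expectation (\<lambda>\<omega>. form P (Y t \<omega>) (Y t \<omega>))\<bar> \<le> expectation (\<lambda>\<omega>. \<bar>form P (Y t \<omega>) (Y t \<omega>)\<bar>)"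
    using integral_abs_bound[of M "\<lambda>\<omega>. form P (Y t \<omega>) (Y t \<omega>)"] .
  also have "\<dots> \<le> expectation (\<lambda>\<omega>. K * (norm (Y t \<omega>))\<^sup>2)"
    using int X_sqint[OF assms(2)] assms(1) by (intro integral_mono) (auto simp: sqint_def)
  finally show ?thesis by (simp add: msq_def)
qed

end

lemma form_bounded: "\<exists>K>0. \<forall>u. \<bar>form P u u\<bar> \<le> K * (norm u)\<^sup>2"
proof -
  obtain K where "K > 0" "\<And>u v. norm (form P u v) \<le> norm u * norm v * K"
    using bounded_bilinear.pos_bounded[OF bounded_bilinear_form] by blast
  then show ?thesis by (intro exI[of _ K]) (auto simp: power2_eq_square mult_ac)
qed

lemma form_mat_1: "form (mat 1) u u = (norm u)\<^sup>2" "form (- mat 1) u u = - (norm u)\<^sup>2"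
proof -
  show "form (mat 1) u u = (norm u)\<^sup>2" by (simp add: form_def power2_norm_eq_inner)
  have "(- mat 1 :: real^'a^'a) *v u = - u"
    using matrix_vector_mult_diff_rdistrib[of 0 "mat 1" u] by simp
  then show "form (- mat 1) u u = - (norm u)\<^sup>2" by (simp add: form_def power2_norm_eq_inner)
qed

context stable_solution begin

lemma msq_integrable: "t \<ge> 0 \<Longrightarrow> integrable (time_measure t) msq"
  using mean_square_integrable(1) by (simp add: msq_def[abs_def])

lemma msq_integral_mono:
  assumes "0 \<le> s" "s \<le> t"
  shows "(LINT r|time_measure s. msq r) \<le> (LINT r|time_measure t. msq r)"
proof -
  have "integrable (time_measure t) (\<lambda>s. - msq s)" using msq_integrable assms by simp
  from time_integral_increment[OF this assms, of 0] show ?thesis by (simp add: msq_nonneg)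
qed

lemma lyapunov_moment:
  assumes "transpose P = P" "lyapunov F G P = - mat 1" "t \<ge> 0"
  shows "expectation (\<lambda>\<omega>. form P (Y t \<omega>) (Y t \<omega>)) = form P x x - (LINT s|time_measure t. msq s)"
  using form_moment(1)[OF assms(1,3)] by (simp add: assms(2) form_mat_1 msq_def)

text \<open>P is not yet known to be positive, so the boundary term of
  \<open>lyapunov_moment\<close> cannot be dropped by sign. It is made negligible at a late T where
  \<open>msq\<close> is small; monotonicity in the upper limit then returns to t.\<close>

lemma msq_integral_le_form:
  assumes P: "transpose P = P" "lyapunov F G P = - mat 1" and t: "t \<ge> 0"
  shows "(LINT s|time_measure t. msq s) \<le> form P x x"
proof (rule field_le_epsilon)
  fix e :: real assume e: "e > 0"
  obtain K where K: "K > 0" "\<And>u. \<bar>form P u u\<bar> \<le> K * (norm u)\<^sup>2" using form_bounded by blast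
  obtain T where T: "T \<ge> t" "msq T < e / K" using msq_small[of "e / K" t] e K t by auto
  have "K * msq T \<le> e" using T K by (simp add: field_simps)
  then have "- e \<le> form P x x - (LINT s|time_measure T. msq s)"
    using form_expectation_bound[OF K(2), of T] lyapunov_moment[OF P, of T] T t by simp
  then show "(LINT s|time_measure t. msq s) \<le> form P x x + e"
    using msq_integral_mono[OF t T(1)] by simp
qed

text \<open>\<open>form_moment\<close> at the identity matrix: the rate of change of the mean square
  is at most c times the mean square.\<close>

lemma msq_growth:
  assumes c: "\<And>u. \<bar>form (lyapunov F G (mat 1)) u u\<bar> \<le> c * (norm u)\<^sup>2" and t: "t \<ge> 0"
  shows "\<bar>msq t - (norm x)\<^sup>2\<bar> \<le> c * (LINT s|time_measure t. msq s)"
proof -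
  have tr: "transpose (mat 1 :: real^'n^'n) = mat 1" by simp
  let ?g = "\<lambda>s. expectation (\<lambda>\<omega>. form (lyapunov F G (mat 1)) (Y s \<omega>) (Y s \<omega>))"
  have "msq t - (norm x)\<^sup>2 = (LINT s|time_measure t. ?g s)"
    using form_moment(1)[OF tr t] by (simp add: form_mat_1 msq_def)
  also have "\<bar>\<dots>\<bar> \<le> (LINT s|time_measure t. \<bar>?g s\<bar>)"
    using integral_abs_bound[of "time_measure t" ?g] .
  also have "\<dots> \<le> (LINT s|time_measure t. c * msq s)"
    using form_moment(2)[OF tr t] msq_integrable[OF t] form_expectation_bound[OF c]
    by (intro integral_mono) (auto simp: space_restrict_space)
  finally show ?thesis by simp
qed

text \<open>If the mean square starts at |x|^2 and is nearly 0 at some late T, the loss is at most c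
  times the integral of \<open>msq\<close>, hence at most c <Px, x>. Positive definiteness of P is
  thus a consequence of stability.\<close>

lemma coercive:
  assumes P: "transpose P = P" "lyapunov F G P = - mat 1"
    and c: "\<And>u. \<bar>form (lyapunov F G (mat 1)) u u\<bar> \<le> c * (norm u)\<^sup>2" "c > 0"
  shows "(norm x)\<^sup>2 \<le> c * form P x x"
proof (rule field_le_epsilon)
  fix e :: real assume e: "e > 0"
  obtain T where T: "T \<ge> 0" "msq T < e" using msq_small[OF e order_refl] by auto
  have "c * (LINT s|time_measure T. msq s) \<le> c * form P x x"
    using msq_integral_le_form[OF P T(1)] c by simp
  then show "(norm x)\<^sup>2 \<le> c * form P x x + e" using msq_growth[OF c(1) T(1)] T by linarith
qed

text \<open>Growth is controlled by the time integral of \<open>msq\<close>, which never exceeds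
  <Px, x> <= K |x|^2; the bound is therefore uniform in t.\<close>

lemma msq_le:
  assumes P: "transpose P = P" "lyapunov F G P = - mat 1"
    and c: "\<And>u. \<bar>form (lyapunov F G (mat 1)) u u\<bar> \<le> c * (norm u)\<^sup>2" "c > 0"
    and K: "\<And>u. \<bar>form P u u\<bar> \<le> K * (norm u)\<^sup>2" and t: "t \<ge> 0"
  shows "msq t \<le> (1 + c * K) * (norm x)\<^sup>2"
proof -
  have "c * (LINT s|time_measure t. msq s) \<le> c * (K * (norm x)\<^sup>2)"
    using msq_integral_le_form[OF P t] K[of x] c by (intro mult_left_mono) auto
  then show ?thesis using msq_growth[OF c(1) t] by (simp add: algebra_simps)
qed

text \<open>By \<open>lyapunov_moment\<close> the expectation of <PY, Y> never increases, and
  coercivity makes it dominate \<open>msq\<close>. Once small at one time, it stays small.\<close>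

lemma msq_tendsto_0:
  assumes P: "transpose P = P" "lyapunov F G P = - mat 1"
    and c: "\<And>u. (norm u)\<^sup>2 \<le> c * form P u u" "c > 0"
  shows "(msq \<longlongrightarrow> 0) at_top"
proof (rule tendstoI)
  fix e :: real assume e: "e > 0"
  obtain K where K: "K > 0" "\<And>u. \<bar>form P u u\<bar> \<le> K * (norm u)\<^sup>2" using form_bounded by blast
  \<comment> \<open>K pays for passing from \<open>msq\<close> to <PY, Y> at time T, and c for
    returning to \<open>msq\<close> at later times.\<close>
  obtain T where T: "T \<ge> 0" "msq T < e / (c * K)" using msq_small[of "e / (c * K)" 0] e K c by auto
  let ?p = "\<lambda>t. expectation (\<lambda>\<omega>. form P (Y t \<omega>) (Y t \<omega>))"
  have "msq t < e" if t: "t \<ge> T" for t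
  proof -
    have t0: "t \<ge> 0" using t T by simp
    have "msq t \<le> expectation (\<lambda>\<omega>. c * form P (Y t \<omega>) (Y t \<omega>))"
      unfolding msq_def using X_sqint[OF t0] integrable_bilinear[OF X_sqint[OF t0] X_sqint[OF t0] bounded_bilinear_form, of P] c
      by (intro integral_mono) (auto simp: sqint_def)
    then have "msq t \<le> c * ?p t" by simp
    also have "\<dots> \<le> c * ?p T"
      using lyapunov_moment[OF P T(1)] lyapunov_moment[OF P t0] msq_integral_mono[OF T(1) t] c by simp
    also have "\<dots> \<le> c * (K * msq T)"
      using form_expectation_bound[OF K(2) T(1)] c by simp
    also have "\<dots> < e" using T K c by (simp add: field_simps)
    finally show ?thesis .
  qed
  then show "\<forall>\<^sub>F t in at_top. dist (msq t) 0 < e"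
    unfolding eventually_at_top_linorder by (intro exI[of _ T]) (auto simp: msq_nonneg)
qed

end

section \<open>Solutions from all starting points\<close>

locale stable_family = brownian M W
  for M :: "'w measure" and W :: "real \<Rightarrow> 'w \<Rightarrow> real" +
  fixes F G :: "real^'n^'n" and f h :: "real^'n" and X :: "real^'n \<Rightarrow> real \<Rightarrow> 'w \<Rightarrow> real^'n"
  assumes solves: "\<And>x. solves_sde M W F f G h x (X x)"
    and stable: "\<And>x Y. solves_sde M W F 0 G 0 x Y \<Longrightarrow>
      (\<integral>\<^sup>+\<omega>. (\<integral>\<^sup>+t\<in>{0..}. ennreal ((norm (Y t \<omega>))\<^sup>2) \<partial>lborel) \<partial>M) < \<infinity>"
begin

lemma sol: "sde_solution M W F G f h x (X x)"
  by unfold_locales (rule solves)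

lemma stable_diff: "stable_solution M W F G (x - z) (\<lambda>t \<omega>. X x t \<omega> - X z t \<omega>)"
proof -
  have "solves_sde M W F 0 G 0 (x - z) (\<lambda>t \<omega>. X x t \<omega> - X z t \<omega>)"
    by (rule solves_sde_diff[OF solves solves])
  then show ?thesis by unfold_locales (assumption, rule stable)
qed

text \<open>The difference of the given solutions from x and from 0 starts at x, so the family
  itself provides a homogeneous solution for every initial value.\<close>

lemma stable_exists: obtains Y where "stable_solution M W F G x Y"
  using stable_diff[of x 0] by auto

text \<open>One c serves twice: it bounds the growth of the mean square and, by
  \<open>coercive\<close>, it is the coercivity constant of P.\<close>

lemma lyapunov_data:
  obtains P c K where "transpose P = P" "lyapunov F G P = - mat 1" "c > 0" "K > 0"
    "\<And>u. \<bar>form (lyapunov F G (mat 1)) u u\<bar> \<le> c * (norm u)\<^sup>2"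
    "\<And>u. \<bar>form P u u\<bar> \<le> K * (norm u)\<^sup>2" "\<And>u. (norm u)\<^sup>2 \<le> c * form P u u"
proof -
  have "P = 0" if P: "transpose P = P" "lyapunov F G P = 0" for P
  proof (rule form_eq_0_imp[OF P(1)], rule ccontr)
    fix u assume nz: "form P u u \<noteq> 0"
    obtain Y where "stable_solution M W F G u Y" by (rule stable_exists)
    then interpret stable_solution M W F G u Y .
    obtain K where K: "K > 0" "\<And>u. \<bar>form P u u\<bar> \<le> K * (norm u)\<^sup>2" using form_bounded by blast
    obtain T where T: "T \<ge> 0" "msq T < \<bar>form P u u\<bar> / K"
      using msq_small[of "\<bar>form P u u\<bar> / K" 0] nz K by auto
    have "expectation (\<lambda>\<omega>. form P (Y T \<omega>) (Y T \<omega>)) = form P u u"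
      using form_moment(1)[OF P(1) T(1)] by (simp add: P(2) form_def)
    then have "\<bar>form P u u\<bar> \<le> K * msq T" using form_expectation_bound[OF K(2) T(1)] by simp
    then show False using T K by (simp add: field_simps)
  qed
  then obtain P where P: "transpose P = P" "lyapunov F G P = - mat 1"
    by (rule lyapunov_solvable)
  obtain c where c: "c > 0" "\<And>u. \<bar>form (lyapunov F G (mat 1)) u u\<bar> \<le> c * (norm u)\<^sup>2"
    using form_bounded by blast
  obtain K where K: "K > 0" "\<And>u. \<bar>form P u u\<bar> \<le> K * (norm u)\<^sup>2" using form_bounded by blast
  have "(norm u)\<^sup>2 \<le> c * form P u u" for u
  proof -
    obtain Y where "stable_solution M W F G u Y" by (rule stable_exists)
    then interpret stable_solution M W F G u Y .
    show ?thesis by (rule coercive[OF P c(2,1)])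
  qed
  with P c K show thesis by (intro that)
qed

text \<open>The difference solves the homogeneous equation, so the constant depends on the Lyapunov
  data alone and may exceed 1. It yields continuity in the starting point and the dominating
  function for averages over \<open>\<pi>\<close>.\<close>

lemma mean_square_contraction:
  obtains C where "C \<ge> 0"
    "\<And>x z t. t \<ge> 0 \<Longrightarrow> expectation (\<lambda>\<omega>. (norm (X x t \<omega> - X z t \<omega>))\<^sup>2) \<le> C * (norm (x - z))\<^sup>2"
proof -
  obtain P c K where d: "transpose P = P" "lyapunov F G P = - mat 1" "c > 0" "K > 0"
    "\<And>u. \<bar>form (lyapunov F G (mat 1)) u u\<bar> \<le> c * (norm u)\<^sup>2"
    "\<And>u. \<bar>form P u u\<bar> \<le> K * (norm u)\<^sup>2" "\<And>u. (norm u)\<^sup>2 \<le> c * form P u u" using lyapunov_data by blast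
  have "expectation (\<lambda>\<omega>. (norm (X x t \<omega> - X z t \<omega>))\<^sup>2) \<le> (1 + c * K) * (norm (x - z))\<^sup>2" if "t \<ge> 0" for x z t
  proof -
    interpret stable_solution M W F G "x - z" "\<lambda>t \<omega>. X x t \<omega> - X z t \<omega>" by (rule stable_diff)
    show ?thesis using msq_le[OF d(1,2,5,3,6) that] by (simp add: msq_def)
  qed
  moreover have "1 + c * K \<ge> 0" using d by (simp add: add_nonneg_nonneg)
  ultimately show thesis by (intro that)
qed

lemma mean_square_attraction:
  "((\<lambda>t. expectation (\<lambda>\<omega>. (norm (X x t \<omega> - X z t \<omega>))\<^sup>2)) \<longlongrightarrow> 0) at_top"
proof -
  obtain P c K where d: "transpose P = P" "lyapunov F G P = - mat 1" "c > 0" "K > 0"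
    "\<And>u. \<bar>form (lyapunov F G (mat 1)) u u\<bar> \<le> c * (norm u)\<^sup>2"
    "\<And>u. \<bar>form P u u\<bar> \<le> K * (norm u)\<^sup>2" "\<And>u. (norm u)\<^sup>2 \<le> c * form P u u" using lyapunov_data by blast
  interpret stable_solution M W F G "x - z" "\<lambda>t \<omega>. X x t \<omega> - X z t \<omega>" by (rule stable_diff)
  show ?thesis using msq_tendsto_0[OF d(1,2,7,3)] by (simp add: msq_def[abs_def])
qed

text \<open>The inhomogeneous terms add at most linear growth to the generator of <Pu, u>, whose
  leading term is - |u|^2. The result is dissipative, and \<open>dissipative_bound\<close> applies
  to the expectation of <PX, X>.\<close>

lemma mean_square_bounded:
  obtains C where "C \<ge> 0" "\<And>t. t \<ge> 0 \<Longrightarrow> expectation (\<lambda>\<omega>. (norm (X z t \<omega>))\<^sup>2) \<le> C"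
proof -
  obtain P c K where d: "transpose P = P" "lyapunov F G P = - mat 1" "c > 0" "K > 0"
    "\<And>u. \<bar>form (lyapunov F G (mat 1)) u u\<bar> \<le> c * (norm u)\<^sup>2"
    "\<And>u. \<bar>form P u u\<bar> \<le> K * (norm u)\<^sup>2" "\<And>u. (norm u)\<^sup>2 \<le> c * form P u u" using lyapunov_data by blast
  interpret X: sde_solution M W F G f h z "X z" by (rule sol)
  interpret B: bounded_bilinear "form P" by (rule bounded_bilinear_form)
  \<comment> \<open>The part of the generator that is linear in the state, produced by f and
    h.\<close>
  define l where "l = (\<lambda>u. 2 * form P u f + 2 * form P (G *v u) h)"
  have "bounded_linear l"
    unfolding l_def
    by (intro bounded_linear_add bounded_linear_const_mult B.bounded_linear_left
      bounded_linear_compose[OF B.bounded_linear_left matrix_vector_mul_bounded_linear])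
  then obtain L where L: "\<And>u. norm (l u) \<le> norm u * L" using bounded_linear.bounded by blast
  define c1 where "c1 = L\<^sup>2 / 2 + \<bar>form P h h\<bar>"
  define \<phi> where "\<phi> = (\<lambda>t. expectation (\<lambda>\<omega>. form P (X z t \<omega>) (X z t \<omega>)))"
  define \<gamma> where "\<gamma> = (\<lambda>s. expectation (\<lambda>\<omega>. 2 * form P (X z s \<omega>) (F *v X z s \<omega> + f) + form P (G *v X z s \<omega> + h) (G *v X z s \<omega> + h)))"
  have pos: "0 \<le> form P u u" for u
    using d(7)[of u] d(3) zero_le_power2[of "norm u"] by (meson order_trans zero_le_mult_iff not_less)
  \<comment> \<open>Half of |u|^2 absorbs \<open>l u\<close> by Young's inequality at the cost L^2 /
    2, the other half dominates <Pu, u> / (2K). With the constant from h this explains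
    \<open>c1\<close> and the rate 1 / (2K).\<close>
  have pw: "2 * form P u (F *v u + f) + form P (G *v u + h) (G *v u + h) \<le> c1 - 1 / (2 * K) * form P u u" for u
  proof -
    have "2 * form P u (F *v u + f) + form P (G *v u + h) (G *v u + h) =
      (2 * form P u (F *v u) + form P (G *v u) (G *v u)) + l u + form P h h"
      using form_sym[OF d(1), of h "G *v u"] by (simp add: B.add_left B.add_right l_def)
    also have "2 * form P u (F *v u) + form P (G *v u) (G *v u) = - (norm u)\<^sup>2"
      by (simp add: form_lyapunov[OF d(1)] d(2) form_mat_1)
    finally have eq: "2 * form P u (F *v u + f) + form P (G *v u + h) (G *v u + h) = - (norm u)\<^sup>2 + l u + form P h h" .
    have "2 * (norm u * L) \<le> (norm u)\<^sup>2 + L\<^sup>2"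
      using zero_le_power2[of "norm u - L"] by (simp add: power2_eq_square algebra_simps)
    then have "l u \<le> (norm u)\<^sup>2 / 2 + L\<^sup>2 / 2" using L[of u] by simp
    moreover have "1 / (2 * K) * form P u u \<le> (norm u)\<^sup>2 / 2"
      using d(6)[of u] d(4) by (simp add: field_simps)
    ultimately show ?thesis unfolding eq c1_def by linarith
  qed
  have bound: "\<phi> t \<le> form P z z + c1 / (1 / (2 * K)) + c1" if t: "t \<ge> 0" for t
  proof (rule dissipative_bound[OF _ _ _ _ _ _ _ t])
    show "integrable (time_measure t) \<gamma>" if "t \<ge> 0" for t
      unfolding \<gamma>_def by (rule X.second_moment(2)[OF that bounded_bilinear_form form_sym[OF d(1)]])
    show "\<phi> t = form P z z + (LINT s|time_measure t. \<gamma> s)" if "t \<ge> 0" for t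
      unfolding \<gamma>_def \<phi>_def by (rule X.second_moment(1)[OF that bounded_bilinear_form form_sym[OF d(1)]])
    show "\<gamma> t \<le> c1 - 1 / (2 * K) * \<phi> t" if "t \<ge> 0" for t
    proof -
      note s = X.X_sqint[OF that]
      have i1: "integrable M (\<lambda>\<omega>. form P (X z t \<omega>) (X z t \<omega>))"
        by (rule integrable_bilinear[OF s s bounded_bilinear_form])
      have i2: "integrable M (\<lambda>\<omega>. 2 * form P (X z t \<omega>) (F *v X z t \<omega> + f) + form P (G *v X z t \<omega> + h) (G *v X z t \<omega> + h))"
        using integrable_bilinear[OF s X.sqint_affine[OF finite_measure_axioms s, of F f] bounded_bilinear_form, of P]
          integrable_bilinear[OF X.sqint_affine[OF finite_measure_axioms s, of G h] X.sqint_affine[OF finite_measure_axioms s, of G h] bounded_bilinear_form, of P]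
        by simp
      have "\<gamma> t \<le> expectation (\<lambda>\<omega>. c1 - 1 / (2 * K) * form P (X z t \<omega>) (X z t \<omega>))"
        unfolding \<gamma>_def using i1 i2 pw by (intro integral_mono) auto
      also have "\<dots> = c1 - 1 / (2 * K) * \<phi> t" using i1 by (simp add: \<phi>_def prob_space)
      finally show ?thesis .
    qed
    show "0 \<le> \<phi> t" for t unfolding \<phi>_def using pos by simp
  qed (use d pos in \<open>auto simp: c1_def\<close>)
  let ?C = "c * (form P z z + c1 / (1 / (2 * K)) + c1)"
  have "expectation (\<lambda>\<omega>. (norm (X z t \<omega>))\<^sup>2) \<le> ?C" if t: "t \<ge> 0" for t
  proof -
    have "expectation (\<lambda>\<omega>. (norm (X z t \<omega>))\<^sup>2) \<le> expectation (\<lambda>\<omega>. c * form P (X z t \<omega>) (X z t \<omega>))"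
      using X.X_sqint[OF t] integrable_bilinear[OF X.X_sqint[OF t] X.X_sqint[OF t] bounded_bilinear_form, of P] d(7)
      by (intro integral_mono) (auto simp: sqint_def)
    also have "\<dots> = c * \<phi> t" by (simp add: \<phi>_def)
    also have "\<dots> \<le> ?C" using bound[OF t] d(3) by simp
    finally show ?thesis .
  qed
  moreover have "0 \<le> ?C" using d pos[of z] by (simp add: c1_def)
  ultimately show thesis by (intro that[of ?C])
qed

end

section \<open>The invariant measure\<close>

text \<open>Inside A the distance to the closed complement is positive, so the truncation at 1 is
  reached eventually. A = \<open>UNIV\<close> is excluded because \<open>infdist\<close> to the
  empty set is 0 by convention.\<close>

lemma open_indicator_limit:
  fixes A :: "'a::metric_space set"
  assumes "open A" "A \<noteq> UNIV"
  shows "(\<lambda>n. min 1 (real n * infdist y (- A))) \<longlonglongrightarrow> indicat_real A y"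
proof (cases "y \<in> A")
  case True
  have pos: "infdist y (- A) > 0"
    using assms True by (intro infdist_pos_not_in_closed) auto
  obtain N where N: "1 / infdist y (- A) < real N" using reals_Archimedean2 by blast
  have "min 1 (real n * infdist y (- A)) = 1" if "n \<ge> N" for n
  proof -
    have "1 / infdist y (- A) \<le> real n" using N that by linarith
    then show ?thesis using pos by (simp add: field_simps)
  qed
  then have "\<forall>\<^sub>F n in sequentially. min 1 (real n * infdist y (- A)) = 1"
    by (auto simp: eventually_sequentially)
  then show ?thesis using True by (simp add: tendsto_eventually)
qed simp

lemma (in prob_space) expectation_norm_le_L2:
  assumes "sqint M f" shows "expectation (\<lambda>x. norm (f x)) \<le> sqrt (expectation (\<lambda>x. (norm (f x))\<^sup>2))"
  using Cauchy_Schwarz_L2[OF sqint_const[of "1::real"] assms]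
  by (simp add: L2norm_def prob_space)

context stable_family begin

lemma X_sq: "t \<ge> 0 \<Longrightarrow> sqint M (X x t)"
  using sde_solution.X_sqint[OF sol] .

lemma X_meas: "t \<ge> 0 \<Longrightarrow> X x t \<in> borel_measurable M"
  using sqint_measurable[OF X_sq] .

text \<open>The mean-square bound on \<open>X x t - X z t\<close> controls the mean distance, so a
  Lipschitz observable has an expectation that is Lipschitz in the starting point.\<close>

lemma expectation_lipschitz_continuous:
  fixes \<psi> :: "real^'n \<Rightarrow> real"
  assumes t: "t \<ge> 0" and lip: "\<And>y z. \<bar>\<psi> y - \<psi> z\<bar> \<le> L * norm (y - z)" "L \<ge> 0"
    and meas: "\<psi> \<in> borel_measurable borel" and bd: "\<And>y. \<bar>\<psi> y\<bar> \<le> K"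
  shows "continuous_on UNIV (\<lambda>x. expectation (\<lambda>\<omega>. \<psi> (X x t \<omega>)))"
proof -
  obtain C where C: "C \<ge> 0"
    "\<And>x z t. t \<ge> 0 \<Longrightarrow> expectation (\<lambda>\<omega>. (norm (X x t \<omega> - X z t \<omega>))\<^sup>2) \<le> C * (norm (x - z))\<^sup>2"
    using mean_square_contraction by blast
  have int: "integrable M (\<lambda>\<omega>. \<psi> (X x t \<omega>))" for x
    using bd measurable_compose[OF X_meas[OF t] meas]
    by (intro integrable_const_bound[of _ K]) auto
  have "\<bar>expectation (\<lambda>\<omega>. \<psi> (X x t \<omega>)) - expectation (\<lambda>\<omega>. \<psi> (X z t \<omega>))\<bar> \<le> L * sqrt C * norm (x - z)" for x z
  proof -
    have sd: "sqint M (\<lambda>\<omega>. X x t \<omega> - X z t \<omega>)" by (intro sqint_diff X_sq t)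
    have "integrable M (\<lambda>\<omega>. norm (X x t \<omega> - X z t \<omega>))"
      using integrable_bilinear[OF sqint_const[of "1::real"] sqint_norm[OF sd] bounded_bilinear_mult] by simp
    then have "(expectation (\<lambda>\<omega>. \<bar>\<psi> (X x t \<omega>) - \<psi> (X z t \<omega>)\<bar>)) \<le> expectation (\<lambda>\<omega>. L * norm (X x t \<omega> - X z t \<omega>))"
      using int lip by (intro integral_mono) auto
    also have "\<dots> \<le> L * sqrt (C * (norm (x - z))\<^sup>2)"
      using order_trans[OF expectation_norm_le_L2[OF sd] real_sqrt_le_mono[OF C(2)[OF t]]] lip(2)
      by (simp add: mult_left_mono)
    also have "\<dots> = L * sqrt C * norm (x - z)" by (simp add: real_sqrt_mult)
    finally have "(expectation (\<lambda>\<omega>. \<bar>\<psi> (X x t \<omega>) - \<psi> (X z t \<omega>)\<bar>)) \<le> L * sqrt C * norm (x - z)" .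
    moreover have "expectation (\<lambda>\<omega>. \<psi> (X x t \<omega>)) - expectation (\<lambda>\<omega>. \<psi> (X z t \<omega>)) =
        expectation (\<lambda>\<omega>. \<psi> (X x t \<omega>) - \<psi> (X z t \<omega>))"
      using int by simp
    ultimately show ?thesis
      using integral_abs_bound[of M "\<lambda>\<omega>. \<psi> (X x t \<omega>) - \<psi> (X z t \<omega>)"] by linarith
  qed
  then have "(L * sqrt C)-lipschitz_on UNIV (\<lambda>x. expectation (\<lambda>\<omega>. \<psi> (X x t \<omega>)))"
    using C lip(2) by (intro lipschitz_onI) (auto simp: dist_norm)
  then show ?thesis by (rule lipschitz_on_continuous_on)
qed

text \<open>The solutions are given for each x separately, so measurability in x has to be proved.
  Open sets generate the Borel sets and are stable under intersection; the indicator of an open set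
  is a limit of bounded Lipschitz functions, whose expectations are continuous in x.\<close>

lemma transition_kernel:
  assumes t: "t \<ge> 0"
  shows "(\<lambda>x. distr M borel (X x t)) \<in> borel \<rightarrow>\<^sub>M subprob_algebra borel"
proof (rule measurable_subprob_algebra_generated[where \<Omega>=UNIV and G="{S. open S}"])
  show "sets borel = sigma_sets UNIV {S::(real^'n) set. open S}" by (simp add: borel_def)
  show "Int_stable {S::(real^'n) set. open S}" by (auto simp: Int_stable_def)
  fix x :: "real^'n"
  show "subprob_space (distr M borel (X x t))"
    by (intro prob_space_imp_subprob_space prob_space_distr X_meas t)
next
  fix A :: "(real^'n) set" assume "A \<in> {S. open S}"
  then have A: "open A" by simp
  have em: "emeasure (distr M borel (X x t)) A = ennreal (expectation (\<lambda>\<omega>. indicat_real A (X x t \<omega>)))" for x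
  proof -
    have "emeasure (distr M borel (X x t)) A = ennreal (prob (X x t -` A \<inter> space M))"
      using A X_meas[OF t] by (subst emeasure_distr) (auto simp: emeasure_eq_measure)
    also have "prob (X x t -` A \<inter> space M) = expectation (indicat_real (X x t -` A \<inter> space M))"
      by simp
    also have "\<dots> = expectation (\<lambda>\<omega>. indicat_real A (X x t \<omega>))"
      by (intro Bochner_Integration.integral_cong) (auto simp: indicator_def)
    finally show ?thesis .
  qed
  show "(\<lambda>x. emeasure (distr M borel (X x t)) A) \<in> borel_measurable borel"
  proof (cases "A = UNIV")
    case True
    then show ?thesis unfolding em by simp
  next
    case False
    let ?\<psi> = "\<lambda>n y. min 1 (real n * infdist y (- A))"
    have lip: "\<bar>?\<psi> n y - ?\<psi> n z\<bar> \<le> real n * norm (y - z)" for n y z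
    proof -
      have "\<bar>?\<psi> n y - ?\<psi> n z\<bar> \<le> \<bar>real n * infdist y (- A) - real n * infdist z (- A)\<bar>" by linarith
      also have "\<dots> = real n * \<bar>infdist y (- A) - infdist z (- A)\<bar>"
        by (simp add: abs_mult right_diff_distrib[symmetric])
      also have "\<dots> \<le> real n * norm (y - z)"
        using infdist_triangle_abs[of y "- A" z] by (simp add: dist_norm mult_left_mono)
      finally show ?thesis .
    qed
    have m: "?\<psi> n \<in> borel_measurable borel" for n
      by (intro borel_measurable_continuous_onI continuous_intros)
    have bd: "\<bar>?\<psi> n y\<bar> \<le> 1" for n y
    proof -
      have "0 \<le> real n * infdist y (- A)" by (simp add: infdist_nonneg)
      then show ?thesis by linarith
    qed
    have mn: "(\<lambda>x. expectation (\<lambda>\<omega>. ?\<psi> n (X x t \<omega>))) \<in> borel_measurable borel" for n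
      by (intro borel_measurable_continuous_onI expectation_lipschitz_continuous[OF t lip _ m bd]) simp
    have "(\<lambda>x. expectation (\<lambda>\<omega>. indicat_real A (X x t \<omega>))) \<in> borel_measurable borel"
    proof (rule borel_measurable_LIMSEQ_metric[OF mn])
      fix x
      show "(\<lambda>n. expectation (\<lambda>\<omega>. ?\<psi> n (X x t \<omega>))) \<longlonglongrightarrow> expectation (\<lambda>\<omega>. indicat_real A (X x t \<omega>))"
      proof (rule integral_dominated_convergence[where w="\<lambda>_. 1"])
        show "AE \<omega> in M. (\<lambda>n. ?\<psi> n (X x t \<omega>)) \<longlonglongrightarrow> indicat_real A (X x t \<omega>)"
          using open_indicator_limit[OF A False] by auto
        show "AE \<omega> in M. norm (?\<psi> n (X x t \<omega>)) \<le> 1" for n using bd by auto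
        show "(\<lambda>\<omega>. ?\<psi> n (X x t \<omega>)) \<in> borel_measurable M" for n
          by (rule measurable_compose[OF X_meas[OF t] m])
        show "(\<lambda>\<omega>. indicat_real A (X x t \<omega>)) \<in> borel_measurable M"
          by (rule measurable_compose[OF X_meas[OF t]]) (use A in simp)
      qed simp
    qed
    then show ?thesis unfolding em by simp
  qed
next
  show "(\<lambda>x. emeasure (distr M borel (X x t)) UNIV) \<in> borel_measurable borel"
    using X_meas[OF t] by (simp add: emeasure_distr emeasure_space_1)
qed auto

end

section \<open>Averages over the invariant measure\<close>

locale stationary_family = stable_family +
  fixes \<pi> :: "(real^'n) measure"
  assumes invariant: "invariant_prob M X \<pi>"
begin

sublocale \<pi>: prob_space \<pi>
  using invariant by (simp add: invariant_prob_def)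

lemma sets_\<pi> [measurable_cong]: "sets \<pi> = sets borel"
  using invariant by (simp add: invariant_prob_def)

text \<open>With the kernel measurable, invariance says that \<open>\<pi>\<close> is a fixed point
  of the monadic bind, which extends the identity from sets to nonnegative functions.\<close>

lemma nn_integral_stationary:
  assumes t: "t \<ge> 0" and \<phi>: "\<phi> \<in> borel_measurable borel"
  shows "(\<integral>\<^sup>+x. (\<integral>\<^sup>+\<omega>. \<phi> (X x t \<omega>) \<partial>M) \<partial>\<pi>) = (\<integral>\<^sup>+y. \<phi> y \<partial>\<pi>)"
    and "(\<lambda>x. \<integral>\<^sup>+\<omega>. \<phi> (X x t \<omega>) \<partial>M) \<in> borel_measurable borel"
proof -
  let ?k = "\<lambda>x. distr M borel (X x t)"
  have k: "?k \<in> \<pi> \<rightarrow>\<^sub>M subprob_algebra borel"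
    using transition_kernel[OF t] measurable_cong_sets[OF sets_\<pi> refl] by blast
  have "\<pi> \<bind> ?k = \<pi>"
  proof (rule measure_eqI)
    show "sets (\<pi> \<bind> ?k) = sets \<pi>"
      using sets_bind[OF _ \<pi>.not_empty, of ?k borel] sets_\<pi> by simp
    fix E assume "E \<in> sets (\<pi> \<bind> ?k)"
    then have E: "E \<in> sets borel" using sets_bind[OF _ \<pi>.not_empty, of ?k borel] by simp
    show "emeasure (\<pi> \<bind> ?k) E = emeasure \<pi> E"
      using emeasure_bind[OF \<pi>.not_empty k E] invariant t E by (simp add: invariant_prob_def)
  qed
  then have "(\<integral>\<^sup>+y. \<phi> y \<partial>\<pi>) = (\<integral>\<^sup>+x. \<integral>\<^sup>+y. \<phi> y \<partial>?k x \<partial>\<pi>)"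
    using nn_integral_bind[OF \<phi> k] by simp
  also have "\<dots> = (\<integral>\<^sup>+x. (\<integral>\<^sup>+\<omega>. \<phi> (X x t \<omega>) \<partial>M) \<partial>\<pi>)"
    using nn_integral_distr[OF X_meas[OF t]] \<phi> by simp
  finally show "(\<integral>\<^sup>+x. (\<integral>\<^sup>+\<omega>. \<phi> (X x t \<omega>) \<partial>M) \<partial>\<pi>) = (\<integral>\<^sup>+y. \<phi> y \<partial>\<pi>)" by simp
  have "(\<lambda>x. \<integral>\<^sup>+y. \<phi> y \<partial>?k x) \<in> borel_measurable borel"
    by (rule measurable_compose[OF transition_kernel[OF t] nn_integral_measurable_subprob_algebra[OF \<phi>]])
  then show "(\<lambda>x. \<integral>\<^sup>+\<omega>. \<phi> (X x t \<omega>) \<partial>M) \<in> borel_measurable borel"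
    using nn_integral_distr[OF X_meas[OF t]] \<phi> by simp
qed

lemma integral_stationary_nonneg:
  fixes \<phi> :: "real^'n \<Rightarrow> real"
  assumes t: "t \<ge> 0" and \<phi>: "\<phi> \<in> borel_measurable borel" "\<And>y. 0 \<le> \<phi> y"
    and int: "integrable \<pi> \<phi>" "\<And>x. integrable M (\<lambda>\<omega>. \<phi> (X x t \<omega>))"
  shows "integrable \<pi> (\<lambda>x. expectation (\<lambda>\<omega>. \<phi> (X x t \<omega>)))"
    and "(LINT x|\<pi>. expectation (\<lambda>\<omega>. \<phi> (X x t \<omega>))) = (LINT y|\<pi>. \<phi> y)"
proof -
  have \<phi>': "(\<lambda>y. ennreal (\<phi> y)) \<in> borel_measurable borel" using \<phi> by simp
  have eq: "(\<integral>\<^sup>+\<omega>. ennreal (\<phi> (X x t \<omega>)) \<partial>M) = ennreal (expectation (\<lambda>\<omega>. \<phi> (X x t \<omega>)))" for x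
    using int(2) \<phi>(2) by (intro nn_integral_eq_integral) auto
  note s = nn_integral_stationary[OF t \<phi>', unfolded eq]
  have nn: "0 \<le> expectation (\<lambda>\<omega>. \<phi> (X x t \<omega>))" for x using \<phi>(2) by simp
  have "(\<lambda>x. enn2real (ennreal (expectation (\<lambda>\<omega>. \<phi> (X x t \<omega>))))) \<in> borel_measurable borel"
    using s(2) by (rule measurable_compose) simp
  then have m: "(\<lambda>x. expectation (\<lambda>\<omega>. \<phi> (X x t \<omega>))) \<in> borel_measurable \<pi>"
    using nn measurable_cong_sets[OF sets_\<pi> refl] by simp
  have "(\<integral>\<^sup>+x. ennreal (expectation (\<lambda>\<omega>. \<phi> (X x t \<omega>))) \<partial>\<pi>) = ennreal (LINT y|\<pi>. \<phi> y)"
    unfolding s(1) using int(1) \<phi>(2) by (intro nn_integral_eq_integral) auto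
  then have "has_bochner_integral \<pi> (\<lambda>x. expectation (\<lambda>\<omega>. \<phi> (X x t \<omega>))) (LINT y|\<pi>. \<phi> y)"
    using nn \<phi>(2) by (intro has_bochner_integral_nn_integral m) auto
  then show "integrable \<pi> (\<lambda>x. expectation (\<lambda>\<omega>. \<phi> (X x t \<omega>)))"
    "(LINT x|\<pi>. expectation (\<lambda>\<omega>. \<phi> (X x t \<omega>))) = (LINT y|\<pi>. \<phi> y)"
    by (auto simp: has_bochner_integral_iff)
qed

text \<open>
  The truncation at \<open>K\<close> makes dominated convergence in \<open>x\<close> available before any moment of \<open>\<pi>\<close> is
  known to be finite.
\<close>

lemma truncated_moment_le:
  assumes C: "\<And>t. t \<ge> 0 \<Longrightarrow> expectation (\<lambda>\<omega>. (norm (X 0 t \<omega>))\<^sup>2) \<le> C" and C0: "C \<ge> 0"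
  shows "(LINT y|\<pi>. (min (norm y) (real K))\<^sup>2) \<le> 2 * C"
proof -
  let ?\<phi> = "\<lambda>y::real^'n. (min (norm y) (real K))\<^sup>2"
  let ?e = "\<lambda>n x. expectation (\<lambda>\<omega>. ?\<phi> (X x (real n) \<omega>))"
  let ?m = "\<lambda>n x. expectation (\<lambda>\<omega>. (norm (X x (real n) \<omega> - X 0 (real n) \<omega>))\<^sup>2)"
  have \<phi>: "?\<phi> \<in> borel_measurable borel" by measurable
  have bd: "?\<phi> y \<le> (real K)\<^sup>2" for y by (intro power_mono) auto
  have int\<pi>: "integrable \<pi> ?\<phi>"
    using bd measurable_cong_sets[OF sets_\<pi> refl] \<phi> by (intro \<pi>.integrable_const_bound[of _ "(real K)\<^sup>2"]) auto
  have intM: "integrable M (\<lambda>\<omega>. ?\<phi> (X x (real n) \<omega>))" for x n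
    using bd measurable_compose[OF X_meas \<phi>, of "real n" x] by (intro integrable_const_bound[of _ "(real K)\<^sup>2"]) auto
  have st: "integrable \<pi> (?e n)" "(LINT x|\<pi>. ?e n x) = (LINT y|\<pi>. ?\<phi> y)" for n
    by (rule integral_stationary_nonneg[OF _ \<phi> _ int\<pi> intM]; simp)+
  have e1: "?e n x \<le> 2 * C + 2 * ?m n x" for n x
  proof -
    have sd: "sqint M (\<lambda>\<omega>. X x (real n) \<omega> - X 0 (real n) \<omega>)" by (intro sqint_diff X_sq) auto
    have "?e n x \<le> expectation (\<lambda>\<omega>. 2 * (norm (X 0 (real n) \<omega>))\<^sup>2 + 2 * (norm (X x (real n) \<omega> - X 0 (real n) \<omega>))\<^sup>2)"
    proof (rule integral_mono[OF intM])
      show "integrable M (\<lambda>\<omega>. 2 * (norm (X 0 (real n) \<omega>))\<^sup>2 + 2 * (norm (X x (real n) \<omega> - X 0 (real n) \<omega>))\<^sup>2)"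
        using sd X_sq[of "real n" 0] by (auto simp: sqint_def)
      fix \<omega>
      have "?\<phi> (X x (real n) \<omega>) \<le> (norm (X x (real n) \<omega>))\<^sup>2" by (intro power_mono) auto
      also have "\<dots> \<le> 2 * (norm (X 0 (real n) \<omega>))\<^sup>2 + 2 * (norm (X x (real n) \<omega> - X 0 (real n) \<omega>))\<^sup>2"
        using power2_norm_add_le[of "X 0 (real n) \<omega>" "X x (real n) \<omega> - X 0 (real n) \<omega>"] by simp
      finally show "?\<phi> (X x (real n) \<omega>) \<le> 2 * (norm (X 0 (real n) \<omega>))\<^sup>2 + 2 * (norm (X x (real n) \<omega> - X 0 (real n) \<omega>))\<^sup>2" .
    qed
    also have "\<dots> = 2 * expectation (\<lambda>\<omega>. (norm (X 0 (real n) \<omega>))\<^sup>2) + 2 * ?m n x"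
      using sd X_sq[of "real n" 0] by (simp add: sqint_def)
    finally show ?thesis using C[of "real n"] by simp
  qed
  have e2: "0 \<le> ?e n x" "?e n x \<le> (real K)\<^sup>2" for n x
  proof -
    show "0 \<le> ?e n x" by simp
    have "?e n x \<le> expectation (\<lambda>_. (real K)\<^sup>2)"
      by (intro integral_mono intM integrable_const bd)
    then show "?e n x \<le> (real K)\<^sup>2" by (simp add: prob_space)
  qed
  \<comment> \<open>Only an upper bound on \<open>?e n x\<close> is at hand, namely 2 C plus a null
    sequence. Taking the maximum with 2 C produces a genuinely convergent sequence whose integral
    still dominates the stationary one.\<close>
  have "(\<lambda>n. LINT x|\<pi>. max (?e n x) (2 * C)) \<longlonglongrightarrow> (LINT x|\<pi>. 2 * C)"
  proof (rule integral_dominated_convergence[where w="\<lambda>_. (real K)\<^sup>2 + 2 * C"])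
    show "(\<lambda>x. max (?e n x) (2 * C)) \<in> borel_measurable \<pi>" for n using st(1) by auto
    have "(\<lambda>n. max (?e n x) (2 * C)) \<longlonglongrightarrow> 2 * C" for x
    proof (rule tendsto_sandwich[where f="\<lambda>_. 2 * C" and h="\<lambda>n. 2 * C + 2 * ?m n x"])
      have "(\<lambda>n. ?m n x) \<longlonglongrightarrow> 0"
        by (rule filterlim_compose[OF mean_square_attraction filterlim_real_sequentially])
      then have "(\<lambda>n. 2 * C + 2 * ?m n x) \<longlonglongrightarrow> 2 * C + 2 * 0" by (intro tendsto_intros)
      then show "(\<lambda>n. 2 * C + 2 * ?m n x) \<longlonglongrightarrow> 2 * C" by simp
      show "\<forall>\<^sub>F n in sequentially. max (?e n x) (2 * C) \<le> 2 * C + 2 * ?m n x"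
        using e1 by (auto intro!: always_eventually)
      show "(\<lambda>n. 2 * C) \<longlonglongrightarrow> 2 * C" by simp
    qed auto
    then show "AE x in \<pi>. (\<lambda>n. max (?e n x) (2 * C)) \<longlonglongrightarrow> 2 * C" by simp
    have "norm (max (?e n x) (2 * C)) \<le> (real K)\<^sup>2 + 2 * C" for n x
      using e2[of x n] C0 by (simp add: max_def)
    then show "AE x in \<pi>. norm (max (?e n x) (2 * C)) \<le> (real K)\<^sup>2 + 2 * C" for n by simp
  qed auto
  then have "(\<lambda>n. LINT x|\<pi>. max (?e n x) (2 * C)) \<longlonglongrightarrow> 2 * C" by (simp add: \<pi>.prob_space)
  moreover have "(LINT y|\<pi>. ?\<phi> y) \<le> (LINT x|\<pi>. max (?e n x) (2 * C))" for n
    unfolding st(2)[of n, symmetric] using st(1)[of n] by (intro integral_mono) auto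
  ultimately show ?thesis by (intro LIMSEQ_le_const) auto
qed

text \<open>The bound on the truncated moments does not depend on K, so monotone convergence removes
  the truncation.\<close>

lemma stationary_second_moment: "integrable \<pi> (\<lambda>y. (norm y)\<^sup>2)"
proof -
  obtain C where C: "C \<ge> 0" "\<And>t. t \<ge> 0 \<Longrightarrow> expectation (\<lambda>\<omega>. (norm (X 0 t \<omega>))\<^sup>2) \<le> C"
    using mean_square_bounded by blast
  let ?\<phi> = "\<lambda>K y::real^'n. (min (norm y) (real K))\<^sup>2"
  have m: "?\<phi> K \<in> borel_measurable \<pi>" for K by measurable
  have "ennreal (?\<phi> K y) \<le> ennreal (?\<phi> K' y)" if "K \<le> K'" for K K' y
    using that by (intro ennreal_leI power_mono) auto
  then have "incseq (\<lambda>K y. ennreal (?\<phi> K y))" by (auto simp: incseq_def le_fun_def)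
  moreover have "(\<lambda>K. ennreal (?\<phi> K y)) \<longlonglongrightarrow> ennreal ((norm y)\<^sup>2)" for y
  proof -
    obtain N where "norm y < real N" using reals_Archimedean2 by blast
    then have "?\<phi> K y = (norm y)\<^sup>2" if "K \<ge> N" for K using that by (simp add: min_def)
    then have "\<forall>\<^sub>F K in sequentially. ennreal (?\<phi> K y) = ennreal ((norm y)\<^sup>2)"
      by (auto simp: eventually_sequentially intro!: exI[of _ N])
    then show ?thesis by (rule tendsto_eventually)
  qed
  ultimately have lim: "(\<lambda>K. \<integral>\<^sup>+y. ennreal (?\<phi> K y) \<partial>\<pi>) \<longlonglongrightarrow> (\<integral>\<^sup>+y. ennreal ((norm y)\<^sup>2) \<partial>\<pi>)"
    using m by (intro nn_integral_LIMSEQ) auto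
  have "(\<integral>\<^sup>+y. ennreal (?\<phi> K y) \<partial>\<pi>) \<le> ennreal (2 * C)" for K
  proof -
    have bd: "?\<phi> K y \<le> (real K)\<^sup>2" for y by (intro power_mono) auto
    have "integrable \<pi> (?\<phi> K)"
      using bd m by (intro \<pi>.integrable_const_bound[of _ "(real K)\<^sup>2"]) auto
    then have "(\<integral>\<^sup>+y. ennreal (?\<phi> K y) \<partial>\<pi>) = ennreal (LINT y|\<pi>. ?\<phi> K y)"
      by (intro nn_integral_eq_integral) auto
    also have "\<dots> \<le> ennreal (2 * C)"
      by (intro ennreal_leI truncated_moment_le C)
    finally show ?thesis .
  qed
  then have "(\<integral>\<^sup>+y. ennreal ((norm y)\<^sup>2) \<partial>\<pi>) \<le> ennreal (2 * C)"
    by (intro LIMSEQ_le_const2[OF lim]) auto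
  also have "\<dots> < \<infinity>" by simp
  finally show ?thesis by (intro integrableI_bounded) auto
qed

end

section \<open>Abelian limits of the discounted cost\<close>

lemma exponential_density_1: "integrable lborel (exponential_density 1)" "(LINT s|lborel. exponential_density 1 s) = 1"
proof -
  interpret prob_space "density lborel (exponential_density 1)"
    by (rule prob_space_exponential_density) simp
  have "(\<integral>\<^sup>+s. ennreal (exponential_density 1 s) \<partial>lborel) = 1"
    using emeasure_space_1 by (simp add: emeasure_density)
  then have "has_bochner_integral lborel (exponential_density 1) 1"
    by (intro has_bochner_integral_nn_integral) (auto simp: exponential_density_nonneg)
  then show "integrable lborel (exponential_density 1)" "(LINT s|lborel. exponential_density 1 s) = 1"
    by (auto simp: has_bochner_integral_iff)
qed

text \<open>Substituting t = u s with u = 1 / r turns the discounted average into an expectation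
  under one fixed exponential law, with u only in the argument of \<open>\<Gamma>\<close>.\<close>

lemma exponential_rescale:
  fixes \<Gamma> :: "real \<Rightarrow> real"
  assumes u: "u > 0"
  shows "inverse u * (LBINT t:{0..}. exp (- inverse u * t) * \<Gamma> t) = (LBINT s. exponential_density 1 s * \<Gamma> (u * s))"
proof -
  have "(LBINT t:{0..}. exp (- inverse u * t) * \<Gamma> t) =
      \<bar>u\<bar> *\<^sub>R (LBINT s. indicat_real {0..} (0 + u * s) *\<^sub>R (exp (- inverse u * (0 + u * s)) * \<Gamma> (0 + u * s)))"
    unfolding set_lebesgue_integral_def using u by (intro lborel_integral_real_affine) simp
  also have "(\<lambda>s. indicat_real {0..} (0 + u * s) *\<^sub>R (exp (- inverse u * (0 + u * s)) * \<Gamma> (0 + u * s))) =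
      (\<lambda>s. exponential_density 1 s * \<Gamma> (u * s))"
    using u by (auto simp: exponential_density_def indicator_def zero_le_mult_iff fun_eq_iff field_simps)
  finally show ?thesis using u by simp
qed

lemma exponential_integrable:
  fixes r :: real
  assumes r: "r > 0" shows "set_integrable lborel {0..} (\<lambda>t. exp (- r * t))"
proof -
  have "integrable lborel (\<lambda>t::real. exponential_density 1 (0 + r * t))"
    using exponential_density_1(1) r by (intro lborel_integrable_real_affine) auto
  moreover have "(\<lambda>t::real. exponential_density 1 (0 + r * t)) = (\<lambda>t. indicat_real {0..} t *\<^sub>R exp (- r * t))"
    using r by (auto simp: exponential_density_def indicator_def zero_le_mult_iff fun_eq_iff mult_less_0_iff)
  ultimately show ?thesis by (simp add: set_integrable_def)
qed

text \<open>After rescaling, r tending to 0 means u tending to infinity, and dominated convergence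
  under the exponential law applies because \<open>\<Gamma>\<close> is bounded on the
  half-line.\<close>

lemma abelian_limit:
  fixes \<Gamma> :: "real \<Rightarrow> real"
  assumes meas: "(\<lambda>t. indicat_real {0..} t * \<Gamma> t) \<in> borel_measurable borel" and bd: "\<And>t. t \<ge> 0 \<Longrightarrow> \<bar>\<Gamma> t\<bar> \<le> C"
    and lim: "(\<Gamma> \<longlongrightarrow> l) at_top"
  shows "((\<lambda>r. r * (LBINT t:{0..}. exp (- r * t) * \<Gamma> t)) \<longlongrightarrow> l) (at_right 0)"
  unfolding filterlim_at_right_to_top
proof -
  let ?I = "\<lambda>u s. exponential_density 1 s * \<Gamma> (u * s)"
  \<comment> \<open>Dominated convergence asks for measurability at every u; \<open>max 1 u\<close>
    keeps the factor positive and equals u eventually.\<close>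
  have lims: "((\<lambda>u. LBINT s. ?I (max 1 u) s) \<longlongrightarrow> (LBINT s. exponential_density 1 s * l)) at_top"
  proof (rule integral_dominated_convergence_at_top[where w="\<lambda>s. exponential_density 1 s * C"])
    show "?I (max 1 u) \<in> borel_measurable lborel" for u
    proof -
      have u: "max 1 u > 0" by simp
      have X: "(\<lambda>s. indicat_real {0..} (max 1 u * s) * \<Gamma> (max 1 u * s)) \<in> borel_measurable borel"
        by (rule measurable_compose[OF _ meas]) simp
      have "(\<lambda>s. exponential_density 1 s * (indicat_real {0..} (max 1 u * s) * \<Gamma> (max 1 u * s))) \<in> borel_measurable borel"
        by (intro borel_measurable_times[OF _ X]) simp
      moreover have "(\<lambda>s. exponential_density 1 s * (indicat_real {0..} (max 1 u * s) * \<Gamma> (max 1 u * s))) = ?I (max 1 u)"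
        using u by (auto simp: exponential_density_def indicator_def zero_le_mult_iff fun_eq_iff)
      ultimately show ?thesis by simp
    qed
    \<comment> \<open>At s = 0 the argument u s does not grow, so this null set is removed; for s <
      0 the density vanishes.\<close>
    show "AE s in lborel. ((\<lambda>u. ?I (max 1 u) s) \<longlongrightarrow> exponential_density 1 s * l) at_top"
      using AE_lborel_singleton[of 0]
    proof eventually_elim
      case (elim s)
      show ?case
      proof (cases "s > 0")
        case True
        have "filterlim (\<lambda>u. s * u) at_top at_top"
          using True by (simp add: filterlim_tendsto_pos_mult_at_top[OF tendsto_const _ filterlim_ident])
        then have "((\<lambda>u. \<Gamma> (s * u)) \<longlongrightarrow> l) at_top" by (rule filterlim_compose[OF lim])
        then have "((\<lambda>u. exponential_density 1 s * \<Gamma> (s * u)) \<longlongrightarrow> exponential_density 1 s * l) at_top"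
          by (intro tendsto_intros)
        moreover have "\<forall>\<^sub>F u in at_top. exponential_density 1 s * \<Gamma> (s * u) = ?I (max 1 u) s"
          using eventually_ge_at_top[of 1] by eventually_elim (simp add: max_def mult.commute)
        ultimately show ?thesis by (rule Lim_transform_eventually)
      next
        case False
        then have "s < 0" using elim by simp
        then show ?thesis by (simp add: exponential_density_def)
      qed
    qed
    show "\<forall>\<^sub>F u in at_top. AE s in lborel. norm (?I (max 1 u) s) \<le> exponential_density 1 s * C"
    proof (intro always_eventually allI AE_I2)
      fix u s :: real
      show "norm (?I (max 1 u) s) \<le> exponential_density 1 s * C"
      proof (cases "s < 0")
        case False
        then have "\<bar>\<Gamma> (max 1 u * s)\<bar> \<le> C" by (intro bd) simp
        then show ?thesis by (simp add: abs_mult exponential_density_nonneg mult_left_mono)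
      qed (simp add: exponential_density_def)
    qed
    show "integrable lborel (\<lambda>s. exponential_density 1 s * C)" using exponential_density_1(1) by simp
  qed auto
  have "((\<lambda>u. LBINT s. ?I (max 1 u) s) \<longlongrightarrow> l) at_top"
    using lims exponential_density_1 by simp
  moreover have "\<forall>\<^sub>F u in at_top. (LBINT s. ?I (max 1 u) s) = inverse u * (LBINT t:{0..}. exp (- inverse u * t) * \<Gamma> t)"
    using eventually_ge_at_top[of 1]
  proof eventually_elim
    case (elim u)
    then show ?case using exponential_rescale[of u \<Gamma>] by (simp add: max_def)
  qed
  ultimately show "((\<lambda>u. inverse u * (LBINT t:{0..}. exp (- inverse u * t) * \<Gamma> t)) \<longlongrightarrow> l) at_top"
    by (rule Lim_transform_eventually)
qed

text \<open>The weight 1 + |y| + |z| is what a quadratic function admits. Cauchy-Schwarz pairs the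
  distance, small in mean square, with the weight, bounded in mean square.\<close>

locale local_lipschitz_cost =
  fixes g :: "real^'n \<Rightarrow> real" and L :: real
  assumes g_lip: "\<And>y z. \<bar>g y - g z\<bar> \<le> L * (norm (y - z) * (1 + norm y + norm z))"
    and L_nonneg: "L \<ge> 0" and g_meas: "g \<in> borel_measurable borel"
begin

text \<open>The factor 2 comes from |y| (1 + |y|) <= 2 (1 + |y|^2).\<close>

definition "growth = \<bar>g 0\<bar> + 2 * L"

lemma growth_nonneg: "growth \<ge> 0"
  using L_nonneg by (simp add: growth_def)

lemma g_growth: "\<bar>g y\<bar> \<le> growth * (1 + (norm y)\<^sup>2)"
proof -
  have "norm y * (1 + norm y) \<le> 2 * (1 + (norm y)\<^sup>2)"
  proof -
    have "2 * norm y \<le> 1 + norm y * norm y"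
      using zero_le_power2[of "norm y - 1"] by (simp add: power2_eq_square algebra_simps)
    moreover have "0 \<le> norm y * norm y" by simp
    ultimately show ?thesis unfolding power2_eq_square distrib_left by linarith
  qed
  then have "L * (norm y * (1 + norm y)) \<le> L * (2 * (1 + (norm y)\<^sup>2))"
    using L_nonneg by (rule mult_left_mono)
  moreover have "\<bar>g 0\<bar> \<le> \<bar>g 0\<bar> * (1 + (norm y)\<^sup>2)"
    by (simp add: algebra_simps)
  moreover have "\<bar>g y\<bar> \<le> \<bar>g 0\<bar> + L * (norm y * (1 + norm y))" using g_lip[of y 0] by simp
  moreover have "growth * (1 + (norm y)\<^sup>2) = \<bar>g 0\<bar> * (1 + (norm y)\<^sup>2) + L * (2 * (1 + (norm y)\<^sup>2))"
    by (simp add: growth_def algebra_simps)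
  ultimately show ?thesis by linarith
qed

lemma g_integrable:
  assumes "finite_measure N" "sqint N Y" shows "integrable N (\<lambda>z. g (Y z))"
proof (rule Bochner_Integration.integrable_bound)
  interpret finite_measure N by fact
  show "integrable N (\<lambda>z. growth * (1 + (norm (Y z))\<^sup>2))" using assms(2) by (simp add: sqint_def)
  show "(\<lambda>z. g (Y z)) \<in> borel_measurable N" by (rule measurable_compose[OF sqint_measurable[OF assms(2)] g_meas])
  show "AE z in N. norm (g (Y z)) \<le> norm (growth * (1 + (norm (Y z))\<^sup>2))"
    using order_trans[OF g_growth abs_ge_self] by simp
qed

end

locale ergodic_cost = stationary_family M W F G f h X \<pi> + local_lipschitz_cost g L
  for M :: "'w measure" and W :: "real \<Rightarrow> 'w \<Rightarrow> real" and F G :: "real^'n^'n" and f h :: "real^'n"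
    and X :: "real^'n \<Rightarrow> real \<Rightarrow> 'w \<Rightarrow> real^'n" and \<pi> :: "(real^'n) measure" and g :: "real^'n \<Rightarrow> real" and L :: real
begin

abbreviation "mean_cost z t \<equiv> expectation (\<lambda>\<omega>. g (X z t \<omega>))"

lemma g_X_integrable: "t \<ge> 0 \<Longrightarrow> integrable M (\<lambda>\<omega>. g (X z t \<omega>))"
  by (rule g_integrable[OF finite_measure_axioms X_sq])

lemma sqint_\<pi>: "sqint \<pi> (\<lambda>y. y)"
  using stationary_second_moment measurable_cong_sets[OF sets_\<pi> refl] by (auto simp: sqint_def)

lemma g_\<pi>_integrable: "integrable \<pi> g"
  by (rule g_integrable[OF \<pi>.finite_measure_axioms sqint_\<pi>])

text \<open>Stationarity is available for nonnegative functions, and g may change sign. The majorant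
  \<open>?b\<close> is added to make it nonnegative, and its own stationary identity is subtracted
  afterwards.\<close>

lemma stationary_mean_cost:
  assumes t: "t \<ge> 0"
  shows "integrable \<pi> (\<lambda>x. mean_cost x t)" "(LINT x|\<pi>. mean_cost x t) = (LINT y|\<pi>. g y)"
proof -
  let ?b = "\<lambda>y::real^'n. growth * (1 + (norm y)\<^sup>2)"
  have b: "?b \<in> borel_measurable borel" "\<And>y. 0 \<le> ?b y" "integrable \<pi> ?b" "\<And>x. integrable M (\<lambda>\<omega>. ?b (X x t \<omega>))"
    using growth_nonneg stationary_second_moment X_sq[OF t] by (auto simp: sqint_def)
  have gb: "0 \<le> g y + ?b y" for y using g_growth[of y] by linarith
  have gb': "(\<lambda>y. g y + ?b y) \<in> borel_measurable borel" using g_meas b(1) by simp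
  note s1 = integral_stationary_nonneg[OF t b]
  have i: "integrable M (\<lambda>\<omega>. g (X x t \<omega>) + ?b (X x t \<omega>))" for x using g_X_integrable[OF t] b(4) by simp
  note s2 = integral_stationary_nonneg[OF t gb' gb Bochner_Integration.integrable_add[OF g_\<pi>_integrable b(3)] i]
  have eq: "mean_cost x t = expectation (\<lambda>\<omega>. g (X x t \<omega>) + ?b (X x t \<omega>)) - expectation (\<lambda>\<omega>. ?b (X x t \<omega>))" for x
    using g_X_integrable[OF t] b(4)[of x] by (subst Bochner_Integration.integral_add) auto
  show "integrable \<pi> (\<lambda>x. mean_cost x t)"
    unfolding eq by (intro Bochner_Integration.integrable_diff s1 s2)
  show "(LINT x|\<pi>. mean_cost x t) = (LINT y|\<pi>. g y)"
    unfolding eq Bochner_Integration.integral_diff[OF s2(1) s1(1)] s1(2) s2(2)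
    by (subst Bochner_Integration.integral_add[OF g_\<pi>_integrable b(3)]) simp
qed

text \<open>Cauchy-Schwarz splits the weighted Lipschitz bound into the square root of m and that of
  the mean squared weight. The latter is estimated by (1 + a + b)^2 <= 3 (1 + a^2 + b^2) and |X x|^2
  <= 2 |X z|^2 + 2 |X x - X z|^2.\<close>

lemma mean_cost_difference:
  fixes x z :: "real^'n"
  assumes t: "t \<ge> 0"
    and C0: "expectation (\<lambda>\<omega>. (norm (X z t \<omega>))\<^sup>2) \<le> C0"
  defines "m \<equiv> expectation (\<lambda>\<omega>. (norm (X x t \<omega> - X z t \<omega>))\<^sup>2)"
  shows "\<bar>mean_cost x t - mean_cost z t\<bar> \<le> L * sqrt (m * (3 * (1 + 3 * C0 + 2 * m)))"
proof -
  let ?d = "\<lambda>\<omega>. X x t \<omega> - X z t \<omega>" and ?w = "\<lambda>\<omega>. 1 + norm (X x t \<omega>) + norm (X z t \<omega>)"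
  have sd: "sqint M ?d" by (intro sqint_diff X_sq t)
  have sw: "sqint M ?w" by (intro sqint_add sqint_norm X_sq t sqint_const)
  have int: "integrable M (\<lambda>\<omega>. norm (?d \<omega>) * norm (?w \<omega>))"
    by (rule integrable_bilinear[OF sqint_norm[OF sd] sqint_norm[OF sw] bounded_bilinear_mult])
  have w2: "expectation (\<lambda>\<omega>. (norm (?w \<omega>))\<^sup>2) \<le> 3 * (1 + 3 * C0 + 2 * m)"
  proof -
    have sq: "integrable M (\<lambda>\<omega>. (norm (?d \<omega>))\<^sup>2)" "integrable M (\<lambda>\<omega>. (norm (X z t \<omega>))\<^sup>2)" 
      using sd X_sq[OF t] by (auto simp: sqint_def)
    have "expectation (\<lambda>\<omega>. (norm (?w \<omega>))\<^sup>2) \<le> expectation (\<lambda>\<omega>. 3 * (1 + 3 * (norm (X z t \<omega>))\<^sup>2 + 2 * (norm (?d \<omega>))\<^sup>2))"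
    proof (rule integral_mono)
      fix \<omega>
      have a: "(norm (X x t \<omega>))\<^sup>2 \<le> 2 * (norm (X z t \<omega>))\<^sup>2 + 2 * (norm (?d \<omega>))\<^sup>2"
        using power2_norm_add_le[of "X z t \<omega>" "?d \<omega>"] by simp
      have "(1 + a + b)\<^sup>2 \<le> 3 * (1 + a\<^sup>2 + b\<^sup>2)" for a b :: real
        using zero_le_power2[of "a - 1"] zero_le_power2[of "b - 1"] zero_le_power2[of "a - b"]
        by (simp add: power2_eq_square algebra_simps)
      from order_trans[OF this] a
      show "(norm (?w \<omega>))\<^sup>2 \<le> 3 * (1 + 3 * (norm (X z t \<omega>))\<^sup>2 + 2 * (norm (?d \<omega>))\<^sup>2)" by simp
    qed (use sw sq in \<open>auto simp: sqint_def\<close>)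
    also have "\<dots> = 3 * (1 + 3 * expectation (\<lambda>\<omega>. (norm (X z t \<omega>))\<^sup>2) + 2 * m)"
      using sq by (simp add: m_def prob_space)
    finally show ?thesis using C0 by simp
  qed
  have "\<bar>mean_cost x t - mean_cost z t\<bar> = \<bar>expectation (\<lambda>\<omega>. g (X x t \<omega>) - g (X z t \<omega>))\<bar>"
    using g_X_integrable[OF t] by simp
  also have "\<dots> \<le> expectation (\<lambda>\<omega>. \<bar>g (X x t \<omega>) - g (X z t \<omega>)\<bar>)"
    using integral_abs_bound[of M "\<lambda>\<omega>. g (X x t \<omega>) - g (X z t \<omega>)"] .
  also have "\<dots> \<le> expectation (\<lambda>\<omega>. L * (norm (?d \<omega>) * norm (?w \<omega>)))"
    using int g_X_integrable[OF t] g_lip by (intro integral_mono) (auto simp: abs_of_nonneg add_nonneg_nonneg)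
  also have "\<dots> \<le> L * (L2norm M ?d * L2norm M ?w)"
    using Cauchy_Schwarz_L2[OF sd sw] L_nonneg by (simp add: mult_left_mono)
  also have "\<dots> = L * sqrt (m * expectation (\<lambda>\<omega>. (norm (?w \<omega>))\<^sup>2))"
    by (simp add: L2norm_def m_def real_sqrt_mult)
  also have "\<dots> \<le> L * sqrt (m * (3 * (1 + 3 * C0 + 2 * m)))"
    using w2 L_nonneg by (intro mult_left_mono real_sqrt_le_mono) (auto simp: m_def)
  finally show ?thesis .
qed

theorem mean_cost_tendsto: "(mean_cost z \<longlongrightarrow> (LINT y|\<pi>. g y)) at_top"
proof -
  obtain C where C: "C \<ge> 0"
    "\<And>x z t. t \<ge> 0 \<Longrightarrow> expectation (\<lambda>\<omega>. (norm (X x t \<omega> - X z t \<omega>))\<^sup>2) \<le> C * (norm (x - z))\<^sup>2"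
    using mean_square_contraction by blast
  obtain C0 where C0: "C0 \<ge> 0" "\<And>t. t \<ge> 0 \<Longrightarrow> expectation (\<lambda>\<omega>. (norm (X z t \<omega>))\<^sup>2) \<le> C0"
    using mean_square_bounded by blast
  let ?m = "\<lambda>x t. expectation (\<lambda>\<omega>. (norm (X x t \<omega> - X z t \<omega>))\<^sup>2)"
  \<comment> \<open>The processes are controlled at nonnegative times only, while the convergence
    theorem wants measurability for all t; hence \<open>max 0 t\<close>.\<close>
  let ?D = "\<lambda>t x. mean_cost x (max 0 t) - mean_cost z (max 0 t)"
  \<comment> \<open>The square root in \<open>bd\<close> is at most 3 (1 + 3 C0) + 3 m, and m <= C
    |x - z|^2. So w is quadratic in x and integrable by the second moment of
    \<open>\<pi>\<close>.\<close>
  define w where "w = (\<lambda>x. L * (3 * (1 + 3 * C0) + 3 * C * (norm (x - z))\<^sup>2))"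
  have bd: "\<bar>?D t x\<bar> \<le> L * sqrt (?m x (max 0 t) * (3 * (1 + 3 * C0 + 2 * ?m x (max 0 t))))" for t x
    by (rule mean_cost_difference) (simp, rule C0, simp)
  have "((\<lambda>t. LINT x|\<pi>. ?D t x) \<longlongrightarrow> (LINT x|\<pi>. 0)) at_top"
  proof (rule integral_dominated_convergence_at_top[where w=w])
    show "?D t \<in> borel_measurable \<pi>" for t
      using stationary_mean_cost(1)[of "max 0 t"] by simp
    have "((\<lambda>t. ?D t x) \<longlongrightarrow> 0) at_top" for x
    proof (rule Lim_null_comparison[OF always_eventually[OF allI]])
      show "norm (?D t x) \<le> L * sqrt (?m x (max 0 t) * (3 * (1 + 3 * C0 + 2 * ?m x (max 0 t))))" for t
        using bd by simp
      have "filterlim (\<lambda>t::real. max 0 t) at_top at_top"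
        by (rule filterlim_at_top_mono[OF filterlim_ident]) auto
      from filterlim_compose[OF mean_square_attraction this]
      have "((\<lambda>t. ?m x (max 0 t)) \<longlongrightarrow> 0) at_top" .
      then have "((\<lambda>t. L * sqrt (?m x (max 0 t) * (3 * (1 + 3 * C0 + 2 * ?m x (max 0 t))))) \<longlongrightarrow> L * sqrt (0 * (3 * (1 + 3 * C0 + 2 * 0)))) at_top"
        by (intro tendsto_intros)
      then show "((\<lambda>t. L * sqrt (?m x (max 0 t) * (3 * (1 + 3 * C0 + 2 * ?m x (max 0 t))))) \<longlongrightarrow> 0) at_top" by simp
    qed
    then show "AE x in \<pi>. ((\<lambda>t. ?D t x) \<longlongrightarrow> 0) at_top" by simp
    have "norm (?D t x) \<le> w x" for t x
    proof -
      define m where "m = ?m x (max 0 t)"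
      have m: "0 \<le> m" "m \<le> C * (norm (x - z))\<^sup>2" using C(2)[of "max 0 t" x z] by (auto simp: m_def)
      have "m * (3 * (1 + 3 * C0 + 2 * m)) \<le> (3 * (1 + 3 * C0) + 3 * m)\<^sup>2"
        using m C0(1) mult_nonneg_nonneg[OF m(1) C0(1)] by (simp add: power2_eq_square algebra_simps)
      then have "sqrt (m * (3 * (1 + 3 * C0 + 2 * m))) \<le> 3 * (1 + 3 * C0) + 3 * m"
        using m C0 by (intro real_le_lsqrt) auto
      also have "\<dots> \<le> 3 * (1 + 3 * C0) + 3 * C * (norm (x - z))\<^sup>2" using m by simp
      finally have "L * sqrt (m * (3 * (1 + 3 * C0 + 2 * m))) \<le> w x"
        unfolding w_def using L_nonneg by (rule mult_left_mono)
      then show ?thesis using bd[of x t] by (simp add: m_def)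
    qed
    then show "\<forall>\<^sub>F t in at_top. AE x in \<pi>. norm (?D t x) \<le> w x" by simp
    have "sqint \<pi> (\<lambda>x. x - z)" by (intro sqint_diff sqint_\<pi> \<pi>.sqint_const)
    then show "integrable \<pi> w" unfolding w_def by (simp add: sqint_def)
  qed auto
  moreover have "(LINT x|\<pi>. ?D t x) = (LINT y|\<pi>. g y) - mean_cost z (max 0 t)" for t
    using stationary_mean_cost[of "max 0 t"] by (simp add: \<pi>.prob_space)
  ultimately have "((\<lambda>t. (LINT y|\<pi>. g y) - mean_cost z (max 0 t)) \<longlongrightarrow> 0) at_top" by simp
  then have "((\<lambda>t. (LINT y|\<pi>. g y) - ((LINT y|\<pi>. g y) - mean_cost z (max 0 t))) \<longlongrightarrow> (LINT y|\<pi>. g y) - 0) at_top"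
    by (intro tendsto_intros)
  then have "((\<lambda>t. mean_cost z (max 0 t)) \<longlongrightarrow> (LINT y|\<pi>. g y)) at_top" by simp
  moreover have "\<forall>\<^sub>F t in at_top. mean_cost z (max 0 t) = mean_cost z t"
    using eventually_ge_at_top[of 0] by eventually_elim simp
  ultimately show ?thesis by (rule Lim_transform_eventually)
qed

end

section \<open>Exchange of expectation and time in the discounted cost\<close>

context ergodic_cost begin

lemma X_joint_half_line:
  "(\<lambda>p. X z (snd p) (fst p)) \<in> borel_measurable (M \<Otimes>\<^sub>M restrict_space lborel {0..})"
proof -
  have sets: "sets (restrict_space lborel {0::real..}) = sets (restrict_space borel {0..})"
    by (rule sets_restrict_space_cong) simp
  show ?thesis
    by (rule continuous_paths_measurable[OF X_meas sde_solution.X_continuous_paths[OF sol] sets]) auto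
qed

lemma g_X_joint:
  "(\<lambda>p. g (X z (snd p) (fst p))) \<in> borel_measurable (M \<Otimes>\<^sub>M restrict_space lborel {0..})"
  by (rule measurable_compose[OF X_joint_half_line g_meas])

lemma mean_cost_measurable: "(\<lambda>t. indicat_real {0..} t * mean_cost z t) \<in> borel_measurable borel"
proof -
  have "case_prod (\<lambda>t \<omega>. g (X z t \<omega>)) \<in> borel_measurable (restrict_space lborel {0..} \<Otimes>\<^sub>M M)"
    using measurable_pair_swap[OF g_X_joint[of z]] by (simp add: split_beta')
  then have "mean_cost z \<in> borel_measurable (restrict_space lborel {0..})"
    by (rule borel_measurable_lebesgue_integral)
  then show ?thesis by (subst (asm) borel_measurable_restrict_space_iff) (auto simp: mult.commute)
qed

text \<open>With the absolute value inside the expectation, the bound serves both as the majorant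
  for Fubini and as the boundedness required by \<open>abelian_limit\<close>.\<close>

lemma mean_cost_bound:
  obtains C where "\<And>t. t \<ge> 0 \<Longrightarrow> expectation (\<lambda>\<omega>. \<bar>g (X z t \<omega>)\<bar>) \<le> C"
proof -
  obtain C0 where C0: "C0 \<ge> 0" "\<And>t. t \<ge> 0 \<Longrightarrow> expectation (\<lambda>\<omega>. (norm (X z t \<omega>))\<^sup>2) \<le> C0"
    using mean_square_bounded by blast
  have "expectation (\<lambda>\<omega>. \<bar>g (X z t \<omega>)\<bar>) \<le> growth * (1 + C0)" if t: "t \<ge> 0" for t
  proof -
    have "expectation (\<lambda>\<omega>. \<bar>g (X z t \<omega>)\<bar>) \<le> expectation (\<lambda>\<omega>. growth * (1 + (norm (X z t \<omega>))\<^sup>2))"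
      using g_X_integrable[OF t] X_sq[OF t] g_growth by (intro integral_mono) (auto simp: sqint_def)
    also have "\<dots> = growth * (1 + expectation (\<lambda>\<omega>. (norm (X z t \<omega>))\<^sup>2))"
      using X_sq[OF t, of z] by (simp add: sqint_def prob_space)
    also have "\<dots> \<le> growth * (1 + C0)" using C0(2)[OF t] growth_nonneg by (simp add: mult_left_mono)
    finally show ?thesis .
  qed
  then show thesis by (rule that)
qed

text \<open>The integrand is absolutely integrable on the product, its mean at time t being at most
  C exp (- r t).\<close>

lemma discounted_cost_Fubini:
  assumes r: "r > 0"
  shows "(LINT \<omega>|M. (LBINT t:{0..}. exp (- r * t) * g (X z t \<omega>))) = (LBINT t:{0..}. exp (- r * t) * mean_cost z t)"
proof -
  let ?N = "restrict_space lborel {0::real..}"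
  let ?f = "\<lambda>\<omega> t. exp (- r * t) * g (X z t \<omega>)"
  interpret N: sigma_finite_measure ?N
    by (rule sigma_finite_measure_restrict_space) (auto intro: sigma_finite_lborel)
  interpret P: pair_sigma_finite M ?N by unfold_locales
  obtain C where C: "\<And>t. t \<ge> 0 \<Longrightarrow> expectation (\<lambda>\<omega>. \<bar>g (X z t \<omega>)\<bar>) \<le> C"
    using mean_cost_bound by blast
  have m: "case_prod ?f \<in> borel_measurable (M \<Otimes>\<^sub>M ?N)"
  proof -
    have "(\<lambda>t. exp (- r * t)) \<in> borel_measurable ?N"
      by (rule measurable_restrict_space1) simp
    from borel_measurable_times[OF measurable_compose[OF measurable_snd this] g_X_joint[of z]] show ?thesis
      by (simp add: split_beta')
  qed
  have "integrable (M \<Otimes>\<^sub>M ?N) (case_prod ?f)"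
  proof (rule integrableI_bounded[OF m])
    have "(\<integral>\<^sup>+p. ennreal (norm (case_prod ?f p)) \<partial>(M \<Otimes>\<^sub>M ?N)) = (\<integral>\<^sup>+t. (\<integral>\<^sup>+\<omega>. ennreal (norm (?f \<omega> t)) \<partial>M) \<partial>?N)"
      using P.nn_integral_snd[of "\<lambda>p. ennreal (norm (case_prod ?f p))"] m by simp
    also have "\<dots> \<le> (\<integral>\<^sup>+t. ennreal (exp (- r * t) * C) \<partial>?N)"
    proof (rule nn_integral_mono)
      fix t assume "t \<in> space ?N"
      then have t: "t \<ge> 0" by (simp add: space_restrict_space)
      have "(\<integral>\<^sup>+\<omega>. ennreal (norm (?f \<omega> t)) \<partial>M) = ennreal (expectation (\<lambda>\<omega>. exp (- r * t) * \<bar>g (X z t \<omega>)\<bar>))"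
        using g_X_integrable[OF t] by (subst nn_integral_eq_integral[symmetric]) (auto simp: abs_mult)
      also have "\<dots> \<le> ennreal (exp (- r * t) * C)"
        using C[OF t] by (intro ennreal_leI) simp
      finally show "(\<integral>\<^sup>+\<omega>. ennreal (norm (?f \<omega> t)) \<partial>M) \<le> ennreal (exp (- r * t) * C)" .
    qed
    also have "\<dots> < \<infinity>"
    proof -
      have "integrable ?N (\<lambda>t. exp (- r * t) * C)"
        using exponential_integrable[OF r]
        by (intro Bochner_Integration.integrable_mult_left) (simp add: integrable_restrict_space set_integrable_def)
      then have "(\<integral>\<^sup>+t. ennreal (norm (exp (- r * t) * C)) \<partial>?N) < \<infinity>"
        unfolding integrable_iff_bounded by (rule conjunct2)
      moreover have "(\<integral>\<^sup>+t. ennreal (exp (- r * t) * C) \<partial>?N) \<le> (\<integral>\<^sup>+t. ennreal (norm (exp (- r * t) * C)) \<partial>?N)"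
        by (intro nn_integral_mono ennreal_leI) simp
      ultimately show ?thesis by (rule le_less_trans[rotated])
    qed
    finally show "(\<integral>\<^sup>+p. ennreal (norm (case_prod ?f p)) \<partial>(M \<Otimes>\<^sub>M ?N)) < \<infinity>" .
  qed
  from P.Fubini_integral[OF this]
  have "(LINT \<omega>|M. LINT t|?N. ?f \<omega> t) = (LINT t|?N. exp (- r * t) * mean_cost z t)" by simp
  moreover have "(LINT t|?N. k t) = (LBINT t:{0..}. k t)" for k :: "real \<Rightarrow> real"
    unfolding set_lebesgue_integral_def by (rule integral_restrict_space) simp
  ultimately show ?thesis by simp
qed

theorem discounted_limit:
  "((\<lambda>r. r * (LINT \<omega>|M. (LBINT t:{0..}. exp (- r * t) * g (X z t \<omega>)))) \<longlongrightarrow> (LINT y|\<pi>. g y)) (at_right 0)"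
proof -
  obtain C where C: "\<And>t. t \<ge> 0 \<Longrightarrow> expectation (\<lambda>\<omega>. \<bar>g (X z t \<omega>)\<bar>) \<le> C"
    using mean_cost_bound by blast
  have "\<bar>mean_cost z t\<bar> \<le> C" if "t \<ge> 0" for t
    using order_trans[OF integral_abs_bound C[OF that]] .
  from abelian_limit[OF mean_cost_measurable this mean_cost_tendsto]
  have "((\<lambda>r. r * (LBINT t:{0..}. exp (- r * t) * mean_cost z t)) \<longlongrightarrow> (LINT y|\<pi>. g y)) (at_right 0)" .
  moreover have "\<forall>\<^sub>F r in at_right 0. r * (LBINT t:{0..}. exp (- r * t) * mean_cost z t) =
      r * (LINT \<omega>|M. (LBINT t:{0..}. exp (- r * t) * g (X z t \<omega>)))"
    using eventually_at_right_less[of "0::real"] by eventually_elim (simp only: discounted_cost_Fubini)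
  ultimately show ?thesis by (rule Lim_transform_eventually)
qed

end

section \<open>The quadratic running cost and the limit inferior\<close>

text \<open>g y - g z = B (y - z) y + B z (y - z) + l (y - z), and each term has a factor |y -
  z|.\<close>

lemma quadratic_local_lipschitz:
  fixes B :: "real^'n \<Rightarrow> real^'n \<Rightarrow> real" and l :: "real^'n \<Rightarrow> real"
  assumes "bounded_bilinear B" "bounded_linear l" "\<And>y. g y = B y y + l y + c"
  obtains L where "local_lipschitz_cost g L"
proof -
  interpret B: bounded_bilinear B by fact
  interpret l: bounded_linear l by fact
  obtain K where K: "K \<ge> 0" "\<And>y z. norm (B y z) \<le> norm y * norm z * K" using B.nonneg_bounded by blast
  obtain J where J: "J \<ge> 0" "\<And>y. norm (l y) \<le> norm y * J" using l.nonneg_bounded by blast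
  have "local_lipschitz_cost g (K + J)"
  proof
    fix y z
    have "g y - g z = B (y - z) y + B z (y - z) + l (y - z)"
      by (simp add: assms(3) B.diff_left B.diff_right l.diff)
    then have "\<bar>g y - g z\<bar> \<le> norm (y - z) * norm y * K + norm z * norm (y - z) * K + norm (y - z) * J"
      using K(2)[of "y - z" y] K(2)[of z "y - z"] J(2)[of "y - z"] by (simp only: real_norm_def)
    also have "\<dots> = (norm (y - z) * (norm y + norm z)) * K + norm (y - z) * J" by (simp add: algebra_simps)
    also have "\<dots> \<le> (norm (y - z) * (1 + norm y + norm z)) * K + (norm (y - z) * (1 + norm y + norm z)) * J"
      using K(1) J(1) by (intro add_mono mult_right_mono mult_left_mono) (auto simp: mult_le_cancel_left1)
    finally show "\<bar>g y - g z\<bar> \<le> (K + J) * (norm (y - z) * (1 + norm y + norm z))" by (simp add: algebra_simps)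
  next
    have "continuous_on UNIV (\<lambda>y. B y y + l y + c)"
      by (intro continuous_intros B.continuous_on l.continuous_on)
    then show "g \<in> borel_measurable borel"
      unfolding assms(3)[abs_def] by (rule borel_measurable_continuous_onI)
  qed (use K J in simp)
  then show thesis by (rule that)
qed

lemma running_cost_local_lipschitz:
  fixes Q :: "real^'n^'n" and S :: "real^'n^'m" and R :: "real^'m^'m" and \<Theta> :: "real^'n^'m"
  obtains L where "local_lipschitz_cost (\<lambda>y. running_cost Q S R q \<rho> y (\<Theta> *v y + v)) L"
proof -
  \<comment> \<open>Putting u = \<open>\<Theta> *v y + v\<close> into the cost and collecting by
    degree in y: \<open>?B\<close> is the quadratic part, \<open>?l\<close> the linear one.\<close>
  let ?B = "\<lambda>y z. (Q *v y) \<bullet> z + 2 * ((S *v y) \<bullet> (\<Theta> *v z)) + (R *v (\<Theta> *v y)) \<bullet> (\<Theta> *v z)"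
  let ?l = "\<lambda>y. 2 * ((S *v y) \<bullet> v) + (R *v (\<Theta> *v y)) \<bullet> v + (R *v v) \<bullet> (\<Theta> *v y) + 2 * (q \<bullet> y) + 2 * (\<rho> \<bullet> (\<Theta> *v y))"
  have "bilinear ?B"
    unfolding bilinear_def
    by (intro conjI allI linearI)
       (simp_all add: matrix_vector_right_distrib inner_add_left inner_add_right matrix_vector_mult_scaleR algebra_simps)
  then have B: "bounded_bilinear ?B" by (simp add: bilinear_conv_bounded_bilinear)
  have "linear ?l"
    by (rule linearI)
       (simp_all add: matrix_vector_right_distrib inner_add_left inner_add_right matrix_vector_mult_scaleR algebra_simps)
  then have l: "bounded_linear ?l" by (simp add: linear_conv_bounded_linear)
  have "running_cost Q S R q \<rho> y (\<Theta> *v y + v) = ?B y y + ?l y + ((R *v v) \<bullet> v + 2 * (\<rho> \<bullet> v))" for y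
    by (simp add: running_cost_def matrix_vector_right_distrib inner_add_left inner_add_right)
  from quadratic_local_lipschitz[OF B l this] show thesis using that by blast
qed

theorem mainTheorem4:
  fixes M :: "'w measure" and W :: "real \<Rightarrow> 'w \<Rightarrow> real"
    and A C :: "real^'n^'n" and B D :: "real^'m^'n" and b \<sigma> :: "real^'n"
    and Q :: "real^'n^'n" and S :: "real^'n^'m" and R :: "real^'m^'m"
    and q :: "real^'n" and \<rho> :: "real^'m"
    and \<Theta> :: "real^'n^'m" and v :: "real^'m"
    and X :: "real^'n \<Rightarrow> real \<Rightarrow> 'w \<Rightarrow> real^'n" and \<pi> :: "(real^'n) measure"
  assumes "standard_brownian M W"
    and "transpose Q = Q" and "transpose R = R"
    and "stabilizers M W A C B D \<noteq> {}"
    and "(\<Theta>, v) \<in> strategies M W A C B D"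
    and "\<And>x. solves_sde M W (A + B ** \<Theta>) (B *v v + b) (C + D ** \<Theta>) (D *v v + \<sigma>) x (X x)"
    and "invariant_prob M X \<pi>"
  shows "\<forall>x. Liminf (at_right 0)
           (\<lambda>r. ereal (r * discounted_cost M (running_cost Q S R q \<rho>) \<Theta> v r (X x)))
         = ereal (LINT y|\<pi>. running_cost Q S R q \<rho> y (\<Theta> *v y + v))"
proof -
  let ?g = "\<lambda>y. running_cost Q S R q \<rho> y (\<Theta> *v y + v)"
  obtain L where "local_lipschitz_cost ?g L" by (rule running_cost_local_lipschitz)
  then interpret cost: local_lipschitz_cost ?g L .
  \<comment> \<open>Unfolding \<open>stabilizers\<close> yields the assumption
    \<open>stable\<close>, since its equation is the one with f = h = 0.\<close>
  interpret ergodic_cost M W "A + B ** \<Theta>" "C + D ** \<Theta>" "B *v v + b" "D *v v + \<sigma>" X \<pi> ?g L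
    using assms by unfold_locales (auto simp: strategies_def stabilizers_def)
  show ?thesis
  proof
    fix x
    from discounted_limit[of x]
    have "((\<lambda>r. ereal (r * discounted_cost M (running_cost Q S R q \<rho>) \<Theta> v r (X x))) \<longlongrightarrow> ereal (LINT y|\<pi>. ?g y)) (at_right 0)"
      unfolding discounted_cost_def by (rule tendsto_ereal)
    \<comment> \<open>The filter \<open>at_right 0\<close> is nontrivial, so a limit along it is
      also the limit inferior.\<close>
    then show "Liminf (at_right 0) (\<lambda>r. ereal (r * discounted_cost M (running_cost Q S R q \<rho>) \<Theta> v r (X x)))
         = ereal (LINT y|\<pi>. ?g y)"
      by (rule lim_imp_Liminf[rotated]) simp
  qed
qed

end
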